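(* For all $j,j'\in\frac12\mathbb N$, $$\big[\mathbf T^{(j)}(u),\mathbf T^{(j')}(v)\big]=0.$$
   Context: **Conventions.** $q\in\mathbb C^*$ is not a root of unity, $\mathbb N=\{0,1,\dots\}$, $[n]_q=\frac{q^n-q^{-n}}{q-q^{-1}}$, $[X,Y]_q=qXY-q^{-1}YX$, $c(u)=u-u^{-1}$. $A((u^{-1}))$ denotes formal Laurent series in $u^{-1}$ with coefficients in $A$; rational functions $1/p(u)$ are expanded in $u^{-1}$. $X_1=X\otimes\mathbb I$, $X_2=\mathbb I\otimes X$; $u,v$ are indeterminates. **Algebra $\mathcal A_q$.** Fix $k_\pm\in\mathbb C^*$, $\rho=k_+k_-(q+q^{-1})^2$. $\mathcal A_q$ is the unital associative $\mathbb C$-algebra generated by $\mathsf W_{-k},\mathsf W_{k+1},\mathsf G_{k+1},\tilde{\mathsf G}_{k+1}$ ($k\in\mathbb N$) with, for all $k,l\in\mathbb N$: $[\mathsf W_0,\mathsf W_{k+1}]=[\mathsf W_{-k},\mathsf W_1]=\frac{\tilde{\mathsf G}_{k+1}-\mathsf G_{k+1}}{q+q^{-1}}$; $[\mathsf W_0,\mathsf G_{k+1}]_q=[\tilde{\mathsf G}_{k+1},\mathsf W_0]_q=\rho(\mathsf W_{-k-1}-\mathsf W_{k+1})$; $[\mathsf G_{k+1},\mathsf W_1]_q=[\mathsf W_1,\tilde{\mathsf G}_{k+1}]_q=\rho(\mathsf W_{k+2}-\mathsf W_{-k})$; $[\mathsf W_{-k},\mathsf W_{-l}]=[\mathsf W_{k+1},\mathsf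 W_{l+1}]=[\mathsf G_{k+1},\mathsf G_{l+1}]=[\tilde{\mathsf G}_{k+1},\tilde{\mathsf G}_{l+1}]=0$; $[\mathsf W_{-k},\mathsf W_{l+1}]+[\mathsf W_{k+1},\mathsf W_{-l}]=0$; $[\mathsf W_{-k},\mathsf G_{l+1}]+[\mathsf G_{k+1},\mathsf W_{-l}]=0$; $[\mathsf W_{-k},\tilde{\mathsf G}_{l+1}]+[\tilde{\mathsf G}_{k+1},\mathsf W_{-l}]=0$; $[\mathsf W_{k+1},\mathsf G_{l+1}]+[\mathsf G_{k+1},\mathsf W_{l+1}]=0$; $[\mathsf W_{k+1},\tilde{\mathsf G}_{l+1}]+[\tilde{\mathsf G}_{k+1},\mathsf W_{l+1}]=0$; $[\tilde{\mathsf G}_{k+1},\mathsf G_{l+1}]+[\mathsf G_{k+1},\tilde{\mathsf G}_{l+1}]=0$. Put $U=\frac{qu^2+q^{-1}u^{-2}}{q+q^{-1}}$ and $\mathsf W_+(u)=\sum_{k\ge0}\mathsf W_{-k}U^{-k-1}$, $\mathsf W_-(u)=\sum_{k\ge0}\mathsf W_{k+1}U^{-k-1}$, $\mathsf G_+(u)=\sum_{k\ge0}\mathsf G_{k+1}U^{-k-1}$, $\mathsf G_-(u)=\sum_{k\ge0}\tilde{\mathsf G}_{k+1}U^{-k-1}$, and $$\mathcal K^{(\frac12)}(u)=\begin{pmatrix}uq\mathsf W_+(u)-u^{-1}q^{-1}\mathsf W_-(u)&\frac{\mathsf G_+(u)}{k_-(q+q^{-1})}+\frac{k_+(q+q^{-1})}{q-q^{-1}}\\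 \frac{\mathsf G_-(u)}{k_+(q+q^{-1})}+\frac{k_-(q+q^{-1})}{q-q^{-1}}&uq\mathsf W_-(u)-u^{-1}q^{-1}\mathsf W_+(u)\end{pmatrix}.$$ **Spin matrices, fusion maps, R-matrices.** $B_{j,j'}=\sqrt{[j+j']_q[j-j'+1]_q}$; $(S_+)_{mn}=B_{j,j+1-m}\delta_{m,n-1}$, $(S_-)_{mn}=B_{j,j+1-n}\delta_{m-1,n}$, $(S_3)_{mn}=2(j+1-n)\delta_{m,n}$. $\mathcal E^{(j)}:\mathbb C^{2j+1}\to\mathbb C^2\otimes\mathbb C^{2j}$ has nonzero entries $\mathcal E_{1,1}=1$, $\mathcal E_{1+n,1+n}=\prod_{p=0}^{n-1}\frac{B_{j-1/2,j-p-1/2}}{B_{j,j-p}}$ ($1\le n\le2j-1$), $\mathcal E_{2j+m,1+m}=[m]_q\mathcal E_{m,m}/B_{j,j+1-m}$ ($1\le m\le 2j$). $\mathcal F^{(j)}:\mathbb C^2\otimes\mathbb C^{2j}\to\mathbb C^{2j+1}$ has nonzero entries $\mathcal F_{1,1}=1$, $\mathcal F_{n,n+2j-1}=\frac{\mathcal E_{n+2j-1,n}}{\mathcal E_{n,n}^2+\mathcal E_{n+2j-1,n}^2}$, $\mathcal F_{n,n}=\frac{1-\mathcal F_{n,n+2j-1}\mathcal E_{n+2j-1,n}}{\mathcal E_{n,n}}$ ($2\le n\le 2j$), $\mathcal F_{2j+1,4j}=\mathcal E_{4j,2j+1}^{-1}$. $R^{(\frac12,0)}=\mathbb I_2$ and,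 on $\mathbb C^2\otimes\mathbb C^{2j+1}$, $R^{(\frac12,j)}(u)=\prod_{k=0}^{2j-2}c(uq^{j-\frac12-k})\Big((q-q^{-1})(\sigma_+\otimes S_-+\sigma_-\otimes S_+)+uq^{\frac12(\mathbb I+\sigma_z\otimes S_3)}-u^{-1}q^{-\frac12(\mathbb I+\sigma_z\otimes S_3)}\Big)$. **Fused K-operators.** $\mathcal K^{(0)}=1$, $\mathcal K^{(j)}(u)=\mathcal F^{(j)}\mathcal K_1^{(\frac12)}(uq^{-j+\frac12})R^{(\frac12,j-\frac12)}(u^2q^{-j+1})\mathcal K_2^{(j-\frac12)}(uq^{\frac12})\mathcal E^{(j)}$. **Dual K-matrices.** For $\varepsilon_\pm\in\mathbb C$ put $K^{(\frac12)}(u)=\begin{pmatrix}u\varepsilon_++u^{-1}\varepsilon_-&k_+c(u^2)/(q-q^{-1})\\k_-c(u^2)/(q-q^{-1})&u\varepsilon_-+u^{-1}\varepsilon_+\end{pmatrix}$, $K^{(0)}=1$, and $K^{(j)}$ by the same recursion as $\mathcal K^{(j)}$. For $\bar\varepsilon_\pm,\bar k_\pm\in\mathbb C$, $K^{+(j)}(u)=\frac1{f^{(j)}(u)}\big(K^{(j)}(u^{-1}q^{-1})\big)^t$ with the substitution $\varepsilon_\pm\to\bar\varepsilon_\mp$, $k_\pm\to-\bar k_\mp$, where $f^{(j)}(u)=\prod_{k=1}^{2j-1}\prod_{\ell=1}^kc(u^2q^{k+\ell+2-2j})c(u^{-2}q^{-k-\ell+2j})$ ($f^{(0)}=f^{(1/2)}=1$).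 **Generating functions.** $\mathbf T^{(j)}(u)=\mathrm{tr}_{\mathbb C^{2j+1}}\big(K^{+(j)}(u)\mathcal K^{(j)}(u)\big)\in\mathcal A_q((u^{-1}))$, $\mathbf T^{(0)}=1$; the same parameters $\bar\varepsilon_\pm,\bar k_\pm$ are used for all $j$. *)

theory Defs
  imports
    "HOL-Computational_Algebra.Formal_Laurent_Series"
    "HOL-Library.Poly_Mapping"
    "HOL-Algebra.QuotRing"
    "Jordan_Normal_Form.Matrix"
begin

no_notation fls_nth (infixl "$$" 75)

text \<open>
  Conventions. A spin \<open>j\<close> in one half of the natural numbers is represented by the natural number
  \<open>d = 2j\<close>; the representation space of dimension \<open>2j+1\<close> has dimension \<open>d+1\<close>. Half-integer powers of \<open>q\<close> are integer powers of a
  square root \<open>qh\<close> of \<open>q\<close>: an exponent \<open>a/2\<close> is written \<open>qh powi a\<close>.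

  Series in \<open>u\<^sup>-\<^sup>1\<close> are formal Laurent series whose variable \<^const>\<open>fls_X\<close> stands for \<open>u\<^sup>-\<^sup>1\<close>, so \<open>u\<close> itself is
  \<^const>\<open>fls_X_inv\<close>, and inversion in the field of complex Laurent series is expansion in
  \<open>u\<^sup>-\<^sup>1\<close>. A matrix \<open>M(u)\<close> is given as a function of a spectral parameter \<open>x\<close> ranging over this field;
  \<open>M(uc)\<close>, \<open>M(u\<^sup>2c)\<close>, \<open>M(u\<^sup>-\<^sup>1c)\<close> are its values at the corresponding field elements.
\<close>

section \<open>The algebra\<close>

text \<open>\<open>gW_neg k\<close>, \<open>gW_pos k\<close>, \<open>gG k\<close>, \<open>gGt k\<close> index the generators
  \<open>W\<close> with subscript \<open>-k\<close>, \<open>W\<close> with subscript \<open>k+1\<close>, \<open>G\<close> with subscript \<open>k+1\<close>, and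
  \<open>G\<close>-tilde with subscript \<open>k+1\<close>.\<close>

datatype gen = gW_neg nat | gW_pos nat | gG nat | gGt nat

datatype gword = Word "gen list"

instantiation gword :: monoid_add
begin

definition zero_gword :: gword where "0 = Word []"

fun plus_gword :: "gword \<Rightarrow> gword \<Rightarrow> gword" where
  "Word xs + Word ys = Word (xs @ ys)"

instance
proof
  fix a b c :: gword
  show "a + b + c = a + (b + c)" by (cases a; cases b; cases c) simp
  show "0 + a = a" by (cases a) (simp add: zero_gword_def)
  show "a + 0 = a" by (cases a) (simp add: zero_gword_def)
qed

end

text \<open>The free unital complex algebra on the generators is the monoid algebra of the free monoid of
  words (the monoid is written additively, as \<^typ>\<open>'a \<Rightarrow>\<^sub>0 'b\<close> requires).\<close>

type_synonym free_alg = "gword \<Rightarrow>\<^sub>0 complex"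

definition fscal :: "complex \<Rightarrow> free_alg" where
  "fscal c = Poly_Mapping.single 0 c"

definition fgen :: "gen \<Rightarrow> free_alg" where
  "fgen g = Poly_Mapping.single (Word [g]) 1"

abbreviation Wneg :: "nat \<Rightarrow> free_alg" where "Wneg k \<equiv> fgen (gW_neg k)"
abbreviation Wpos :: "nat \<Rightarrow> free_alg" where "Wpos k \<equiv> fgen (gW_pos k)"
abbreviation Gen :: "nat \<Rightarrow> free_alg" where "Gen k \<equiv> fgen (gG k)"
abbreviation Gtil :: "nat \<Rightarrow> free_alg" where "Gtil k \<equiv> fgen (gGt k)"

definition comm :: "'a::ring \<Rightarrow> 'a \<Rightarrow> 'a" where
  "comm a b = a * b - b * a"

definition qcomm :: "complex \<Rightarrow> free_alg \<Rightarrow> free_alg \<Rightarrow> free_alg" where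
  "qcomm q a b = fscal q * a * b - fscal (inverse q) * b * a"

definition rho :: "complex \<Rightarrow> complex \<Rightarrow> complex \<Rightarrow> complex" where
  "rho q kp km = kp * km * (q + inverse q)\<^sup>2"

text \<open>The defining relations, as pairs of a left and a right hand side.\<close>

definition Aq_relations :: "complex \<Rightarrow> complex \<Rightarrow> complex \<Rightarrow> (free_alg \<times> free_alg) set" where
  "Aq_relations q kp km =
    (\<Union>k l.
      {(comm (Wneg 0) (Wpos k), fscal (1 / (q + inverse q)) * (Gtil k - Gen k)),
       (comm (Wneg k) (Wpos 0), fscal (1 / (q + inverse q)) * (Gtil k - Gen k)),
       (qcomm q (Wneg 0) (Gen k), fscal (rho q kp km) * (Wneg (k+1) - Wpos k)),
       (qcomm q (Gtil k) (Wneg 0), fscal (rho q kp km) * (Wneg (k+1) - Wpos k)),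
       (qcomm q (Gen k) (Wpos 0), fscal (rho q kp km) * (Wpos (k+1) - Wneg k)),
       (qcomm q (Wpos 0) (Gtil k), fscal (rho q kp km) * (Wpos (k+1) - Wneg k)),
       (comm (Wneg k) (Wneg l), 0),
       (comm (Wpos k) (Wpos l), 0),
       (comm (Gen k) (Gen l), 0),
       (comm (Gtil k) (Gtil l), 0),
       (comm (Wneg k) (Wpos l) + comm (Wpos k) (Wneg l), 0),
       (comm (Wneg k) (Gen l) + comm (Gen k) (Wneg l), 0),
       (comm (Wneg k) (Gtil l) + comm (Gtil k) (Wneg l), 0),
       (comm (Wpos k) (Gen l) + comm (Gen k) (Wpos l), 0),
       (comm (Wpos k) (Gtil l) + comm (Gtil k) (Wpos l), 0),
       (comm (Gtil k) (Gen l) + comm (Gen k) (Gtil l), 0)})"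

definition free_ring :: "free_alg ring" where
  "free_ring = \<lparr>carrier = UNIV, mult = (*), one = 1, zero = 0, add = (+)\<rparr>"

text \<open>The ideal contains every scalar multiple of each of its elements because the scalars
  \<open>fscal c\<close> lie in the free algebra; hence the quotient ring is the quotient algebra.\<close>

definition Aq_ideal :: "complex \<Rightarrow> complex \<Rightarrow> complex \<Rightarrow> free_alg set" where
  "Aq_ideal q kp km = Idl\<^bsub>free_ring\<^esub> {a - b |a b. (a, b) \<in> Aq_relations q kp km}"

definition Aq :: "complex \<Rightarrow> complex \<Rightarrow> complex \<Rightarrow> free_alg set ring" where
  "Aq q kp km = free_ring Quot Aq_ideal q kp km"

definition Aq_proj :: "complex \<Rightarrow> complex \<Rightarrow> complex \<Rightarrow> free_alg \<Rightarrow> free_alg set" where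
  "Aq_proj q kp km a = Aq_ideal q kp km +>\<^bsub>free_ring\<^esub> a"

section \<open>Matrices\<close>

text \<open>Kronecker product in the lexicographic basis order; \<open>X\<^sub>1\<close> and \<open>X\<^sub>2\<close> are
  \<open>kron X (1\<^sub>m n)\<close> and \<open>kron (1\<^sub>m n) X\<close>.\<close>

definition kron :: "'a::times mat \<Rightarrow> 'a mat \<Rightarrow> 'a mat" where
  "kron A B = mat (dim_row A * dim_row B) (dim_col A * dim_col B)
     (\<lambda>(i, j). A $$ (i div dim_row B, j div dim_col B) * B $$ (i mod dim_row B, j mod dim_col B))"

definition mat_trace :: "'a::comm_monoid_add mat \<Rightarrow> 'a" where
  "mat_trace A = (\<Sum>i<dim_row A. A $$ (i, i))"

text \<open>Matrix given by a function of one-based indices.\<close>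

definition mat1 :: "nat \<Rightarrow> nat \<Rightarrow> (nat \<Rightarrow> nat \<Rightarrow> 'a) \<Rightarrow> 'a mat" where
  "mat1 r c f = mat r c (\<lambda>(i, j). f (i + 1) (j + 1))"

text \<open>Coefficientwise application; meant for \<open>h 0 = 0\<close>.\<close>

definition fls_map :: "('a::zero \<Rightarrow> 'b::zero) \<Rightarrow> 'a fls \<Rightarrow> 'b fls" where
  "fls_map h f = Abs_fls (\<lambda>n. h (fls_nth f n))"

lemma fls_nth_fls_map:
  assumes "h 0 = 0"
  shows "fls_nth (fls_map h f) n = h (fls_nth f n)"
  unfolding fls_map_def
  by (rule nth_Abs_fls_lower_bound[where N = "fls_subdegree f"]) (simp add: assms)

definition qnum :: "complex \<Rightarrow> int \<Rightarrow> complex" where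
  "qnum q n = (q powi n - q powi (- n)) / (q - inverse q)"

definition cfun :: "complex fls \<Rightarrow> complex fls" where
  "cfun x = x - inverse x"

text \<open>\<open>Bcoef q d e\<close> is \<open>B\<^sub>j\<^sub>,\<^sub>j\<^sub>'\<close> for \<open>d = 2j\<close>, \<open>e = 2j'\<close>; it is only used for \<open>d\<close> and \<open>e\<close> of equal
  parity, when both divisions are exact.\<close>

definition Bcoef :: "complex \<Rightarrow> int \<Rightarrow> int \<Rightarrow> complex" where
  "Bcoef q d e = csqrt (qnum q ((d + e) div 2) * qnum q ((d - e) div 2 + 1))"

definition S_plus :: "complex \<Rightarrow> nat \<Rightarrow> complex mat" where
  "S_plus q d = mat1 (d+1) (d+1)
     (\<lambda>m n. if n = m + 1 then Bcoef q (int d) (int d + 2 - 2 * int m) else 0)"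

definition S_minus :: "complex \<Rightarrow> nat \<Rightarrow> complex mat" where
  "S_minus q d = mat1 (d+1) (d+1)
     (\<lambda>m n. if m = n + 1 then Bcoef q (int d) (int d + 2 - 2 * int n) else 0)"

definition S_three :: "nat \<Rightarrow> int mat" where
  "S_three d = mat1 (d+1) (d+1) (\<lambda>m n. if m = n then int d + 2 - 2 * int n else 0)"

definition sigma_plus :: "complex mat" where
  "sigma_plus = mat_of_rows_list 2 [[0, 1], [0, 0]]"

definition sigma_minus :: "complex mat" where
  "sigma_minus = mat_of_rows_list 2 [[0, 0], [1, 0]]"

definition sigma_z :: "int mat" where
  "sigma_z = mat_of_rows_list 2 [[1, 0], [0, -1]]"

text \<open>\<open>q\<close> to the power \<open>D/2\<close> for a diagonal integer matrix \<open>D\<close>.\<close>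

definition half_qpow :: "complex \<Rightarrow> int mat \<Rightarrow> complex mat" where
  "half_qpow qh D = mat (dim_row D) (dim_col D) (\<lambda>(i, j). if i = j then qh powi (D $$ (i, i)) else 0)"

text \<open>\<open>Rmat q qh d x\<close> is \<open>R\<close> of spins \<open>(1/2, j)\<close> for \<open>d = 2j\<close>.\<close>

definition Rmat :: "complex \<Rightarrow> complex \<Rightarrow> nat \<Rightarrow> complex fls \<Rightarrow> complex fls mat" where
  "Rmat q qh d x =
    (if d = 0 then 1\<^sub>m 2
     else
      (let D = 1\<^sub>m (2 * (d+1)) + kron sigma_z (S_three d) in
       (\<Prod>k<d-1. cfun (x * fls_const (qh powi (int d - 1 - 2 * int k)))) \<cdot>\<^sub>m
       (map_mat fls_const
          ((q - inverse q) \<cdot>\<^sub>m (kron sigma_plus (S_minus q d) + kron sigma_minus (S_plus q d)))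
        + x \<cdot>\<^sub>m map_mat fls_const (half_qpow qh D)
        - inverse x \<cdot>\<^sub>m map_mat fls_const (half_qpow qh (- D)))))"

text \<open>Fusion maps for \<open>d = 2j \<ge> 1\<close>, entries with one-based indices.
  \<open>E_diag q d n\<close> is the entry of \<open>\<E>\<close> at \<open>(n, n)\<close> for \<open>1 \<le> n \<le> d\<close>.\<close>

definition E_diag :: "complex \<Rightarrow> nat \<Rightarrow> nat \<Rightarrow> complex" where
  "E_diag q d n = (\<Prod>p<n-1. Bcoef q (int d - 1) (int d - 2 * int p - 1)
                            / Bcoef q (int d) (int d - 2 * int p))"

definition E_entry :: "complex \<Rightarrow> nat \<Rightarrow> nat \<Rightarrow> nat \<Rightarrow> complex" where
  "E_entry q d i n =
    (if i = n \<and> n \<le> d then E_diag q d n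
     else if 2 \<le> n \<and> i = d + (n - 1)
       then (let m = n - 1 in
         qnum q (int m) * E_diag q d m / Bcoef q (int d) (int d + 2 - 2 * int m))
     else 0)"

definition fus_E :: "complex \<Rightarrow> nat \<Rightarrow> complex mat" where
  "fus_E q d = mat1 (2*d) (d+1) (E_entry q d)"

definition F_off :: "complex \<Rightarrow> nat \<Rightarrow> nat \<Rightarrow> complex" where
  "F_off q d n =
     E_entry q d (n+d-1) n / ((E_entry q d n n)\<^sup>2 + (E_entry q d (n+d-1) n)\<^sup>2)"

definition F_entry :: "complex \<Rightarrow> nat \<Rightarrow> nat \<Rightarrow> nat \<Rightarrow> complex" where
  "F_entry q d n i =
    (if n = 1 \<and> i = 1 then 1
     else if 2 \<le> n \<and> n \<le> d \<and> i = n + d - 1 then F_off q d n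
     else if 2 \<le> n \<and> n \<le> d \<and> i = n
       then (1 - F_off q d n * E_entry q d (n+d-1) n) / E_entry q d n n
     else if n = d + 1 \<and> i = 2*d then inverse (E_entry q d (2*d) (d+1))
     else 0)"

definition fus_F :: "complex \<Rightarrow> nat \<Rightarrow> complex mat" where
  "fus_F q d = mat1 (d+1) (2*d) (F_entry q d)"

section \<open>Fusion\<close>

text \<open>The recursion for spin \<open>j\<close>, \<open>d = 2j\<close>, for a matrix \<open>K\<close> of spin \<open>1/2\<close> with coefficients in a
  (noncommutative) ring into which the complex scalars are mapped by \<open>\<iota>\<close>.\<close>

primrec fused :: "(complex \<Rightarrow> 'a::ring_1) \<Rightarrow> complex \<Rightarrow> complex \<Rightarrow> (complex fls \<Rightarrow> 'a fls mat)
    \<Rightarrow> nat \<Rightarrow> complex fls \<Rightarrow> 'a fls mat" where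
  "fused \<iota> q qh K 0 = (\<lambda>x. 1\<^sub>m 1)"
| "fused \<iota> q qh K (Suc d') = (\<lambda>x. let d = Suc d' in
     map_mat (\<lambda>c. fls_const (\<iota> c)) (fus_F q d)
     * kron (K (x * fls_const (qh powi (1 - int d)))) (1\<^sub>m d)
     * map_mat (fls_map \<iota>) (Rmat q qh d' (x\<^sup>2 * fls_const (qh powi (2 - int d))))
     * kron (1\<^sub>m 2) (fused \<iota> q qh K d' (x * fls_const qh))
     * map_mat (\<lambda>c. fls_const (\<iota> c)) (fus_E q d))"

definition Ufun :: "complex \<Rightarrow> complex fls \<Rightarrow> complex fls" where
  "Ufun q x = (fls_const q * x\<^sup>2 + fls_const (inverse q) * (inverse x)\<^sup>2) / fls_const (q + inverse q)"

text \<open>The series \<open>\<Sum>k\<ge>0. a\<^sub>k U(x)\<^sup>-\<^sup>k\<^sup>-\<^sup>1\<close>, used for \<open>x\<close> a nonzero scalar multiple of \<open>u\<close>. Then the inverse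
  of \<open>U(x)\<close> has order 2 in \<open>u\<^sup>-\<^sup>1\<close> (\<open>inverse_Ufun_order\<close> below), so only terms with \<open>k < n\<close> contribute
  to the coefficient of \<open>u\<^sup>-\<^sup>n\<close>.\<close>

definition gen_series :: "complex \<Rightarrow> (nat \<Rightarrow> free_alg) \<Rightarrow> complex fls \<Rightarrow> free_alg fls" where
  "gen_series q a x =
     Abs_fls (\<lambda>n. \<Sum>k<nat n. fscal (fls_nth (inverse (Ufun q x) ^ (k+1)) n) * a k)"

lemma fls_nth_gen_series:
  "fls_nth (gen_series q a x) n =
     (\<Sum>k<nat n. fscal (fls_nth (inverse (Ufun q x) ^ (k+1)) n) * a k)"
  unfolding gen_series_def by (rule nth_Abs_fls_lower_bound[where N = 0]) simp

lemma inverse_Ufun_order: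
  assumes "c \<noteq> 0" "q \<noteq> 0" "q + inverse q \<noteq> 0"
  shows "fls_subdegree (inverse (Ufun q (fls_X_inv * fls_const c))) = 2"
proof -
  define A where "A = fls_const (q * c\<^sup>2) * (fls_X_inv :: complex fls) ^ 2"
  define B where "B = fls_const (inverse (q * c\<^sup>2)) * (fls_X :: complex fls) ^ 2"
  have A: "fls_const q * (fls_X_inv * fls_const c)\<^sup>2 = A"
    unfolding A_def power_mult_distrib fls_const_power[symmetric] fls_const_mult_const[symmetric]
    by (simp only: mult_ac)
  have B: "fls_const (inverse q) * (inverse (fls_X_inv * fls_const c))\<^sup>2 = B"
    unfolding B_def power_mult_distrib fls_const_power[symmetric] fls_const_mult_const[symmetric]
      inverse_mult_distrib fls_inverse_X_inv fls_inverse_const power_inverse[symmetric]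
    by (simp only: mult_ac)
  have U: "Ufun q (fls_X_inv * fls_const c) = (A + B) / fls_const (q + inverse q)"
    unfolding Ufun_def A B ..
  have A0: "A \<noteq> 0" and dA: "fls_subdegree A = -2"
    unfolding A_def using assms by auto
  have dB: "fls_subdegree B = 2"
    unfolding B_def using assms by auto
  have d: "fls_subdegree (A + B) = -2"
    using fls_subdegree_add_eq1[OF A0, of B] dA dB by simp
  have "fls_subdegree ((A + B) * fls_const (inverse (q + inverse q))) = -2"
  proof -
    have "A + B \<noteq> 0" using d by auto
    then show ?thesis using d assms(3) by (subst fls_subdegree_mult) auto
  qed
  moreover have "Ufun q (fls_X_inv * fls_const c) = (A + B) * fls_const (inverse (q + inverse q))"
    unfolding U field_class.field_divide_inverse fls_inverse_const ..
  ultimately show ?thesis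
    by (simp only: fls_inverse_subdegree)
qed

definition K_op_half :: "complex \<Rightarrow> complex \<Rightarrow> complex \<Rightarrow> complex fls \<Rightarrow> free_alg fls mat" where
  "K_op_half q kp km x =
    (let Wp = gen_series q Wneg x; Wm = gen_series q Wpos x;
         Gp = gen_series q Gen x; Gm = gen_series q Gtil x;
         a = fls_map fscal (x * fls_const q);
         b = fls_map fscal (inverse x * fls_const (inverse q));
         s = (\<lambda>c. fls_const (fscal c))
     in mat_of_rows_list 2
      [[a * Wp - b * Wm,
        s (1 / (km * (q + inverse q))) * Gp + s (kp * (q + inverse q) / (q - inverse q))],
       [s (1 / (kp * (q + inverse q))) * Gm + s (km * (q + inverse q) / (q - inverse q)),
        a * Wm - b * Wp]])"

definition K_op :: "complex \<Rightarrow> complex \<Rightarrow> complex \<Rightarrow> complex \<Rightarrow> nat \<Rightarrow> complex fls \<Rightarrow> free_alg fls mat"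
where
  "K_op q qh kp km = fused fscal q qh (K_op_half q kp km)"

definition K_num_half :: "complex \<Rightarrow> complex \<Rightarrow> complex \<Rightarrow> complex \<Rightarrow> complex
    \<Rightarrow> complex fls \<Rightarrow> complex fls mat" where
  "K_num_half q ep em kp km x =
    mat_of_rows_list 2
      [[x * fls_const ep + inverse x * fls_const em,
        fls_const (kp / (q - inverse q)) * cfun (x\<^sup>2)],
       [fls_const (km / (q - inverse q)) * cfun (x\<^sup>2),
        x * fls_const em + inverse x * fls_const ep]]"

definition K_num :: "complex \<Rightarrow> complex \<Rightarrow> complex \<Rightarrow> complex \<Rightarrow> complex \<Rightarrow> complex
    \<Rightarrow> nat \<Rightarrow> complex fls \<Rightarrow> complex fls mat" where
  "K_num q qh ep em kp km = fused (\<lambda>c. c) q qh (K_num_half q ep em kp km)"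

definition f_norm :: "complex \<Rightarrow> nat \<Rightarrow> complex fls \<Rightarrow> complex fls" where
  "f_norm q d x =
    (\<Prod>k=1..d-1. \<Prod>l=1..k.
       cfun (x\<^sup>2 * fls_const (q powi (int k + int l + 2 - int d)))
       * cfun ((inverse x)\<^sup>2 * fls_const (q powi (int d - int k - int l))))"

definition K_dual :: "complex \<Rightarrow> complex \<Rightarrow> complex \<Rightarrow> complex \<Rightarrow> complex \<Rightarrow> complex
    \<Rightarrow> nat \<Rightarrow> complex fls \<Rightarrow> complex fls mat" where
  "K_dual q qh ebp ebm kbp kbm d x =
    (1 / f_norm q d x) \<cdot>\<^sub>m
      transpose_mat (K_num q qh ebm ebp (- kbm) (- kbp) d (inverse x * fls_const (inverse q)))"

section \<open>Generating functions\<close>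

text \<open>\<open>T_free\<close> is computed with the free generators; \<open>T_gen\<close> is its image in Laurent series over the
  quotient algebra, under the coefficientwise projection: \<open>T_gen \<dots> n\<close> is the coefficient of
  \<open>u\<^sup>-\<^sup>n\<close>.\<close>

definition T_free :: "complex \<Rightarrow> complex \<Rightarrow> complex \<Rightarrow> complex \<Rightarrow> complex \<Rightarrow> complex \<Rightarrow> complex \<Rightarrow> complex
    \<Rightarrow> nat \<Rightarrow> free_alg fls" where
  "T_free q qh kp km ebp ebm kbp kbm d =
    mat_trace (map_mat (fls_map fscal) (K_dual q qh ebp ebm kbp kbm d fls_X_inv)
               * K_op q qh kp km d fls_X_inv)"

definition T_gen :: "complex \<Rightarrow> complex \<Rightarrow> complex \<Rightarrow> complex \<Rightarrow> complex \<Rightarrow> complex \<Rightarrow> complex \<Rightarrow> complex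
    \<Rightarrow> nat \<Rightarrow> int \<Rightarrow> free_alg set" where
  "T_gen q qh kp km ebp ebm kbp kbm d n =
    Aq_proj q kp km (fls_nth (T_free q qh kp km ebp ebm kbp kbm d) n)"

text \<open>The commutator of \<open>f(u)\<close> and \<open>g(v)\<close> for series over a ring \<open>R\<close>: its coefficient of
  \<open>u\<^sup>-\<^sup>m v\<^sup>-\<^sup>n\<close>.\<close>

definition laurent_comm :: "('a, 'b) ring_scheme \<Rightarrow> (int \<Rightarrow> 'a) \<Rightarrow> (int \<Rightarrow> 'a) \<Rightarrow> int \<Rightarrow> int \<Rightarrow> 'a" where
  "laurent_comm R f g m n = f m \<otimes>\<^bsub>R\<^esub> g n \<ominus>\<^bsub>R\<^esub> g n \<otimes>\<^bsub>R\<^esub> f m"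

end

theory Submission
  imports Defs
begin

text \<open>
  The fused operators \<open>K\<^sub>j\<close> come from the spin 1/2 reflection equation, which both the generating series of the
  algebra and the numerical K-matrices satisfy. The product \<open>T\<^sub>h(x) T\<^sub>j(x q)\<close> with \<open>h = 1/2\<close> is a trace over the tensor
  product of spins \<open>h\<close> and \<open>j\<close>. Crossing symmetry of R turns it into the trace of a two-site operator that leaves the
  image of the fusion map invariant; splitting along this image and its quotient gives, up to scalars,
  \<open>T\<^sub>h T\<^sub>j = T\<^sub>j\<^sub>+\<^sub>h + \<gamma> T\<^sub>j\<^sub>-\<^sub>h\<close> with \<open>\<gamma>\<close> the quantum determinant, whose coefficients are central. Hence all coefficients
  are polynomials in those of \<open>\<gamma>\<close> and \<open>T\<^sub>h\<close>. The latter are combinations of 1 and of a single family of linear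
  combinations of the generators, which commute by the defining relations.
\<close>

section \<open>R-matrices of spins 1/2 and j\<close>

text \<open>Only one indeterminate is used. Spectral parameters are elements of the field C((1/u)),
  and two of them are independent enough once the relevant values of \<open>cc\<close> are nonzero,
  which is read off from orders in 1/u. Relations with two parameters thus live in a single series
  ring, and the statement about u and v is recovered from coefficients: those of every transfer
  series lie in the double commutant of one commuting set. Modes are separated by letting the second
  parameter run through high powers of u.

  The obstacle to computing with fused matrices is the square roots of the spin basis. A diagonal
  rescaling removes them: the fusion map becomes \<open>Em\<close>, whose image consists of vectors
  depending only on the sum of two indices, and R gets Laurent polynomial entries. Parameters are
  shifted too: \<open>x\<close> stands for u q^((1-d)/2), the lowest of the string x, xq, ...,
  xq^(d-1) of spin-1/2 parameters, so that only integer powers of q occur. The price is that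
  transposition becomes the adjoint for a weighted form, and that the transpose of a fused matrix
  has to be shown to be the fusion of a transpose.\<close>

locale scalars =
  fixes \<iota> :: "'k::field \<Rightarrow> 'b::ring_1"
  assumes i_add: "\<iota> (k + l) = \<iota> k + \<iota> l"
    and i_mult: "\<iota> (k * l) = \<iota> k * \<iota> l"
    and i_one [simp]: "\<iota> 1 = 1"
    and i_central: "\<iota> k * b = b * \<iota> k"
begin

lemma i_zero [simp]: "\<iota> 0 = 0"
  using i_add[of 0 0] by simp

lemma i_minus: "\<iota> (- k) = - \<iota> k"
  using i_add[of k "- k"] by (simp add: eq_neg_iff_add_eq_0 add.commute)

lemma i_diff: "\<iota> (k - l) = \<iota> k - \<iota> l"
  using i_add[of k "- l"] by (simp add: i_minus)

lemma i_sum: "\<iota> (sum g A) = (\<Sum>x\<in>A. \<iota> (g x))"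
  by (induction A rule: infinite_finite_induct) (simp_all add: i_add)

lemma i_cancel: "k \<noteq> 0 \<Longrightarrow> \<iota> k * b = \<iota> k * c \<Longrightarrow> b = c"
proof -
  assume k: "k \<noteq> 0" and e: "\<iota> k * b = \<iota> k * c"
  have "\<iota> (inverse k) * (\<iota> k * b) = \<iota> (inverse k) * (\<iota> k * c)"
    using e by simp
  then show ?thesis
    using k by (simp add: mult.assoc[symmetric] i_mult[symmetric])
qed

lemma i_left_comm: "b * (\<iota> k * c) = \<iota> k * (b * c)"
  by (metis i_central mult.assoc)

lemma i_i: "\<iota> k * (\<iota> l * c) = \<iota> (k * l) * c"
  by (simp add: i_mult mult.assoc)

text \<open>Linear functionals separate points, so identities between scalar combinations of vectors
  may be checked in the field.\<close>

lemma functional_ext: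
  assumes "\<And>f. (\<And>x y. f (x + y) = f x + f y) \<Longrightarrow> (\<And>x y. f (x - y) = f x - f y) \<Longrightarrow>
    (\<And>x. f (- x) = - f x) \<Longrightarrow> f 0 = 0 \<Longrightarrow>
    (\<And>k x. f (\<iota> k * x) = (k::'k) * f x) \<Longrightarrow> f a = f b"
  shows "a = b"
proof (rule ccontr)
  assume ne: "a \<noteq> b"
  interpret V: vector_space_pair "\<lambda>k x. \<iota> k * x" "(*) :: 'k \<Rightarrow> 'k \<Rightarrow> 'k"
    by unfold_locales (simp_all add: algebra_simps i_add i_mult)
  have "V.vs1.independent {a - b}"
    using ne by (simp add: V.vs1.dependent_single)
  then obtain g where lin: "Vector_Spaces.linear (\<lambda>k x. \<iota> k * x) (*) g"
    and g: "\<And>x. x \<in> {a - b} \<Longrightarrow> g x = (1::'k)"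
    using V.linear_independent_extend[of "{a - b}" "\<lambda>_. 1"] by blast
  have "g a = g b"
    by (rule assms)
      (use lin in \<open>simp_all add: V.linear_add V.linear_diff V.linear_neg V.linear_0 V.linear_scale\<close>)
  moreover have "g (a - b) = g a - g b"
    using lin by (simp add: V.linear_diff)
  ultimately show False
    using g[of "a - b"] by simp
qed

end

section \<open>Yang-Baxter equation, fusion and quantum determinant of the L-operators\<close>

definition cc :: "'k::field \<Rightarrow> 'k" where
  "cc z = z - inverse z"

locale qscalars = scalars \<iota> for \<iota> :: "'k::field \<Rightarrow> 'b::ring_1" +
  fixes q :: 'k
  assumes q0: "q \<noteq> 0"
begin

text \<open>The R-matrix of spins 1/2 and d/2 without its scalar prefactor, in the rescaled basis.
  The truth value is the index of C^2, False being the first basis vector, and \<open>m\<close> runs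
  from 0 to \<open>d\<close>. In terms of the usual parameter u one has y = u q^((1-d)/2).\<close>

definition Lop :: "nat \<Rightarrow> 'k \<Rightarrow> (bool \<Rightarrow> nat \<Rightarrow> 'b) \<Rightarrow> bool \<Rightarrow> nat \<Rightarrow> 'b" where
  "Lop d y \<phi> a m = (if m \<le> d then
     (if a then \<iota> (cc (y * q ^ m)) * \<phi> True m + \<iota> (cc (q ^ (d - m))) * \<phi> False (m + 1)
      else \<iota> (cc (y * q ^ (d - m))) * \<phi> False m + \<iota> (cc (q ^ m)) * \<phi> True (m - 1))
     else 0)"

definition L13 where "L13 d y \<phi> = (\<lambda>a b. Lop d y (\<lambda>a'. \<phi> a' b) a)"
definition L23 where "L23 d y \<phi> = (\<lambda>a. Lop d y (\<phi> a))"

text \<open>This is \<open>Lop 1 y\<close> with the second index written as a truth value.\<close>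

definition R12 :: "'k \<Rightarrow> (bool \<Rightarrow> bool \<Rightarrow> nat \<Rightarrow> 'b) \<Rightarrow> bool \<Rightarrow> bool \<Rightarrow> nat \<Rightarrow> 'b" where
  "R12 y \<phi> a b m = (if a = b then \<iota> (cc (y * q)) * \<phi> a b m
     else \<iota> (cc y) * \<phi> a b m + \<iota> (cc q) * \<phi> b a m)"

text \<open>The fusion map in the rescaled basis: spin d/2 sits inside C^2 tensor spin (d-1)/2 as
  the vectors whose entries depend only on the sum of the two indices.\<close>

definition Em :: "nat \<Rightarrow> (nat \<Rightarrow> 'b) \<Rightarrow> bool \<Rightarrow> nat \<Rightarrow> 'b" where
  "Em d \<psi> a m = (if m < d then \<psi> (of_bool a + m) else 0)"

definition E23 where "E23 d \<phi> = (\<lambda>a. Em d (\<phi> a))"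

text \<open>The singlet component of the two C^2 factors; it vanishes exactly on vectors symmetric
  in them.\<close>

definition pi12 :: "(bool \<Rightarrow> bool \<Rightarrow> nat \<Rightarrow> 'b) \<Rightarrow> nat \<Rightarrow> 'b" where
  "pi12 \<phi> m = \<phi> False True m - \<phi> True False m"

lemmas op_defs = Lop_def L13_def L23_def R12_def Em_def E23_def pi12_def

text \<open>The Yang-Baxter equation. A functional turns both sides into combinations of values with
  Laurent polynomial coefficients. The four cases isolate the ends m = 0 and m = d of the spin
  index, where neighbouring entries drop out because their coefficient is \<open>cc 1\<close>, that
  is 0.\<close>

lemma RLL:
  assumes y0: "y \<noteq> 0" and z0: "z \<noteq> 0"
  shows "R12 z (L13 d (z * y) (L23 d y \<phi>)) a b m
    = L23 d y (L13 d (z * y) (R12 z \<phi>)) a b m"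
proof (rule functional_ext)
  fix f :: "'b \<Rightarrow> 'k"
  assume f: "\<And>x y. f (x + y) = f x + f y" "\<And>x y. f (x - y) = f x - f y" "\<And>x. f (- x) = - f x"
    "f 0 = 0" "\<And>k x. f (\<iota> k * x) = k * f x"
  define qa where "qa = inverse q"
  have qr: "q * qa = 1" "\<And>w. q * (qa * w) = w" "inverse qa = q"
    using q0 by (simp_all add: qa_def)
  define ya where "ya = inverse y"
  have yr: "y * ya = 1" "\<And>w. y * (ya * w) = w" "inverse ya = y"
    using y0 by (simp_all add: ya_def)
  define za where "za = inverse z"
  have zr: "z * za = 1" "\<And>w. z * (za * w) = w" "inverse za = z"
    using z0 by (simp_all add: za_def)
  show "f (R12 z (L13 d (z * y) (L23 d y \<phi>)) a b m)
    = f (L23 d y (L13 d (z * y) (R12 z \<phi>)) a b m)"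
  proof (cases "m \<le> d")
    case True
    then obtain n where d: "d = m + n"
      using le_iff_add by blast
    show ?thesis
    proof (cases m)
      case m: 0
      show ?thesis
      proof (cases n)
        case n: 0
        show ?thesis
          by (cases a; cases b)
            (simp_all add: op_defs f d m n cc_def power_add field_class.field_divide_inverse  qa_def[symmetric] ya_def[symmetric] za_def[symmetric] qr yr zr;
             simp add: algebra_simps qr yr zr)+
      next
        case n: (Suc k)
        \<comment> \<open>Powers of q and inverses get names of their own, so that what remains is a
          polynomial identity in which each unknown cancels against its inverse.\<close>
        define N where "N = q ^ k"
        have N0: "N \<noteq> 0"
          using q0 by (simp add: N_def)
        define Na where "Na = inverse N"
        have Nr: "N * Na = 1" "\<And>w. N * (Na * w) = w" "inverse Na = N"
          using N0 by (simp_all add: Na_def)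
        show ?thesis
          by (cases a; cases b)
            (simp_all add: op_defs f d m n cc_def power_add field_class.field_divide_inverse N_def[symmetric] Na_def[symmetric] qa_def[symmetric] ya_def[symmetric] za_def[symmetric] Nr qr yr zr;
             simp add: algebra_simps Nr qr yr zr)+
      qed
    next
      case m: (Suc l)
      define M where "M = q ^ l"
      have M0: "M \<noteq> 0"
        using q0 by (simp add: M_def)
      define Ma where "Ma = inverse M"
      have Mr: "M * Ma = 1" "\<And>w. M * (Ma * w) = w" "inverse Ma = M"
        using M0 by (simp_all add: Ma_def)
      show ?thesis
      proof (cases n)
        case n: 0
        show ?thesis
          by (cases a; cases b)
            (simp_all add: op_defs f d m n cc_def power_add field_class.field_divide_inverse M_def[symmetric] Ma_def[symmetric] qa_def[symmetric] ya_def[symmetric] za_def[symmetric] Mr qr yr zr;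
             simp add: algebra_simps Mr qr yr zr)+
      next
        case n: (Suc k)
        define N where "N = q ^ k"
        have N0: "N \<noteq> 0"
          using q0 by (simp add: N_def)
        define Na where "Na = inverse N"
        have Nr: "N * Na = 1" "\<And>w. N * (Na * w) = w" "inverse Na = N"
          using N0 by (simp_all add: Na_def)
        show ?thesis
          by (cases a; cases b)
            (simp_all add: op_defs f d m n cc_def power_add field_class.field_divide_inverse N_def[symmetric] M_def[symmetric] Na_def[symmetric] Ma_def[symmetric] qa_def[symmetric] ya_def[symmetric] za_def[symmetric] Nr Mr qr yr zr;
             simp add: algebra_simps Nr Mr qr yr zr)+
      qed
    qed
  qed (simp add: op_defs f)
qed

text \<open>The Yang-Baxter equation with the spin space in the middle role. For y = u q^((1-d)/2)
  and z = v q^((1-d)/2) the argument y z q^(d-1) of \<open>R12\<close> is the product uv.\<close>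

lemma LRL:
  assumes y0: "y \<noteq> 0" and z0: "z \<noteq> 0"
  shows "L13 d y (R12 (y * z * q ^ d / q) (L23 d z \<phi>)) a b m
    = L23 d z (R12 (y * z * q ^ d / q) (L13 d y \<phi>)) a b m"
proof (rule functional_ext)
  fix f :: "'b \<Rightarrow> 'k"
  assume f: "\<And>x y. f (x + y) = f x + f y" "\<And>x y. f (x - y) = f x - f y" "\<And>x. f (- x) = - f x"
    "f 0 = 0" "\<And>k x. f (\<iota> k * x) = k * f x"
  define qa where "qa = inverse q"
  have qr: "q * qa = 1" "\<And>w. q * (qa * w) = w" "inverse qa = q"
    using q0 by (simp_all add: qa_def)
  define ya where "ya = inverse y"
  have yr: "y * ya = 1" "\<And>w. y * (ya * w) = w" "inverse ya = y"
    using y0 by (simp_all add: ya_def)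
  define za where "za = inverse z"
  have zr: "z * za = 1" "\<And>w. z * (za * w) = w" "inverse za = z"
    using z0 by (simp_all add: za_def)
  show "f (L13 d y (R12 (y * z * q ^ d / q) (L23 d z \<phi>)) a b m)
    = f (L23 d z (R12 (y * z * q ^ d / q) (L13 d y \<phi>)) a b m)"
  proof (cases "m \<le> d")
    case True
    then obtain n where d: "d = m + n"
      using le_iff_add by blast
    show ?thesis
    proof (cases m)
      case m: 0
      show ?thesis
      proof (cases n)
        case n: 0
        show ?thesis
          by (cases a; cases b)
            (simp_all add: op_defs f d m n cc_def power_add field_class.field_divide_inverse  qa_def[symmetric] ya_def[symmetric] za_def[symmetric] qr yr zr;
             simp add: algebra_simps qr yr zr)+
      next
        case n: (Suc k)
        define N where "N = q ^ k"
        have N0: "N \<noteq> 0"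
          using q0 by (simp add: N_def)
        define Na where "Na = inverse N"
        have Nr: "N * Na = 1" "\<And>w. N * (Na * w) = w" "inverse Na = N"
          using N0 by (simp_all add: Na_def)
        show ?thesis
          by (cases a; cases b)
            (simp_all add: op_defs f d m n cc_def power_add field_class.field_divide_inverse N_def[symmetric] Na_def[symmetric] qa_def[symmetric] ya_def[symmetric] za_def[symmetric] Nr qr yr zr;
             simp add: algebra_simps Nr qr yr zr)+
      qed
    next
      case m: (Suc l)
      define M where "M = q ^ l"
      have M0: "M \<noteq> 0"
        using q0 by (simp add: M_def)
      define Ma where "Ma = inverse M"
      have Mr: "M * Ma = 1" "\<And>w. M * (Ma * w) = w" "inverse Ma = M"
        using M0 by (simp_all add: Ma_def)
      show ?thesis
      proof (cases n)
        case n: 0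
        show ?thesis
          by (cases a; cases b)
            (simp_all add: op_defs f d m n cc_def power_add field_class.field_divide_inverse M_def[symmetric] Ma_def[symmetric] qa_def[symmetric] ya_def[symmetric] za_def[symmetric] Mr qr yr zr;
             simp add: algebra_simps Mr qr yr zr)+
      next
        case n: (Suc k)
        define N where "N = q ^ k"
        have N0: "N \<noteq> 0"
          using q0 by (simp add: N_def)
        define Na where "Na = inverse N"
        have Nr: "N * Na = 1" "\<And>w. N * (Na * w) = w" "inverse Na = N"
          using N0 by (simp_all add: Na_def)
        show ?thesis
          by (cases a; cases b)
            (simp_all add: op_defs f d m n cc_def power_add field_class.field_divide_inverse N_def[symmetric] M_def[symmetric] Na_def[symmetric] Ma_def[symmetric] qa_def[symmetric] ya_def[symmetric] za_def[symmetric] Nr Mr qr yr zr;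
             simp add: algebra_simps Nr Mr qr yr zr)+
      qed
    qed
  qed (simp add: op_defs f)
qed

text \<open>Fusion in the second space. The scalar on the right is the one that
  \<open>Rpre_Suc\<close> later absorbs into the prefactor.\<close>

lemma L_fusion:
  assumes y0: "y \<noteq> 0"
  shows "R12 y (L13 d (y * q) (E23 (Suc d) \<phi>)) a b m
    = \<iota> (cc (y * q)) * E23 (Suc d) (Lop (Suc d) y \<phi>) a b m"
proof (rule functional_ext)
  fix f :: "'b \<Rightarrow> 'k"
  assume f: "\<And>x y. f (x + y) = f x + f y" "\<And>x y. f (x - y) = f x - f y" "\<And>x. f (- x) = - f x"
    "f 0 = 0" "\<And>k x. f (\<iota> k * x) = k * f x"
  define qa where "qa = inverse q"
  have qr: "q * qa = 1" "\<And>w. q * (qa * w) = w" "inverse qa = q"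
    using q0 by (simp_all add: qa_def)
  define ya where "ya = inverse y"
  have yr: "y * ya = 1" "\<And>w. y * (ya * w) = w" "inverse ya = y"
    using y0 by (simp_all add: ya_def)
  show "f (R12 y (L13 d (y * q) (E23 (Suc d) \<phi>)) a b m)
    = f (\<iota> (cc (y * q)) * E23 (Suc d) (Lop (Suc d) y \<phi>) a b m)"
  proof (cases "m \<le> d")
    case True
    then obtain n where d: "d = m + n"
      using le_iff_add by blast
    show ?thesis
    proof (cases m)
      case m: 0
      show ?thesis
      proof (cases n)
        case n: 0
        show ?thesis
          by (cases a; cases b)
            (simp_all add: op_defs f d m n cc_def power_add field_class.field_divide_inverse  qa_def[symmetric] ya_def[symmetric] qr yr;
             simp add: algebra_simps qr yr)+
      next
        case n: (Suc k)
        define N where "N = q ^ k"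
        have N0: "N \<noteq> 0"
          using q0 by (simp add: N_def)
        define Na where "Na = inverse N"
        have Nr: "N * Na = 1" "\<And>w. N * (Na * w) = w" "inverse Na = N"
          using N0 by (simp_all add: Na_def)
        show ?thesis
          by (cases a; cases b)
            (simp_all add: op_defs f d m n cc_def power_add field_class.field_divide_inverse N_def[symmetric] Na_def[symmetric] qa_def[symmetric] ya_def[symmetric] Nr qr yr;
             simp add: algebra_simps Nr qr yr)+
      qed
    next
      case m: (Suc l)
      define M where "M = q ^ l"
      have M0: "M \<noteq> 0"
        using q0 by (simp add: M_def)
      define Ma where "Ma = inverse M"
      have Mr: "M * Ma = 1" "\<And>w. M * (Ma * w) = w" "inverse Ma = M"
        using M0 by (simp_all add: Ma_def)
      show ?thesis
      proof (cases n)
        case n: 0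
        show ?thesis
          by (cases a; cases b)
            (simp_all add: op_defs f d m n cc_def power_add field_class.field_divide_inverse M_def[symmetric] Ma_def[symmetric] qa_def[symmetric] ya_def[symmetric] Mr qr yr;
             simp add: algebra_simps Mr qr yr)+
      next
        case n: (Suc k)
        define N where "N = q ^ k"
        have N0: "N \<noteq> 0"
          using q0 by (simp add: N_def)
        define Na where "Na = inverse N"
        have Nr: "N * Na = 1" "\<And>w. N * (Na * w) = w" "inverse Na = N"
          using N0 by (simp_all add: Na_def)
        show ?thesis
          by (cases a; cases b)
            (simp_all add: op_defs f d m n cc_def power_add field_class.field_divide_inverse N_def[symmetric] M_def[symmetric] Na_def[symmetric] Ma_def[symmetric] qa_def[symmetric] ya_def[symmetric] Nr Mr qr yr;
             simp add: algebra_simps Nr Mr qr yr)+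
      qed
    qed
  qed (simp add: op_defs f)
qed

text \<open>The same operator with the two factors in the other order. The spin-1/2 factor now sits
  at the other end of the parameter string, whence the different scalar. Both versions are used,
  because K-operators will be assembled from either end.\<close>

lemma L_fusion':
  assumes y0: "y \<noteq> 0"
  shows "L13 d y (R12 (y * q ^ d) (E23 (Suc d) \<phi>)) a b m
    = \<iota> (cc (y * q ^ d)) * E23 (Suc d) (Lop (Suc d) y \<phi>) a b m"
proof (rule functional_ext)
  fix f :: "'b \<Rightarrow> 'k"
  assume f: "\<And>x y. f (x + y) = f x + f y" "\<And>x y. f (x - y) = f x - f y" "\<And>x. f (- x) = - f x"
    "f 0 = 0" "\<And>k x. f (\<iota> k * x) = k * f x"
  define qa where "qa = inverse q"
  have qr: "q * qa = 1" "\<And>w. q * (qa * w) = w" "inverse qa = q"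
    using q0 by (simp_all add: qa_def)
  define ya where "ya = inverse y"
  have yr: "y * ya = 1" "\<And>w. y * (ya * w) = w" "inverse ya = y"
    using y0 by (simp_all add: ya_def)
  show "f (L13 d y (R12 (y * q ^ d) (E23 (Suc d) \<phi>)) a b m)
    = f (\<iota> (cc (y * q ^ d)) * E23 (Suc d) (Lop (Suc d) y \<phi>) a b m)"
  proof (cases "m \<le> d")
    case True
    then obtain n where d: "d = m + n"
      using le_iff_add by blast
    show ?thesis
    proof (cases m)
      case m: 0
      show ?thesis
      proof (cases n)
        case n: 0
        show ?thesis
          by (cases a; cases b)
            (simp_all add: op_defs f d m n cc_def power_add field_class.field_divide_inverse  qa_def[symmetric] ya_def[symmetric] qr yr;
             simp add: algebra_simps qr yr)+
      next
        case n: (Suc k)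
        define N where "N = q ^ k"
        have N0: "N \<noteq> 0"
          using q0 by (simp add: N_def)
        define Na where "Na = inverse N"
        have Nr: "N * Na = 1" "\<And>w. N * (Na * w) = w" "inverse Na = N"
          using N0 by (simp_all add: Na_def)
        show ?thesis
          by (cases a; cases b)
            (simp_all add: op_defs f d m n cc_def power_add field_class.field_divide_inverse N_def[symmetric] Na_def[symmetric] qa_def[symmetric] ya_def[symmetric] Nr qr yr;
             simp add: algebra_simps Nr qr yr)+
      qed
    next
      case m: (Suc l)
      define M where "M = q ^ l"
      have M0: "M \<noteq> 0"
        using q0 by (simp add: M_def)
      define Ma where "Ma = inverse M"
      have Mr: "M * Ma = 1" "\<And>w. M * (Ma * w) = w" "inverse Ma = M"
        using M0 by (simp_all add: Ma_def)
      show ?thesis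
      proof (cases n)
        case n: 0
        show ?thesis
          by (cases a; cases b)
            (simp_all add: op_defs f d m n cc_def power_add field_class.field_divide_inverse M_def[symmetric] Ma_def[symmetric] qa_def[symmetric] ya_def[symmetric] Mr qr yr;
             simp add: algebra_simps Mr qr yr)+
      next
        case n: (Suc k)
        define N where "N = q ^ k"
        have N0: "N \<noteq> 0"
          using q0 by (simp add: N_def)
        define Na where "Na = inverse N"
        have Nr: "N * Na = 1" "\<And>w. N * (Na * w) = w" "inverse Na = N"
          using N0 by (simp_all add: Na_def)
        show ?thesis
          by (cases a; cases b)
            (simp_all add: op_defs f d m n cc_def power_add field_class.field_divide_inverse N_def[symmetric] M_def[symmetric] Na_def[symmetric] Ma_def[symmetric] qa_def[symmetric] ya_def[symmetric] Nr Mr qr yr;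
             simp add: algebra_simps Nr Mr qr yr)+
      qed
    qed
  qed (simp add: op_defs f)
qed

text \<open>The quantum determinant of the L-operator: the product at parameters in ratio q
  preserves symmetric vectors and acts by a scalar on the singlet quotient.\<close>

lemma L_qdet:
  assumes y0: "y \<noteq> 0"
  shows "pi12 (L13 d y (L23 d (y * q) \<phi>)) m
    = \<iota> (cc y * cc (y * q ^ Suc d)) * (if m \<le> d then pi12 \<phi> m else 0)"
proof (rule functional_ext)
  fix f :: "'b \<Rightarrow> 'k"
  assume f: "\<And>x y. f (x + y) = f x + f y" "\<And>x y. f (x - y) = f x - f y" "\<And>x. f (- x) = - f x"
    "f 0 = 0" "\<And>k x. f (\<iota> k * x) = k * f x"
  define qa where "qa = inverse q"
  have qr: "q * qa = 1" "\<And>w. q * (qa * w) = w" "inverse qa = q"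
    using q0 by (simp_all add: qa_def)
  define ya where "ya = inverse y"
  have yr: "y * ya = 1" "\<And>w. y * (ya * w) = w" "inverse ya = y"
    using y0 by (simp_all add: ya_def)
  show "f (pi12 (L13 d y (L23 d (y * q) \<phi>)) m)
    = f (\<iota> (cc y * cc (y * q ^ Suc d)) * (if m \<le> d then pi12 \<phi> m else 0))"
  proof (cases "m \<le> d")
    case True
    then obtain n where d: "d = m + n"
      using le_iff_add by blast
    show ?thesis
    proof (cases m)
      case m: 0
      show ?thesis
      proof (cases n)
        case n: 0
        show ?thesis
          by -
            (simp_all add: op_defs f d m n cc_def power_add field_class.field_divide_inverse  qa_def[symmetric] ya_def[symmetric] qr yr;
             simp add: algebra_simps qr yr)+
      next
        case n: (Suc k)
        define N where "N = q ^ k"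
        have N0: "N \<noteq> 0"
          using q0 by (simp add: N_def)
        define Na where "Na = inverse N"
        have Nr: "N * Na = 1" "\<And>w. N * (Na * w) = w" "inverse Na = N"
          using N0 by (simp_all add: Na_def)
        show ?thesis
          by -
            (simp_all add: op_defs f d m n cc_def power_add field_class.field_divide_inverse N_def[symmetric] Na_def[symmetric] qa_def[symmetric] ya_def[symmetric] Nr qr yr;
             simp add: algebra_simps Nr qr yr)+
      qed
    next
      case m: (Suc l)
      define M where "M = q ^ l"
      have M0: "M \<noteq> 0"
        using q0 by (simp add: M_def)
      define Ma where "Ma = inverse M"
      have Mr: "M * Ma = 1" "\<And>w. M * (Ma * w) = w" "inverse Ma = M"
        using M0 by (simp_all add: Ma_def)
      show ?thesis
      proof (cases n)
        case n: 0
        show ?thesis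
          by -
            (simp_all add: op_defs f d m n cc_def power_add field_class.field_divide_inverse M_def[symmetric] Ma_def[symmetric] qa_def[symmetric] ya_def[symmetric] Mr qr yr;
             simp add: algebra_simps Mr qr yr)+
      next
        case n: (Suc k)
        define N where "N = q ^ k"
        have N0: "N \<noteq> 0"
          using q0 by (simp add: N_def)
        define Na where "Na = inverse N"
        have Nr: "N * Na = 1" "\<And>w. N * (Na * w) = w" "inverse Na = N"
          using N0 by (simp_all add: Na_def)
        show ?thesis
          by -
            (simp_all add: op_defs f d m n cc_def power_add field_class.field_divide_inverse N_def[symmetric] M_def[symmetric] Na_def[symmetric] Ma_def[symmetric] qa_def[symmetric] ya_def[symmetric] Nr Mr qr yr;
             simp add: algebra_simps Nr Mr qr yr)+
      qed
    qed
  qed (simp add: op_defs f)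
qed

lemma L_qdet':
  assumes y0: "y \<noteq> 0"
  shows "pi12 (L23 d y (L13 d (y * q) \<phi>)) m
    = \<iota> (cc y * cc (y * q ^ Suc d)) * (if m \<le> d then pi12 \<phi> m else 0)"
proof (rule functional_ext)
  fix f :: "'b \<Rightarrow> 'k"
  assume f: "\<And>x y. f (x + y) = f x + f y" "\<And>x y. f (x - y) = f x - f y" "\<And>x. f (- x) = - f x"
    "f 0 = 0" "\<And>k x. f (\<iota> k * x) = k * f x"
  define qa where "qa = inverse q"
  have qr: "q * qa = 1" "\<And>w. q * (qa * w) = w" "inverse qa = q"
    using q0 by (simp_all add: qa_def)
  define ya where "ya = inverse y"
  have yr: "y * ya = 1" "\<And>w. y * (ya * w) = w" "inverse ya = y"
    using y0 by (simp_all add: ya_def)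
  show "f (pi12 (L23 d y (L13 d (y * q) \<phi>)) m)
    = f (\<iota> (cc y * cc (y * q ^ Suc d)) * (if m \<le> d then pi12 \<phi> m else 0))"
  proof (cases "m \<le> d")
    case True
    then obtain n where d: "d = m + n"
      using le_iff_add by blast
    show ?thesis
    proof (cases m)
      case m: 0
      show ?thesis
      proof (cases n)
        case n: 0
        show ?thesis
          by -
            (simp_all add: op_defs f d m n cc_def power_add field_class.field_divide_inverse  qa_def[symmetric] ya_def[symmetric] qr yr;
             simp add: algebra_simps qr yr)+
      next
        case n: (Suc k)
        define N where "N = q ^ k"
        have N0: "N \<noteq> 0"
          using q0 by (simp add: N_def)
        define Na where "Na = inverse N"
        have Nr: "N * Na = 1" "\<And>w. N * (Na * w) = w" "inverse Na = N"
          using N0 by (simp_all add: Na_def)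
        show ?thesis
          by -
            (simp_all add: op_defs f d m n cc_def power_add field_class.field_divide_inverse N_def[symmetric] Na_def[symmetric] qa_def[symmetric] ya_def[symmetric] Nr qr yr;
             simp add: algebra_simps Nr qr yr)+
      qed
    next
      case m: (Suc l)
      define M where "M = q ^ l"
      have M0: "M \<noteq> 0"
        using q0 by (simp add: M_def)
      define Ma where "Ma = inverse M"
      have Mr: "M * Ma = 1" "\<And>w. M * (Ma * w) = w" "inverse Ma = M"
        using M0 by (simp_all add: Ma_def)
      show ?thesis
      proof (cases n)
        case n: 0
        show ?thesis
          by -
            (simp_all add: op_defs f d m n cc_def power_add field_class.field_divide_inverse M_def[symmetric] Ma_def[symmetric] qa_def[symmetric] ya_def[symmetric] Mr qr yr;
             simp add: algebra_simps Mr qr yr)+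
      next
        case n: (Suc k)
        define N where "N = q ^ k"
        have N0: "N \<noteq> 0"
          using q0 by (simp add: N_def)
        define Na where "Na = inverse N"
        have Nr: "N * Na = 1" "\<And>w. N * (Na * w) = w" "inverse Na = N"
          using N0 by (simp_all add: Na_def)
        show ?thesis
          by -
            (simp_all add: op_defs f d m n cc_def power_add field_class.field_divide_inverse N_def[symmetric] M_def[symmetric] Na_def[symmetric] Ma_def[symmetric] qa_def[symmetric] ya_def[symmetric] Nr Mr qr yr;
             simp add: algebra_simps Nr Mr qr yr)+
      qed
    qed
  qed (simp add: op_defs f)
qed

text \<open>The prefactor turns \<open>Lop\<close> into the fused R-matrix, normalised such that fusion holds without scalars;
  \<open>Lop 0 y\<close> is the scalar \<open>cc y\<close>.\<close>

definition Rpre :: "nat \<Rightarrow> 'k \<Rightarrow> 'k" where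
  "Rpre d y = (if d = 0 then inverse (cc y) else \<Prod>i=1..<d. cc (y * q ^ i))"

definition Rop :: "nat \<Rightarrow> 'k \<Rightarrow> (bool \<Rightarrow> nat \<Rightarrow> 'b) \<Rightarrow> bool \<Rightarrow> nat \<Rightarrow> 'b" where
  "Rop d y \<phi> a m = \<iota> (Rpre d y) * Lop d y \<phi> a m"

definition R13 where "R13 d y \<phi> = (\<lambda>a b. Rop d y (\<lambda>a'. \<phi> a' b) a)"
definition R23 where "R23 d y \<phi> = (\<lambda>a. Rop d y (\<phi> a))"

lemma Rpre_Suc:
  assumes "cc (y * q) \<noteq> 0"
  shows "Rpre (Suc d) y = Rpre d (y * q) * cc (y * q)"
proof (cases d)
  case (Suc e)
  have "(\<Prod>i=1..<Suc d. cc (y * q ^ i)) = cc (y * q) * (\<Prod>i=2..<Suc d. cc (y * q ^ i))"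
    using Suc by (subst prod.atLeast_Suc_lessThan) (simp_all add: numeral_2_eq_2)
  also have "(\<Prod>i=2..<Suc d. cc (y * q ^ i)) = (\<Prod>i=1..<d. cc (y * q * q ^ i))"
    using prod.atLeast_Suc_lessThan_Suc_shift[of "\<lambda>i. cc (y * q ^ i)" 1 d] by (simp add: numeral_2_eq_2 mult_ac)
  finally show ?thesis
    using Suc by (simp add: Rpre_def)
qed (use assms in \<open>simp add: Rpre_def\<close>)

lemma Rpre_Suc':
  assumes "cc y \<noteq> 0"
  shows "Rpre (Suc d) y = Rpre d y * cc (y * q ^ d)"
  using assms by (cases d) (simp_all add: Rpre_def)

lemma Rop_0: "cc y \<noteq> 0 \<Longrightarrow> Rop 0 y \<phi> = (\<lambda>a m. if m = 0 then \<phi> a 0 else 0)"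
  by (intro ext) (auto simp: Rop_def Lop_def Rpre_def cc_def[of 1] mult.assoc[symmetric] i_mult[symmetric])

lemma R13_L: "R13 d y \<phi> = (\<lambda>a b m. \<iota> (Rpre d y) * L13 d y \<phi> a b m)"
  and R23_L: "R23 d y \<phi> = (\<lambda>a b m. \<iota> (Rpre d y) * L23 d y \<phi> a b m)"
  by (simp_all add: R13_def R23_def L13_def L23_def Rop_def fun_eq_iff)

lemma op_scale:
  "R12 y (\<lambda>a b m. \<iota> k * \<phi> a b m) = (\<lambda>a b m. \<iota> k * R12 y \<phi> a b m)"
  "L13 d y (\<lambda>a b m. \<iota> k * \<phi> a b m) = (\<lambda>a b m. \<iota> k * L13 d y \<phi> a b m)"
  "L23 d y (\<lambda>a b m. \<iota> k * \<phi> a b m) = (\<lambda>a b m. \<iota> k * L23 d y \<phi> a b m)"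
  by (simp_all add: op_defs fun_eq_iff algebra_simps i_left_comm[of _ k])

lemma E23_R:
  assumes "y \<noteq> 0" "cc (y * q) \<noteq> 0"
  shows "E23 (Suc d) (Rop (Suc d) y \<phi>) = R12 y (R13 d (y * q) (E23 (Suc d) \<phi>))"
  using L_fusion[OF assms(1), of d \<phi>]
  by (simp add: R13_L op_scale fun_eq_iff E23_def Em_def Rop_def Rpre_Suc[OF assms(2)] i_mult mult.assoc)

lemma E23_R':
  assumes "y \<noteq> 0" "cc y \<noteq> 0"
  shows "E23 (Suc d) (Rop (Suc d) y \<phi>) = R13 d y (R12 (y * q ^ d) (E23 (Suc d) \<phi>))"
  using L_fusion'[OF assms(1), of d \<phi>]
  by (simp add: R13_L op_scale fun_eq_iff E23_def Em_def Rop_def Rpre_Suc'[OF assms(2)] i_mult mult.assoc)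

lemma RRR:
  assumes "y \<noteq> 0" "z \<noteq> 0"
  shows "R12 z (R13 d (z * y) (R23 d y \<phi>)) = R23 d y (R13 d (z * y) (R12 z \<phi>))"
  using RLL[OF assms, of d \<phi>]
  by (simp add: R13_L R23_L op_scale fun_eq_iff i_left_comm[of "\<iota> (Rpre d y)"])

lemma RRR':
  assumes "y \<noteq> 0" "z \<noteq> 0"
  shows "R13 d y (R12 (y * z * q ^ d / q) (R23 d z \<phi>)) = R23 d z (R12 (y * z * q ^ d / q) (R13 d y \<phi>))"
  using LRL[OF assms, of d \<phi>]
  by (simp add: R13_L R23_L op_scale fun_eq_iff i_left_comm[of "\<iota> (Rpre d y)"])

definition Rdet :: "nat \<Rightarrow> 'k \<Rightarrow> 'k" where
  "Rdet d y = Rpre d y * Rpre d (y * q) * (cc y * cc (y * q ^ Suc d))"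

lemma pi12_scale: "pi12 (\<lambda>a b m. \<iota> k * \<phi> a b m) = (\<lambda>m. \<iota> k * pi12 \<phi> m)"
  by (auto simp: pi12_def algebra_simps)

lemma R_qdet:
  assumes "y \<noteq> 0"
  shows "pi12 (R13 d y (R23 d (y * q) \<phi>)) m = \<iota> (Rdet d y) * (if m \<le> d then pi12 \<phi> m else 0)"
  unfolding R13_L R23_L op_scale pi12_scale L_qdet[OF assms] by (simp add: Rdet_def i_mult mult.assoc)

lemma R_qdet':
  assumes "y \<noteq> 0"
  shows "pi12 (R23 d y (R13 d (y * q) \<phi>)) m = \<iota> (Rdet d y) * (if m \<le> d then pi12 \<phi> m else 0)"
  unfolding R13_L R23_L op_scale pi12_scale L_qdet'[OF assms] by (simp add: Rdet_def i_mult mult.assoc)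

end

section \<open>Fused K-operators\<close>

context scalars begin

text \<open>Entries of vectors lie in a noncommutative ring and matrices multiply from the left;
  linearity over right multiplication is what all operators then share.\<close>

definition rlin :: "((nat \<Rightarrow> 'b) \<Rightarrow> nat \<Rightarrow> 'b) \<Rightarrow> bool" where
  "rlin A \<longleftrightarrow> (\<forall>f g. A (\<lambda>m. f m + g m) = (\<lambda>m. A f m + A g m)) \<and> (\<forall>f c. A (\<lambda>m. f m * c) = (\<lambda>m. A f m * c))"

lemma rlin_add: "rlin A \<Longrightarrow> A (\<lambda>m. f m + g m) = (\<lambda>m. A f m + A g m)"
  and rlin_right: "rlin A \<Longrightarrow> A (\<lambda>m. f m * c) = (\<lambda>m. A f m * c)"
  by (simp_all add: rlin_def)

lemma rlin_scale: "rlin A \<Longrightarrow> A (\<lambda>m. \<iota> k * f m) = (\<lambda>m. \<iota> k * A f m)"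
  by (simp add: i_central rlin_right)

lemma rlin_zero: "rlin A \<Longrightarrow> A (\<lambda>m. 0) = (\<lambda>m. 0)"
  using rlin_right[of A "\<lambda>m. 0" 0] by simp

lemma rlin_minus: "rlin A \<Longrightarrow> A (\<lambda>m. - f m) = (\<lambda>m. - A f m)"
  using rlin_right[of A f "- 1"] by simp

lemma rlin_diff: "rlin A \<Longrightarrow> A (\<lambda>m. f m - g m) = (\<lambda>m. A f m - A g m)"
  using rlin_add[of A f "\<lambda>m. - g m"] by (simp add: rlin_minus)

definition Kop :: "(bool \<Rightarrow> bool \<Rightarrow> 'b) \<Rightarrow> (bool \<Rightarrow> 'c \<Rightarrow> 'b) \<Rightarrow> bool \<Rightarrow> 'c \<Rightarrow> 'b" where
  "Kop M \<phi> a m = M a False * \<phi> False m + M a True * \<phi> True m"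

definition K1 where "K1 M \<phi> = (\<lambda>a b. Kop M (\<lambda>a'. \<phi> a' b) a)"
definition K2 where "K2 M \<phi> = (\<lambda>a. Kop M (\<phi> a))"

lemmas K_defs = Kop_def K1_def K2_def

end

context qscalars begin

lemma Rop_beyond: "d < m \<Longrightarrow> Rop d y \<phi> a m = 0"
  by (simp add: Rop_def Lop_def)

lemma Rop_add: "Rop d y (\<lambda>a m. \<phi> a m + \<psi> a m) = (\<lambda>a m. Rop d y \<phi> a m + Rop d y \<psi> a m)"
  by (intro ext) (simp add: Rop_def Lop_def algebra_simps)

lemma Rop_right: "Rop d y (\<lambda>a m. \<phi> a m * c) = (\<lambda>a m. Rop d y \<phi> a m * c)"
  by (intro ext) (simp add: Rop_def Lop_def algebra_simps)

lemma Rop_scale: "Rop d y (\<lambda>a m. \<iota> k * \<phi> a m) = (\<lambda>a m. \<iota> k * Rop d y \<phi> a m)"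
  by (simp add: i_central Rop_right)

lemma K1_R23: "K1 M (R23 d y \<phi>) = R23 d y (K1 M \<phi>)"
proof (intro ext)
  fix a b m
  show "K1 M (R23 d y \<phi>) a b m = R23 d y (K1 M \<phi>) a b m"
    by (simp add: K_defs R23_def Rop_def Lop_def algebra_simps i_left_comm[of "M a False"] i_left_comm[of "M a True"])
qed

lemma K2_R13: "K2 M (R13 d y \<phi>) = R13 d y (K2 M \<phi>)"
proof (intro ext)
  fix a b m
  show "K2 M (R13 d y \<phi>) a b m = R13 d y (K2 M \<phi>) a b m"
    by (simp add: K_defs R13_def Rop_def Lop_def algebra_simps i_left_comm[of "M b False"] i_left_comm[of "M b True"])
qed

definition A3 :: "((nat \<Rightarrow> 'b) \<Rightarrow> nat \<Rightarrow> 'b) \<Rightarrow> (bool \<Rightarrow> bool \<Rightarrow> nat \<Rightarrow> 'b) \<Rightarrow> bool \<Rightarrow> bool \<Rightarrow> nat \<Rightarrow> 'b" where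
  "A3 A \<phi> = (\<lambda>a b. A (\<phi> a b))"

lemma R12_A3:
  assumes "rlin A"
  shows "R12 y (A3 A \<phi>) = A3 A (R12 y \<phi>)"
proof (intro ext)
  fix a b m
  have "R12 y \<phi> a b = (if a = b then (\<lambda>m. \<iota> (cc (y * q)) * \<phi> a b m)
     else (\<lambda>m. \<iota> (cc y) * \<phi> a b m + \<iota> (cc q) * \<phi> b a m))"
    by (auto simp: R12_def)
  moreover have "A (\<lambda>m. \<iota> (cc y) * \<phi> a b m + \<iota> (cc q) * \<phi> b a m)
    = (\<lambda>m. \<iota> (cc y) * A (\<phi> a b) m + \<iota> (cc q) * A (\<phi> b a) m)"
    by (subst rlin_add[OF assms]) (simp add: rlin_scale[OF assms])
  ultimately show "R12 y (A3 A \<phi>) a b m = A3 A (R12 y \<phi>) a b m"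
    using assms by (cases "a = b") (simp_all add: A3_def R12_def rlin_scale)
qed

lemma pi12_A3: "rlin A \<Longrightarrow> pi12 (A3 A \<phi>) = A (pi12 \<phi>)"
proof -
  assume "rlin A"
  then have "A (\<lambda>m. \<phi> False True m - \<phi> True False m) = (\<lambda>m. A (\<phi> False True) m - A (\<phi> True False) m)"
    by (rule rlin_diff)
  moreover have "pi12 \<phi> = (\<lambda>m. \<phi> False True m - \<phi> True False m)"
    by (auto simp: pi12_def)
  ultimately show ?thesis
    by (auto simp: A3_def pi12_def)
qed

lemma E23_Kop: "E23 d (Kop M \<phi>) = K1 M (E23 d \<phi>)"
  by (intro ext) (simp add: E23_def Em_def K_defs)

definition pim :: "nat \<Rightarrow> (bool \<Rightarrow> nat \<Rightarrow> 'b) \<Rightarrow> nat \<Rightarrow> 'b" where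
  "pim d \<phi> m = (if m < d then \<phi> False (m + 1) - \<phi> True m else 0)"

lemma pi12_E23: "pi12 (E23 d \<phi>) = pim d \<phi>"
  by (intro ext) (simp add: pi12_def E23_def Em_def pim_def)

section \<open>The fusion recursion for K-operators\<close>

definition dress :: "(bool \<Rightarrow> bool \<Rightarrow> 'b) \<Rightarrow> nat \<Rightarrow> 'k \<Rightarrow> ((nat \<Rightarrow> 'b) \<Rightarrow> nat \<Rightarrow> 'b)
    \<Rightarrow> (bool \<Rightarrow> nat \<Rightarrow> 'b) \<Rightarrow> bool \<Rightarrow> nat \<Rightarrow> 'b" where
  "dress M d y A \<phi> = Kop M (Rop d y (\<lambda>a. A (\<phi> a)))"

text \<open>The fused K-operator with lowest parameter \<open>x\<close>. The argument x^2 q of R is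
  the product of \<open>x\<close> with the lowest parameter xq of the remaining string. The entry
  with index m is read at the position (0 < m, m - 1), one of those whose indices sum to m; by
  \<open>dr_Em\<close> the result depends only on that sum, so this reading inverts
  \<open>Em\<close>.\<close>

primrec cop :: "('k \<Rightarrow> bool \<Rightarrow> bool \<Rightarrow> 'b) \<Rightarrow> nat \<Rightarrow> 'k \<Rightarrow> (nat \<Rightarrow> 'b) \<Rightarrow> nat \<Rightarrow> 'b" where
  "cop K 0 x = (\<lambda>\<psi> m. if m = 0 then \<psi> 0 else 0)"
| "cop K (Suc d) x = (\<lambda>\<psi> m. if m \<le> Suc d then
     dress (K x) d (x\<^sup>2 * q) (cop K d (x * q)) (Em (Suc d) \<psi>) (0 < m) (m - 1) else 0)"

declare cop.simps(2) [simp del]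

lemma dress_add: "rlin A \<Longrightarrow> dress M d y A (\<lambda>a m. \<phi> a m + \<psi> a m) = (\<lambda>a m. dress M d y A \<phi> a m + dress M d y A \<psi> a m)"
  by (intro ext) (simp add: dress_def rlin_add Rop_add Kop_def algebra_simps)

lemma dress_right: "rlin A \<Longrightarrow> dress M d y A (\<lambda>a m. \<phi> a m * c) = (\<lambda>a m. dress M d y A \<phi> a m * c)"
  by (intro ext) (simp add: dress_def rlin_right Rop_right Kop_def algebra_simps)

lemma Em_add: "Em d (\<lambda>m. f m + g m) = (\<lambda>a m. Em d f a m + Em d g a m)"
  and Em_right: "Em d (\<lambda>m. f m * c) = (\<lambda>a m. Em d f a m * c)"
  by (auto simp: Em_def fun_eq_iff)

lemma cop_rlin: "rlin (cop K d x)"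
proof (induction d arbitrary: x)
  case 0
  then show ?case
    by (auto simp: rlin_def)
next
  case (Suc d)
  show ?case
    unfolding rlin_def cop.simps Em_add Em_right dress_add[OF Suc] dress_right[OF Suc]
    by (auto simp: fun_eq_iff)
qed

lemma cop_beyond: "d < m \<Longrightarrow> cop K d x \<psi> m = 0"
  by (cases d) (auto simp: cop.simps(2))

lemma cop_cong:
  assumes "\<And>m. m \<le> d \<Longrightarrow> \<psi> m = \<psi>' m"
  shows "cop K d x \<psi> = cop K d x \<psi>'"
proof (cases d)
  case (Suc d')
  have "Em d \<psi> a = Em d \<psi>' a" for a
    using assms Suc by (auto simp: Em_def)
  then have eq: "Em (Suc d') \<psi> = Em (Suc d') \<psi>'"
    unfolding Suc by blast
  show ?thesis
    unfolding Suc cop.simps eq ..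
qed (use assms in auto)

end

section \<open>Sklyanin determinant and invariance of the fused subspace\<close>

definition asym :: "bool \<Rightarrow> bool \<Rightarrow> nat \<Rightarrow> 'b::ring_1" where
  "asym a b m = (if a = b then 0 else if a then - 1 else 1)"

text \<open>\<open>G\<close> is a domain of parameters, closed under multiplication by q, on which
  the scalars cancelled during fusion do not vanish. The last assumption is the spin-1/2 reflection
  equation.\<close>

locale fusion = qscalars \<iota> q for \<iota> :: "'k::field \<Rightarrow> 'b::ring_1" and q +
  fixes K :: "'k \<Rightarrow> bool \<Rightarrow> bool \<Rightarrow> 'b" and G :: "'k set"
  assumes G0: "x \<in> G \<Longrightarrow> x \<noteq> 0"
    and Gq: "x \<in> G \<Longrightarrow> x * q \<in> G"
    and Gcc2: "x \<in> G \<Longrightarrow> y \<in> G \<Longrightarrow> cc (x * y * q ^ n) \<noteq> 0"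
    and q2: "cc q \<noteq> 0"
    and RE: "x \<in> G \<Longrightarrow> y \<in> G \<Longrightarrow>
      R12 (x / y) (K1 (K x) (R12 (x * y) (K2 (K y) \<phi>))) = K2 (K y) (R12 (x * y) (K1 (K x) (R12 (x / y) \<phi>)))"
begin

lemma Gcc: "x \<in> G \<Longrightarrow> cc (x\<^sup>2 * q ^ n) \<noteq> 0"
  using Gcc2[of x x n] by (simp add: power2_eq_square)

text \<open>The quantum (Sklyanin) determinant of K, read off from the image of the antisymmetric
  vector at the entry where that vector is 1.\<close>

definition gam :: "'k \<Rightarrow> 'b" where
  "gam x = K2 (K (x * q)) (R12 (x\<^sup>2 * q) (K1 (K x) asym)) False True 0"

text \<open>At parameters in ratio 1/q the outer R-matrix of the reflection equation has rank one,
  so both sides are determined by their singlet components.\<close>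

lemma pi12_qdet:
  assumes x: "x \<in> G"
  shows "pi12 (K1 (K x) (R12 (x\<^sup>2 * q) (K2 (K (x * q)) \<phi>))) m = gam x * pi12 \<phi> m"
proof -
  let ?X = "K1 (K x) (R12 (x\<^sup>2 * q) (K2 (K (x * q)) \<phi>))"
  have xx: "x / (x * q) = inverse q" "x * (x * q) = x\<^sup>2 * q"
    using G0[OF x] by (simp_all add: power2_eq_square field_simps)
  \<comment> \<open>The diagonal entries are \<open>cc 1\<close>, hence 0, and the off-diagonal ones
    are opposite to each other: what is left is \<open>pi12\<close> followed by the antisymmetric
    vector.\<close>
  have R: "R12 (inverse q) \<psi> = (\<lambda>a b m. asym a b m * (\<iota> (- cc q) * pi12 \<psi> m))" for \<psi>
    using q0 by (intro ext) (auto simp: R12_def asym_def pi12_def cc_def i_diff algebra_simps)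
  have "R12 (inverse q) ?X False True m = \<iota> (- cc q) * pi12 ?X m"
    by (simp add: R asym_def)
  moreover have "R12 (inverse q) ?X = K2 (K (x * q)) (R12 (x\<^sup>2 * q) (K1 (K x) (R12 (inverse q) \<phi>)))"
    using RE[OF x Gq[OF x], of \<phi>] unfolding xx .
  moreover have "K2 (K (x * q)) (R12 (x\<^sup>2 * q) (K1 (K x) (R12 (inverse q) \<phi>))) False True m
    = gam x * (\<iota> (- cc q) * pi12 \<phi> m)"
    unfolding R gam_def by (simp add: K_defs R12_def asym_def algebra_simps)
  ultimately have "\<iota> (- cc q) * pi12 ?X m = \<iota> (- cc q) * (gam x * pi12 \<phi> m)"
    by (simp add: i_left_comm)
  then show ?thesis
    using q2 i_cancel[of "- cc q"] by simp
qed

definition dr where "dr d x = dress (K x) d (x\<^sup>2 * q) (cop K d (x * q))"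

lemma cop_dr: "cop K (Suc d) x \<psi> m = (if m \<le> Suc d then dr d x (Em (Suc d) \<psi>) (0 < m) (m - 1) else 0)"
  by (simp add: cop.simps(2) dr_def)

lemma dr_zero: "d < m \<Longrightarrow> dr d x \<phi> a m = 0"
  by (simp add: dr_def dress_def Kop_def Rop_beyond)

text \<open>\<open>pim\<close> is the projection onto the quotient of C^2 tensor spin (d+1)/2 by the
  image of \<open>Em\<close>. After embedding the second space into C^2 tensor spin d/2 it becomes
  \<open>pi12\<close>, which first meets \<open>K1 R12 K2\<close> and yields \<open>gam\<close>,
  then meets \<open>R13 R23\<close> and yields \<open>Rdet\<close>; the remaining factor acts on the
  third space alone. The assumption \<open>fus\<close> is the invariance at the previous spin, kept
  as a premise for the induction in \<open>dr_Em\<close>.\<close>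

lemma pim_dr_step:
  assumes x: "x \<in> G"
    and fus: "\<And>\<psi>. dr d (x * q) (Em (Suc d) \<psi>) = Em (Suc d) (cop K (Suc d) (x * q) \<psi>)"
  shows "pim (Suc d) (dr (Suc d) x \<phi>)
    = (\<lambda>m. \<iota> (Rdet d (x\<^sup>2 * q * q)) * (gam x * cop K d (x * q * q) (pim (Suc d) \<phi>) m))"
proof
  fix m
  define y where "y = x\<^sup>2 * q * q"
  define \<chi> where "\<chi> = A3 (cop K d (x * q * q)) (E23 (Suc d) \<phi>)"
  have y0: "y \<noteq> 0" "x\<^sup>2 * q \<noteq> 0" and cy: "cc y \<noteq> 0"
    using G0[OF x] q0 Gcc[OF x, of 2] by (simp_all add: y_def power2_eq_square mult_ac)
  have yq: "(x * q)\<^sup>2 * q = y * q"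
    by (simp add: y_def power2_eq_square mult_ac)
  have "E23 (Suc d) (\<lambda>a. cop K (Suc d) (x * q) (\<phi> a)) = (\<lambda>a. dr d (x * q) (Em (Suc d) (\<phi> a)))"
    by (simp add: E23_def fus)
  also have "\<dots> = K2 (K (x * q)) (R23 d (y * q) \<chi>)"
    by (simp add: dr_def dress_def K2_def R23_def \<chi>_def A3_def E23_def yq)
  finally have e: "E23 (Suc d) (\<lambda>a. cop K (Suc d) (x * q) (\<phi> a)) = K2 (K (x * q)) (R23 d (y * q) \<chi>)" .
  \<comment> \<open>\<open>E23_R\<close> splits the larger R-matrix into \<open>R12 R13\<close>, and
    \<open>K2\<close> is moved to the left of \<open>R13\<close>, next to
    \<open>R12\<close>.\<close>
  have *: "E23 (Suc d) (dr (Suc d) x \<phi>)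
    = K1 (K x) (R12 (x\<^sup>2 * q) (K2 (K (x * q)) (R13 d y (R23 d (y * q) \<chi>))))"
    using E23_R[OF y0(2), of d "\<lambda>a. cop K (Suc d) (x * q) (\<phi> a)"] cy
    by (simp add: dr_def dress_def E23_Kop y_def[symmetric] e K2_R13)
  have p\<chi>: "pi12 \<chi> = cop K d (x * q * q) (pim (Suc d) \<phi>)"
    by (simp add: \<chi>_def pi12_A3 cop_rlin pi12_E23)
  have "pim (Suc d) (dr (Suc d) x \<phi>) m = pi12 (E23 (Suc d) (dr (Suc d) x \<phi>)) m"
    by (simp add: pi12_E23)
  also have "\<dots> = gam x * pi12 (R13 d y (R23 d (y * q) \<chi>)) m"
    unfolding * by (rule pi12_qdet[OF x])
  also have "\<dots> = gam x * (\<iota> (Rdet d y) * cop K d (x * q * q) (pim (Suc d) \<phi>) m)"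
    unfolding R_qdet[OF y0(1)] p\<chi> by (simp add: cop_beyond)
  finally show "pim (Suc d) (dr (Suc d) x \<phi>) m
      = \<iota> (Rdet d (x\<^sup>2 * q * q)) * (gam x * cop K d (x * q * q) (pim (Suc d) \<phi>) m)"
    by (simp only: i_left_comm y_def)
qed

lemma pim_Em [simp]: "pim d (Em (Suc d) \<psi>) = (\<lambda>m. 0)"
  by (auto simp: pim_def Em_def)

text \<open>The kernel of \<open>pim\<close> is the image of \<open>Em\<close>. The last two
  hypotheses list the positions at which \<open>cop\<close> reads its values.\<close>

lemma eq_Em_iff_pim:
  assumes "\<And>m. m < d \<Longrightarrow> pim d \<phi> m = 0"
    and "\<And>a m. d < m \<Longrightarrow> \<phi> a m = 0"
    and "\<phi> False 0 = \<psi> 0" and "\<And>m. m \<le> d \<Longrightarrow> \<phi> True m = \<psi> (Suc m)"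
  shows "\<phi> = Em (Suc d) \<psi>"
proof (intro ext)
  fix a m
  show "\<phi> a m = Em (Suc d) \<psi> a m"
  proof (cases "m \<le> d")
    case True
    show ?thesis
    proof (cases "a \<or> m = 0")
      case False
      then obtain l where l: "m = Suc l" "\<not> a"
        by (cases m) auto
      with True assms(1)[of l] assms(4)[of l] show ?thesis
        by (simp add: pim_def Em_def)
    qed (use True assms(3,4) in \<open>auto simp: Em_def\<close>)
  qed (simp add: Em_def assms(2))
qed

text \<open>By \<open>pim_dr_step\<close> the two-site operator descends to the quotient by the
  image of \<open>Em\<close>, and \<open>pim\<close> kills that image; so the image is mapped into
  itself.\<close>

lemma dr_Em: "x \<in> G \<Longrightarrow> dr d x (Em (Suc d) \<psi>) = Em (Suc d) (cop K (Suc d) x \<psi>)"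
proof (induction d arbitrary: x \<psi>)
  case 0
  then show ?case
    by (intro eq_Em_iff_pim) (auto simp: pim_def dr_zero cop_dr)
next
  case (Suc d)
  have "pim (Suc d) (dr (Suc d) x (Em (Suc (Suc d)) \<psi>)) = (\<lambda>m. 0)"
    unfolding pim_dr_step[OF Suc.prems Suc.IH[OF Gq[OF Suc.prems]]] pim_Em rlin_zero[OF cop_rlin] by simp
  then show ?case
    by (intro eq_Em_iff_pim) (simp_all add: dr_zero cop_dr fun_eq_iff)
qed

lemmas pim_dr = pim_dr_step[OF _ dr_Em[OF Gq]]

end

section \<open>Fusion from the highest parameter\<close>

context fusion begin

lemma Gpow: "x \<in> G \<Longrightarrow> x * q ^ n \<in> G"
  by (induction n) (simp_all add: Gq mult.assoc[symmetric] mult.commute[of q])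

text \<open>The mirror image of \<open>dr\<close>: the spin-1/2 factor carries the highest parameter
  x q^d and acts first.\<close>

definition hr where
  "hr d x \<phi> = (\<lambda>a. cop K d x (Rop d (x\<^sup>2 * q ^ d) (Kop (K (x * q ^ d)) \<phi>) a))"

lemma hr_beyond: "d < m \<Longrightarrow> hr d x \<phi> a m = 0"
  by (simp add: hr_def cop_beyond)

lemma Em_swap: "Em (Suc d) (Em (Suc (Suc d)) \<psi> a) b = Em (Suc d) (Em (Suc (Suc d)) \<psi> b) a"
  by (intro ext) (auto simp: Em_def)

lemma R12_swap: "R12 y (\<lambda>a b. \<phi> b a) = (\<lambda>a b. R12 y \<phi> b a)"
  by (intro ext) (simp add: R12_def)

lemma K1_swap: "K1 M (\<lambda>a b. \<phi> b a) = (\<lambda>a b. K2 M \<phi> b a)"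
  and K2_swap: "K2 M (\<lambda>a b. \<phi> b a) = (\<lambda>a b. K1 M \<phi> b a)"
  by (simp_all add: K1_def K2_def)

text \<open>The string of parameters may be assembled from either end. On C^2 tensor C^2 tensor spin
  d/2 one splits off the lowest factor by \<open>E23_R'\<close> and keeps the middle part
  \<open>\<chi>\<close>. A twice fused vector is symmetric in the two C^2 (\<open>Em_swap\<close>),
  so with these exchanged \<open>\<chi>\<close> is also what \<open>E23_R\<close> produces when the
  highest factor is split off.\<close>

lemma hr_Em: "x \<in> G \<Longrightarrow> hr d x (Em (Suc d) \<psi>) = Em (Suc d) (cop K (Suc d) x \<psi>)"
proof (induction d arbitrary: x \<psi>)
  case 0
  have "cc (x\<^sup>2) \<noteq> 0" "cc (x\<^sup>2 * q) \<noteq> 0"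
    using Gcc[OF 0, of 0] Gcc[OF 0, of 1] by simp_all
  then show ?case
    by (intro ext) (auto simp: hr_def Em_def cop_dr dr_def dress_def Kop_def Rop_0)
next
  case (Suc d)
  define y where "y = x\<^sup>2 * q ^ Suc d"
  define \<Phi> where "\<Phi> = Em (Suc (Suc d)) \<psi>"
  define \<Xi> where "\<Xi> = Rop (Suc d) y (Kop (K (x * q ^ Suc d)) \<Phi>)"
  note xG = Suc.prems
  have nz: "x\<^sup>2 * q \<noteq> 0" "y \<noteq> 0" "cc (x\<^sup>2 * q) \<noteq> 0" "cc (y * q) \<noteq> 0"
    using G0[OF xG] q0 Gcc[OF xG, of 1] Gcc[OF xG, of "Suc (Suc d)"] by (simp_all add: y_def mult_ac)
  have e: "E23 (Suc d) (\<lambda>a. cop K (Suc d) (x * q) (\<Phi> a))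
    = A3 (cop K d (x * q)) (R23 d (y * q) (K2 (K (x * q ^ Suc d)) (E23 (Suc d) \<Phi>)))"
    unfolding E23_def Suc.IH[OF Gq[OF xG], symmetric]
    by (simp add: hr_def A3_def R23_def K2_def y_def power2_eq_square mult_ac)
  have yy: "x\<^sup>2 * q * q ^ d = y"
    by (simp add: y_def mult_ac)
  define \<chi> where "\<chi> = R12 y (R23 d (y * q) (K2 (K (x * q ^ Suc d)) (E23 (Suc d) \<Phi>)))"
  have E\<Phi>: "E23 (Suc d) \<Phi> = (\<lambda>a b. E23 (Suc d) \<Phi> b a)"
    by (simp add: E23_def \<Phi>_def fun_eq_iff) (metis Em_swap)
  have "\<chi> = (\<lambda>a b. R12 y (R13 d (y * q) (K1 (K (x * q ^ Suc d)) (E23 (Suc d) \<Phi>))) b a)"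
    unfolding \<chi>_def R12_swap[symmetric]
    by (subst E\<Phi>) (simp add: R23_def R13_def K2_def K1_def)
  also have "\<dots> = (\<lambda>a b. E23 (Suc d) \<Xi> b a)"
    by (simp only: E23_R[OF nz(2,4)] E23_Kop \<Xi>_def)
  finally have \<chi>: "\<chi> = (\<lambda>a b. Em (Suc d) (\<Xi> b) a)"
    by (simp add: E23_def)
  have "E23 (Suc d) (dr (Suc d) x \<Phi>) = K1 (K x) (R13 d (x\<^sup>2 * q) (R12 y (A3 (cop K d (x * q))
      (R23 d (y * q) (K2 (K (x * q ^ Suc d)) (E23 (Suc d) \<Phi>))))))"
    using E23_R'[OF nz(1,3)] by (simp add: dr_def dress_def E23_Kop e yy)
  also have "\<dots> = K1 (K x) (R13 d (x\<^sup>2 * q) (A3 (cop K d (x * q)) \<chi>))"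
    by (simp add: R12_A3 cop_rlin \<chi>_def)
  also have "\<dots> = (\<lambda>a b. dr d x (\<lambda>a'. \<chi> a' b) a)"
    by (simp add: dr_def dress_def K1_def R13_def A3_def)
  also have "\<dots> = (\<lambda>a b. Em (Suc d) (cop K (Suc d) x (\<Xi> b)) a)"
    unfolding \<chi> by (simp add: dr_Em[OF xG])
  also have "\<dots> = (\<lambda>a b. Em (Suc d) (hr (Suc d) x \<Phi> b) a)"
    by (simp add: hr_def \<Xi>_def y_def)
  finally have main: "E23 (Suc d) (Em (Suc (Suc d)) (cop K (Suc (Suc d)) x \<psi>)) a b m = Em (Suc d) (hr (Suc d) x \<Phi> b) a m" for a b m
    unfolding \<Phi>_def dr_Em[OF xG] by (simp add: fun_eq_iff)
  show ?case
  proof (intro ext)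
    fix b n
    show "hr (Suc d) x (Em (Suc (Suc d)) \<psi>) b n = Em (Suc (Suc d)) (cop K (Suc (Suc d)) x \<psi>) b n"
    proof (cases "n \<le> Suc d")
      case True
      then show ?thesis
        using main[of "0 < n" b "n - 1"] by (cases n) (auto simp: E23_def Em_def \<Phi>_def)
    qed (simp add: hr_beyond Em_def)
  qed
qed

text \<open>Here the determinant appears next to the vector, underneath \<open>cop\<close>. Being
  central it can be written on the right, and \<open>cop\<close> is linear over right
  multiplication.\<close>

lemma pim_hr:
  assumes x: "x \<in> G" and central: "\<And>b. gam (x * q ^ d) * b = b * gam (x * q ^ d)"
  shows "pim (Suc d) (hr (Suc d) x \<phi>)
    = (\<lambda>m. \<iota> (Rdet d (x\<^sup>2 * q ^ d)) * (gam (x * q ^ d) * cop K d x (pim (Suc d) \<phi>) m))"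
proof -
  define y where "y = x\<^sup>2 * q ^ d"
  define x' where "x' = x * q ^ d"
  define Z where "Z = K2 (K x') (R12 (x'\<^sup>2 * q) (K1 (K (x' * q)) (E23 (Suc d) \<phi>)))"
  have x'G: "x' \<in> G"
    by (simp add: x'_def Gpow x)
  have nz: "y \<noteq> 0" "y * q \<noteq> 0" "cc (y * q) \<noteq> 0"
    using G0[OF x] q0 Gcc[OF x, of "Suc d"] by (simp_all add: y_def mult_ac)
  have eqs: "x\<^sup>2 * q ^ Suc d = y * q" "x * q ^ Suc d = x' * q" "y * q * q ^ d = x'\<^sup>2 * q"
    by (simp_all add: y_def x'_def power2_eq_square mult_ac)
  have "E23 (Suc d) (hr (Suc d) x \<phi>)
    = (\<lambda>a. hr d x (Em (Suc d) (Rop (Suc d) (x\<^sup>2 * q ^ Suc d) (Kop (K (x * q ^ Suc d)) \<phi>) a)))"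
    by (simp add: E23_def hr_Em[OF x] hr_def[of "Suc d"])
  also have "\<dots> = A3 (cop K d x) (R23 d y (K2 (K x') (E23 (Suc d) (Rop (Suc d) (y * q) (Kop (K (x' * q)) \<phi>)))))"
    unfolding eqs by (simp add: hr_def A3_def R23_def K2_def E23_def y_def x'_def)
  also have "\<dots> = A3 (cop K d x) (R23 d y (R13 d (y * q) Z))"
    unfolding E23_R'[OF nz(2,3)] eqs E23_Kop K2_R13 Z_def ..
  finally have e: "E23 (Suc d) (hr (Suc d) x \<phi>) = A3 (cop K d x) (R23 d y (R13 d (y * q) Z))" .
  \<comment> \<open>Exchanging the two C^2 brings the factors into the order of
    \<open>pi12_qdet\<close>. The functional changes sign once on the result and once on the
    argument, so the signs cancel.\<close>
  have "Z = (\<lambda>a b. K1 (K x') (R12 (x'\<^sup>2 * q) (K2 (K (x' * q)) (\<lambda>a b. E23 (Suc d) \<phi> b a))) b a)"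
    unfolding Z_def K2_swap[of "K (x' * q)" "E23 (Suc d) \<phi>"]
      R12_swap[of "x'\<^sup>2 * q" "K1 (K (x' * q)) (E23 (Suc d) \<phi>)"]
      K1_swap[of "K x'" "R12 (x'\<^sup>2 * q) (K1 (K (x' * q)) (E23 (Suc d) \<phi>))"] ..
  then have "pi12 Z m = - pi12 (K1 (K x') (R12 (x'\<^sup>2 * q) (K2 (K (x' * q)) (\<lambda>a b. E23 (Suc d) \<phi> b a)))) m" for m
    by (simp add: pi12_def)
  also have "\<dots> m = gam x' * pi12 (E23 (Suc d) \<phi>) m" for m
    unfolding pi12_qdet[OF x'G] by (simp add: pi12_def algebra_simps)
  finally have Z: "pi12 Z = (\<lambda>m. gam x' * pim (Suc d) \<phi> m)"
    by (simp add: pi12_E23 fun_eq_iff)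
  have "pi12 (R23 d y (R13 d (y * q) Z)) = (\<lambda>m. \<iota> (Rdet d y) * (pim (Suc d) \<phi> m * gam x'))"
    using central by (auto simp: R_qdet'[OF nz(1)] Z pim_def x'_def fun_eq_iff)
  then have "pim (Suc d) (hr (Suc d) x \<phi>) = cop K d x (\<lambda>m. \<iota> (Rdet d y) * (pim (Suc d) \<phi> m * gam x'))"
    by (simp add: pi12_E23[symmetric] e pi12_A3 cop_rlin)
  also have "\<dots> = (\<lambda>m. \<iota> (Rdet d y) * (cop K d x (pim (Suc d) \<phi>) m * gam x'))"
    by (simp add: rlin_scale[OF cop_rlin] rlin_right[OF cop_rlin])
  finally show ?thesis
    using central by (simp add: y_def x'_def)
qed

end

section \<open>Fused reflection equation and centrality of the determinant\<close>

context fusion begin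

text \<open>The inductive step of the fused reflection equation before restriction to the fused
  subspace: the spin-1/2 equation in the first two spaces, both forms of Yang-Baxter, then the
  equation assumed for the third space. It is kept separate because \<open>gam_commute\<close>
  projects the same identity onto the singlet instead.\<close>

lemma exchange:
  assumes v: "v \<in> G" and x: "x \<in> G" and Y: "Y * (x * q ^ d) = v" and A: "rlin A"
    and RE_A: "\<And>\<phi>. Rop d Y (Kop (K v) (Rop d (v * x * q) (\<lambda>a. A (\<phi> a))))
      = (\<lambda>a. A (Rop d (v * x * q) (Kop (K v) (Rop d Y \<phi>)) a))"
  shows "R13 d Y (R12 (Y * q ^ d) (K1 (K v) (R12 (v * x) (R13 d (v * x * q) (K2 (K x) (R23 d (x\<^sup>2 * q) (A3 A \<phi>)))))))
    = K2 (K x) (R23 d (x\<^sup>2 * q) (A3 A (R12 (v * x) (R13 d (v * x * q) (K1 (K v) (R13 d Y (R12 (Y * q ^ d) \<phi>)))))))"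
proof -
  have nz: "x \<noteq> 0" "v \<noteq> 0" "Y \<noteq> 0" "x\<^sup>2 * q \<noteq> 0" "v / x \<noteq> 0"
    using G0[OF x] G0[OF v] q0 Y by auto
  have eqs: "Y * q ^ d = v / x" "v / x * (x\<^sup>2 * q) = v * x * q"  "Y * (x\<^sup>2 * q) * q ^ d / q = v * x"
    using nz q0 Y by (auto simp: power2_eq_square field_simps)
  have RE_A3: "R13 d Y (K1 (K v) (R13 d (v * x * q) (A3 A \<psi>))) = A3 A (R13 d (v * x * q) (K1 (K v) (R13 d Y \<psi>)))" for \<psi>
    using RE_A[of "\<lambda>a. \<psi> a b" for b] by (simp add: R13_def K1_def A3_def fun_eq_iff)
  have R1: "R12 (v / x) (R13 d (v * x * q) (R23 d (x\<^sup>2 * q) \<psi>)) = R23 d (x\<^sup>2 * q) (R13 d (v * x * q) (R12 (v / x) \<psi>))" for \<psi>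
    using RRR[OF nz(4,5), of d \<psi>] unfolding eqs .
  have R2: "R13 d Y (R12 (v * x) (R23 d (x\<^sup>2 * q) \<psi>)) = R23 d (x\<^sup>2 * q) (R12 (v * x) (R13 d Y \<psi>))" for \<psi>
    using RRR'[OF nz(3,4), of d \<psi>] unfolding eqs .
  show ?thesis
    unfolding eqs K2_R13[symmetric] RE[OF v x] R1
    unfolding R12_A3[OF A] K1_R23 K2_R13[symmetric] R2 RE_A3 R12_A3[OF A] ..
qed

lemma E23_eqD: "E23 (Suc d) \<phi> = E23 (Suc d) \<phi>' \<Longrightarrow> m \<le> Suc d \<Longrightarrow> \<phi> a m = \<phi>' a m"
proof -
  assume e: "E23 (Suc d) \<phi> = E23 (Suc d) \<phi>'" and m: "m \<le> Suc d"
  have "E23 (Suc d) \<phi> a (0 < m) (m - 1) = E23 (Suc d) \<phi>' a (0 < m) (m - 1)"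
    by (simp add: e)
  with m show ?thesis
    by (cases m) (simp_all add: E23_def Em_def)
qed

text \<open>In the shifted normalisation \<open>Y\<close> plays the role of the ratio of parameters:
  Y = v q / (x q^d), which is v / x for d = 1. The identity is checked after \<open>E23\<close>,
  which loses nothing on indices up to the spin.\<close>

lemma fused_RE:
  "\<lbrakk>v \<in> G; x \<in> G; Y * (x * q ^ d) = v * q; cc Y \<noteq> 0\<rbrakk> \<Longrightarrow>
    Rop d Y (Kop (K v) (Rop d (v * x) (\<lambda>a. cop K d x (\<phi> a))))
      = (\<lambda>a. cop K d x (Rop d (v * x) (Kop (K v) (Rop d Y \<phi>)) a))"
proof (induction d arbitrary: x \<phi>)
  case 0
  have "cc (v * x) \<noteq> 0"
    using Gcc2[OF 0(1,2), of 0] by simp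
  then show ?case
    using 0 by (intro ext) (simp add: Rop_0 Kop_def)
next
  case (Suc d)
  note v = Suc.prems(1) and x = Suc.prems(2)
  have Y: "Y * (x * q ^ d) = v"
    using Suc.prems(3) q0 by (simp add: mult_ac)
  have nz: "Y \<noteq> 0" "v * x \<noteq> 0" "cc (v * x * q) \<noteq> 0"
    using G0[OF v] G0[OF x] q0 Suc.prems(3) Gcc2[OF v x, of 1] by auto
  have E23_cop: "E23 (Suc d) (\<lambda>a. cop K (Suc d) x (\<psi> a)) = K2 (K x) (R23 d (x\<^sup>2 * q) (A3 (cop K d (x * q)) (E23 (Suc d) \<psi>)))" for \<psi>
    by (simp add: E23_def dr_Em[OF x, symmetric]) (simp add: dr_def dress_def K2_def R23_def A3_def)
  have "E23 (Suc d) (Rop (Suc d) Y (Kop (K v) (Rop (Suc d) (v * x) (\<lambda>a. cop K (Suc d) x (\<phi> a)))))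
    = R13 d Y (R12 (Y * q ^ d) (K1 (K v) (R12 (v * x) (R13 d (v * x * q) (K2 (K x) (R23 d (x\<^sup>2 * q) (A3 (cop K d (x * q)) (E23 (Suc d) \<phi>))))))))"
    by (simp only: E23_R'[OF nz(1) Suc.prems(4)] E23_Kop E23_R[OF nz(2,3)] E23_cop)
  also have "\<dots> = K2 (K x) (R23 d (x\<^sup>2 * q) (A3 (cop K d (x * q)) (R12 (v * x) (R13 d (v * x * q) (K1 (K v) (R13 d Y (R12 (Y * q ^ d) (E23 (Suc d) \<phi>))))))))"
    using Suc.IH[OF v Gq[OF x] _ Suc.prems(4)] Suc.prems(3)
    by (intro exchange[OF v x Y cop_rlin]) (simp add: mult_ac)
  also have "\<dots> = E23 (Suc d) (\<lambda>a. cop K (Suc d) x (Rop (Suc d) (v * x) (Kop (K v) (Rop (Suc d) Y \<phi>)) a))"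
    by (simp only: E23_R'[OF nz(1) Suc.prems(4)] E23_Kop E23_R[OF nz(2,3)] E23_cop)
  finally have "E23 (Suc d) (Rop (Suc d) Y (Kop (K v) (Rop (Suc d) (v * x) (\<lambda>a. cop K (Suc d) x (\<phi> a)))))
    = E23 (Suc d) (\<lambda>a. cop K (Suc d) x (Rop (Suc d) (v * x) (Kop (K v) (Rop (Suc d) Y \<phi>)) a))" .
  from E23_eqD[OF this] show ?case
    by (intro ext) (metis Rop_beyond cop_beyond not_le)
qed

definition pim23 :: "(bool \<Rightarrow> bool \<Rightarrow> nat \<Rightarrow> 'b) \<Rightarrow> bool \<Rightarrow> 'b" where
  "pim23 \<phi> a = pim 1 (\<phi> a) 0"

text \<open>For d = 1 the last two spaces are both of dimension 2, and R-matrices between the first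
  space and their singlet reduce to a scalar.\<close>

lemma pim23_qdet:
  assumes y0: "y \<noteq> 0"
  shows "pim23 (R12 y (R13 1 (y * q) \<phi>)) a = \<iota> (cc y * cc (y * q\<^sup>2)) * pim23 \<phi> a"
    and "pim23 (R13 1 y (R12 (y * q) \<phi>)) a = \<iota> (cc y * cc (y * q\<^sup>2)) * pim23 \<phi> a"
proof -
  define ya qa where "ya = inverse y" and "qa = inverse q"
  have r: "y * ya = 1" "\<And>w. y * (ya * w) = w" "q * qa = 1" "\<And>w. q * (qa * w) = w"
    using y0 q0 by (simp_all add: ya_def qa_def)
  have "f (pim23 (R12 y (R13 1 (y * q) \<phi>)) a) = f (\<iota> (cc y * cc (y * q\<^sup>2)) * pim23 \<phi> a)
      \<and> f (pim23 (R13 1 y (R12 (y * q) \<phi>)) a) = f (\<iota> (cc y * cc (y * q\<^sup>2)) * pim23 \<phi> a)"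
    if f: "\<And>x y. f (x + y) = f x + f y" "\<And>x y. f (x - y) = f x - f y" "\<And>x. f (- x) = - f x"
      "f 0 = 0" "\<And>k x. f (\<iota> k * x) = k * f x" for f :: "'b \<Rightarrow> 'k"
    by (cases a; simp add: pim23_def pim_def R13_L op_defs Rpre_def f cc_def power2_eq_square ya_def[symmetric] qa_def[symmetric];
      simp add: algebra_simps r)
  note * = this
  show "pim23 (R12 y (R13 1 (y * q) \<phi>)) a = \<iota> (cc y * cc (y * q\<^sup>2)) * pim23 \<phi> a"
    by (rule functional_ext) (use * in blast)
  show "pim23 (R13 1 y (R12 (y * q) \<phi>)) a = \<iota> (cc y * cc (y * q\<^sup>2)) * pim23 \<phi> a"
    by (rule functional_ext) (use * in blast)
qed

text \<open>Project \<open>exchange\<close> with d = 1 onto the singlet of the last two spaces: the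
  R-matrices become the scalars \<open>s\<close> and \<open>s'\<close>, the two-site operator
  becomes \<open>gam x\<close>, and only \<open>K v\<close> is left on the first space. The
  conditions on v and x make \<open>s\<close> nonzero.\<close>

lemma gam_commute:
  assumes v: "v \<in> G" and x: "x \<in> G" and nz: "cc (v / (x * q)) \<noteq> 0" "cc (v * q / x) \<noteq> 0"
  shows "K v a c * gam x = gam x * K v a c"
proof -
  define Y where "Y = v / (x * q)"
  \<comment> \<open>Its singlet component is the basis vector \<open>c\<close> of the first space,
    so the projection produces the entry (a, c) of \<open>K v\<close>.\<close>
  define \<phi> :: "bool \<Rightarrow> bool \<Rightarrow> nat \<Rightarrow> 'b" where "\<phi> = (\<lambda>a' b m. if a' = c \<and> \<not> b \<and> m = 1 then 1 else 0)"
  define s where "s = cc Y * cc (Y * q\<^sup>2)"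
  define s' where "s' = cc (v * x) * cc (v * x * q\<^sup>2)"
  define W where "W = K2 (K x) (R23 1 (x\<^sup>2 * q) (A3 (cop K 1 (x * q)) \<phi>))"
  have x0: "x \<noteq> 0" "v \<noteq> 0"
    using G0[OF x] G0[OF v] by auto
  have Y: "Y * (x * q ^ 1) = v" "Y * (x * q * q ^ 1) = v * q" "Y \<noteq> 0" "cc Y \<noteq> 0"
    using x0 q0 nz by (simp_all add: Y_def)
  have s: "s \<noteq> 0" "s' \<noteq> 0"
    using nz Gcc2[OF v x, of 0] Gcc2[OF v x, of 2] x0 q0
    by (simp_all add: s_def s'_def Y_def power2_eq_square)
  have P_dr: "pim23 (K2 (K x) (R23 1 (x\<^sup>2 * q) (A3 (cop K 1 (x * q)) \<psi>))) a' = gam x * pim23 \<psi> a'" for \<psi> a'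
  proof -
    have "cc (x\<^sup>2 * q * q) \<noteq> 0" "cc (x\<^sup>2 * q * q * q) \<noteq> 0"
      using Gcc[OF x, of 2] Gcc[OF x, of 3] by (simp_all add: eval_nat_numeral mult_ac)
    then have "Rdet 0 (x\<^sup>2 * q * q) = 1"
      by (simp add: Rdet_def Rpre_def field_simps)
    then show ?thesis
      using pim_dr[OF x, of 0 "\<psi> a'"] x
      by (simp add: pim23_def dr_def dress_def K2_def R23_def A3_def)
  qed
  have P_K1: "pim23 (K1 (K v) \<psi>) a' = K v a' False * pim23 \<psi> False + K v a' True * pim23 \<psi> True" for \<psi> a'
    by (simp add: pim23_def pim_def K1_def Kop_def algebra_simps)
  have P\<phi>: "pim23 \<phi> a' = of_bool (a' = c)" for a'
    by (simp add: pim23_def pim_def \<phi>_def)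
  have ex: "R13 1 Y (R12 (Y * q) (K1 (K v) (R12 (v * x) (R13 1 (v * x * q) W))))
    = K2 (K x) (R23 1 (x\<^sup>2 * q) (A3 (cop K 1 (x * q)) (R12 (v * x) (R13 1 (v * x * q) (K1 (K v) (R13 1 Y (R12 (Y * q) \<phi>)))))))"
  proof -
    have "Rop 1 Y (Kop (K v) (Rop 1 (v * x * q) (\<lambda>a. cop K 1 (x * q) (\<psi> a))))
      = (\<lambda>a. cop K 1 (x * q) (Rop 1 (v * x * q) (Kop (K v) (Rop 1 Y \<psi>)) a))" for \<psi>
      using fused_RE[OF v Gq[OF x] Y(2,4), of \<psi>] unfolding mult.assoc .
    from exchange[OF v x Y(1) cop_rlin this, of \<phi>] show ?thesis
      unfolding W_def power_one_right .
  qed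
  have l: "pim23 W a' = gam x * of_bool (a' = c)" for a'
    by (simp add: W_def P_dr P\<phi> del: One_nat_def)
  have "pim23 (R13 1 Y (R12 (Y * q) (K1 (K v) (R12 (v * x) (R13 1 (v * x * q) W))))) a
    = \<iota> s * (K v a False * (\<iota> s' * pim23 W False) + K v a True * (\<iota> s' * pim23 W True))"
    using x0 by (simp add: pim23_qdet Y(3) P_K1 s_def s'_def del: One_nat_def)
  also have "\<dots> = \<iota> (s * s') * (K v a c * gam x)"
    unfolding i_left_comm[of "K v a False" s'] i_left_comm[of "K v a True" s'] l
    by (cases c) (simp_all add: i_mult mult.assoc)
  finally have L: "pim23 (R13 1 Y (R12 (Y * q) (K1 (K v) (R12 (v * x) (R13 1 (v * x * q) W))))) a
    = \<iota> (s * s') * (K v a c * gam x)" .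
  have "pim23 (K2 (K x) (R23 1 (x\<^sup>2 * q) (A3 (cop K 1 (x * q)) (R12 (v * x) (R13 1 (v * x * q) (K1 (K v) (R13 1 Y (R12 (Y * q) \<phi>)))))))) a
    = gam x * (\<iota> s' * (K v a False * (\<iota> s * pim23 \<phi> False) + K v a True * (\<iota> s * pim23 \<phi> True)))"
    using x0 by (simp add: pim23_qdet Y(3) P_K1 P_dr s_def s'_def del: One_nat_def)
  also have "\<dots> = \<iota> (s * s') * (gam x * K v a c)"
    unfolding i_left_comm[of "K v a False" s] i_left_comm[of "K v a True" s] i_left_comm[of "gam x" s'] P\<phi>
    by (cases c) (simp_all add: i_left_comm[of "gam x" s] i_mult mult.assoc i_left_comm[of "\<iota> s'" s])
  finally have "\<iota> (s * s') * (K v a c * gam x) = \<iota> (s * s') * (gam x * K v a c)"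
    unfolding L[symmetric] ex .
  then show ?thesis
    by (rule i_cancel[rotated]) (simp add: s)
qed

end

section \<open>Transposition of numerical K-matrices\<close>

text \<open>The dual K-matrix is the transpose of a fused matrix, whereas the trace identity fuses a
  transposed matrix; hence both K and its transpose are required to satisfy the reflection
  equation.\<close>

locale numeric_fusion =
  fusion "id :: 'k::field \<Rightarrow> 'k" q K G + tr: fusion "id" q "\<lambda>x a b. K x b a" G for q K G +
  assumes qn: "0 < n \<Longrightarrow> cc (q ^ n) \<noteq> 0"
begin

text \<open>The q-binomial coefficient of d and m. In the rescaled basis R is not symmetric, but it
  is self-adjoint for the form with these weights (\<open>Rop_adjoint\<close>).\<close>

definition wt :: "nat \<Rightarrow> nat \<Rightarrow> 'k" where
  "wt d m = (\<Prod>p<m. cc (q ^ (d - p)) / cc (q ^ Suc p))"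

lemma wt_Suc: "wt d (Suc m) * cc (q ^ Suc m) = wt d m * cc (q ^ (d - m))"
  using qn[of "Suc m"] by (simp add: wt_def)

lemma wt_lower: "m \<le> d \<Longrightarrow> wt (Suc d) m * cc (q ^ (Suc d - m)) = cc (q ^ Suc d) * wt d m"
proof (induction m)
  case (Suc m)
  have "wt (Suc d) (Suc m) * cc (q ^ Suc m) = wt (Suc d) m * cc (q ^ (Suc d - m))"
    by (rule wt_Suc)
  also have "\<dots> = cc (q ^ Suc d) * wt d m"
    using Suc by simp
  finally have step: "wt (Suc d) (Suc m) * cc (q ^ Suc m) = cc (q ^ Suc d) * wt d m" .
  have "wt (Suc d) (Suc m) * cc (q ^ (d - m)) * cc (q ^ Suc m) = cc (q ^ Suc d) * (wt d m * cc (q ^ (d - m)))"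
    unfolding mult.assoc[symmetric] step[symmetric] by (simp only: mult_ac)
  also have "\<dots> = cc (q ^ Suc d) * wt d (Suc m) * cc (q ^ Suc m)"
    unfolding wt_Suc[symmetric] by (simp only: mult_ac)
  finally show ?case
    using qn[of "Suc m"] by (simp del: power_Suc)
qed (simp add: wt_def)

lemma wt_lower': "m \<le> d \<Longrightarrow> wt (Suc d) (Suc m) * cc (q ^ Suc m) = cc (q ^ Suc d) * wt d m"
  using wt_lower[of m d] wt_Suc[of "Suc d" m] by simp

definition form :: "nat \<Rightarrow> (nat \<Rightarrow> 'k) \<Rightarrow> (nat \<Rightarrow> 'k) \<Rightarrow> 'k" where
  "form d f g = (\<Sum>m\<le>d. wt d m * f m * g m)"

definition form2 :: "nat \<Rightarrow> (bool \<Rightarrow> nat \<Rightarrow> 'k) \<Rightarrow> (bool \<Rightarrow> nat \<Rightarrow> 'k) \<Rightarrow> 'k" where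
  "form2 d \<phi> \<psi> = form d (\<phi> False) (\<psi> False) + form d (\<phi> True) (\<psi> True)"

text \<open>The adjoint of \<open>Em\<close> up to the scalar in \<open>Ead_adjoint\<close>. It also
  occurs in R itself: see \<open>Lop_q\<close>.\<close>

definition Ead :: "nat \<Rightarrow> (bool \<Rightarrow> nat \<Rightarrow> 'k) \<Rightarrow> nat \<Rightarrow> 'k" where
  "Ead d \<phi> m = cc (q ^ (Suc d - m)) * \<phi> False m + cc (q ^ m) * \<phi> True (m - 1)"

lemma cc_1 [simp]: "cc 1 = 0"
  by (simp add: cc_def)

lemma form_shift:
  "(\<Sum>m\<le>d. wt d m * cc (q ^ m) * F m) = (\<Sum>m\<le>d. wt d m * cc (q ^ (d - m)) * F (Suc m))"
proof -
  have "(\<Sum>m\<le>d. wt d m * cc (q ^ (d - m)) * F (Suc m)) = (\<Sum>m<d. wt d (Suc m) * cc (q ^ Suc m) * F (Suc m))"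
    by (simp only: lessThan_Suc_atMost[symmetric] sum.lessThan_Suc wt_Suc) simp
  also have "\<dots> = (\<Sum>m\<le>d. wt d m * cc (q ^ m) * F m)"
    by (subst sum.atMost_shift) simp
  finally show ?thesis by simp
qed

lemma form2_Rpre:
  "form2 d \<phi> (Rop d y \<psi>) = Rpre d y * form2 d \<phi> (Lop d y \<psi>)"
  "form2 d (Rop d y \<phi>) \<psi> = Rpre d y * form2 d (Lop d y \<phi>) \<psi>"
  by (simp_all add: form2_def form_def Rop_def sum_distrib_left distrib_left mult_ac)

lemma Rop_adjoint: "form2 d \<phi> (Rop d y \<psi>) = form2 d (Rop d y \<phi>) \<psi>"
proof -
  have 1: "(\<Sum>m\<le>d. wt d m * cc (q ^ m) * (\<phi> False m * \<psi> True (m - 1)))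
    = (\<Sum>m\<le>d. wt d m * cc (q ^ (d - m)) * (\<phi> False (Suc m) * \<psi> True m))"
    using form_shift[of d "\<lambda>m. \<phi> False m * \<psi> True (m - 1)"] by simp
  have 2: "(\<Sum>m\<le>d. wt d m * cc (q ^ m) * (\<psi> False m * \<phi> True (m - 1)))
    = (\<Sum>m\<le>d. wt d m * cc (q ^ (d - m)) * (\<psi> False (Suc m) * \<phi> True m))"
    using form_shift[of d "\<lambda>m. \<psi> False m * \<phi> True (m - 1)"] by simp
  have "form2 d \<phi> (Lop d y \<psi>) = form2 d (Lop d y \<phi>) \<psi>"
    using 1 2 by (simp add: form2_def form_def Lop_def sum.distrib algebra_simps)
  then show ?thesis
    by (simp add: form2_Rpre)
qed

lemma Kop_adjoint: "form2 d \<phi> (Kop (\<lambda>a b. M b a) \<psi>) = form2 d (Kop M \<phi>) \<psi>"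
  by (simp add: form2_def form_def Kop_def sum.distrib algebra_simps)

lemma Ead_adjoint: "form (Suc d) f (Ead d \<phi>) = cc (q ^ Suc d) * form2 d (Em (Suc d) f) \<phi>"
proof -
  have "form (Suc d) f (Ead d \<phi>)
    = (\<Sum>m\<le>Suc d. wt (Suc d) m * cc (q ^ (Suc d - m)) * (f m * \<phi> False m))
      + (\<Sum>m\<le>Suc d. wt (Suc d) m * cc (q ^ m) * (f m * \<phi> True (m - 1)))"
    by (simp add: form_def Ead_def sum.distrib algebra_simps)
  also have "(\<Sum>m\<le>Suc d. wt (Suc d) m * cc (q ^ (Suc d - m)) * (f m * \<phi> False m))
      = (\<Sum>m\<le>d. cc (q ^ Suc d) * wt d m * (f m * \<phi> False m))"
    by (simp add: wt_lower del: power_Suc)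
  also have "(\<Sum>m\<le>Suc d. wt (Suc d) m * cc (q ^ m) * (f m * \<phi> True (m - 1)))
      = (\<Sum>m\<le>d. cc (q ^ Suc d) * wt d m * (f (Suc m) * \<phi> True m))"
    by (simp add: sum.atMost_Suc_shift wt_lower' del: power_Suc sum.atMost_Suc)
  finally show ?thesis
    by (simp add: form2_def form_def Em_def sum_distrib_left distrib_left mult.assoc)
qed

lemma Ead_surj: "\<exists>\<phi>. \<forall>m\<le>Suc d. Ead d \<phi> m = g m"
proof -
  define \<phi> where "\<phi> = (\<lambda>a m. if a then (if m = d then g (Suc d) / cc (q ^ Suc d) else 0) else g m / cc (q ^ (Suc d - m)))"
  have "Ead d \<phi> m = g m" if m: "m \<le> Suc d" for m
  proof (cases "m = Suc d")
    case True
    then show ?thesis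
      using qn[of "Suc d"] by (simp add: Ead_def \<phi>_def del: power_Suc)
  next
    case False
    with m have "cc (q ^ (Suc d - m)) \<noteq> 0"
      by (intro qn) simp
    moreover have "m - 1 = d \<Longrightarrow> m = 0"
      using m False by (cases m) auto
    ultimately show ?thesis
      using False by (cases "m = 0") (auto simp: Ead_def \<phi>_def)
  qed
  then show ?thesis by blast
qed

text \<open>The degeneration point of R, where it factors through the fused space.\<close>

lemma Lop_q: "Lop d q \<phi> = Em (Suc d) (Ead d \<phi>)"
proof (intro ext)
  fix a m
  have "m \<le> d \<Longrightarrow> q * q ^ (d - m) = q ^ (Suc d - m)"
    by (simp add: Suc_diff_le)
  then show "Lop d q \<phi> a m = Em (Suc d) (Ead d \<phi>) a m"
    by (auto simp: Lop_def Em_def Ead_def)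
qed

lemma Rpre_q: "Rpre d q \<noteq> 0"
proof -
  have "cc (q * q ^ i) \<noteq> 0" for i
    using qn[of "Suc i"] by simp
  then show ?thesis
    using q2 by (simp add: Rpre_def)
qed

lemma form_cong: "(\<And>m. m \<le> d \<Longrightarrow> f m = f' m) \<Longrightarrow> (\<And>m. m \<le> d \<Longrightarrow> g m = g' m) \<Longrightarrow> form d f g = form d f' g'"
  by (simp add: form_def)

text \<open>Taking adjoints reverses the order of factors, so the adjoint of the recursion has the
  shape of \<open>hr\<close>, which \<open>hr_Em\<close> identifies with \<open>cop\<close> again.
  That \<open>Ead\<close> intertwines the reversed product with \<open>cop\<close> comes from the
  fused reflection equation at the value of \<open>Y\<close> where R is \<open>Em\<close> after
  \<open>Ead\<close>.\<close>

lemma cop_adjoint: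
  "x \<in> G \<Longrightarrow> form d f (cop (\<lambda>x a b. K x b a) d x g) = form d (cop K d x f) g"
proof (induction d arbitrary: f g)
  case 0
  show ?case
    unfolding form_def cop.simps(1) by simp
next
  case (Suc d)
  let ?v = "x * q ^ d" and ?Kt = "\<lambda>x a b. K x b a"
  note x = Suc.prems
  obtain \<phi> where \<phi>: "\<And>m. m \<le> Suc d \<Longrightarrow> Ead d \<phi> m = g m"
    using Ead_surj by blast
  define \<Psi> where "\<Psi> = Kop (?Kt ?v) (Rop d (?v * x) (\<lambda>a. cop ?Kt d x (\<phi> a)))"
  have v: "?v * x = x\<^sup>2 * q ^ d"
    by (simp add: power2_eq_square)
  have R: "Rop d q \<xi> = (\<lambda>a m. Rpre d q * Em (Suc d) (Ead d \<xi>) a m)" for \<xi>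
    by (simp add: Rop_def Lop_q fun_eq_iff)
  \<comment> \<open>The parameter v = x q^d is chosen so that Y x q^d = v q holds with Y =
    q.\<close>
  have "Rop d q \<Psi> = (\<lambda>a. cop ?Kt d x (Rop d (?v * x) (Kop (?Kt ?v) (Rop d q \<phi>)) a))"
    unfolding \<Psi>_def using q2 by (intro tr.fused_RE Gpow x) simp_all
  also have "\<dots> = tr.hr d x (Rop d q \<phi>)"
    by (simp add: tr.hr_def v)
  also have "\<dots> = tr.hr d x (Em (Suc d) (\<lambda>m. Rpre d q * Ead d \<phi> m))"
    by (rule arg_cong[of _ _ "tr.hr d x"]) (auto simp: R Em_def fun_eq_iff)
  also have "\<dots> = Em (Suc d) (cop ?Kt (Suc d) x (\<lambda>m. Rpre d q * Ead d \<phi> m))"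
    by (rule tr.hr_Em[OF x])
  also have "cop ?Kt (Suc d) x (\<lambda>m. Rpre d q * Ead d \<phi> m) = (\<lambda>m. Rpre d q * cop ?Kt (Suc d) x (Ead d \<phi>) m)"
    using rlin_scale[OF cop_rlin, where k = "Rpre d q" and f = "Ead d \<phi>"] by (simp only: id_apply)
  finally have e: "Rpre d q * Em (Suc d) (Ead d \<Psi>) a m = Rpre d q * Em (Suc d) (cop ?Kt (Suc d) x (Ead d \<phi>)) a m" for a m
    unfolding R by (auto simp: fun_eq_iff Em_def)
  have E: "Ead d \<Psi> m = cop ?Kt (Suc d) x (Ead d \<phi>) m" if "m \<le> Suc d" for m
    using e[of "0 < m" "m - 1"] that Rpre_q by (cases m) (simp_all add: Em_def)
  have adj: "form2 d \<xi> (\<lambda>a. cop ?Kt d x (\<chi> a)) = form2 d (\<lambda>a. cop K d x (\<xi> a)) \<chi>" for \<xi> \<chi>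
    unfolding form2_def Suc.IH[OF x] ..
  have "form (Suc d) f (cop ?Kt (Suc d) x g) = form (Suc d) f (Ead d \<Psi>)"
    using \<phi> by (intro form_cong refl) (simp add: E cop_cong[of "Suc d" "Ead d \<phi>" g])
  also have "\<dots> = cc (q ^ Suc d) * form2 d (hr d x (Em (Suc d) f)) \<phi>"
    by (simp only: Ead_adjoint \<Psi>_def Kop_adjoint Rop_adjoint adj hr_def v)
  also have "\<dots> = form (Suc d) (cop K (Suc d) x f) (Ead d \<phi>)"
    unfolding hr_Em[OF x] Ead_adjoint ..
  also have "\<dots> = form (Suc d) (cop K (Suc d) x f) g"
    using \<phi> by (intro form_cong refl)
  finally show ?case .
qed

end

section \<open>Traces and crossing symmetry\<close>

context qscalars begin

definition dl :: "nat \<Rightarrow> nat \<Rightarrow> 'b" where "dl m n = of_bool (n = m)"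

definition inj2 :: "bool \<Rightarrow> (nat \<Rightarrow> 'b) \<Rightarrow> bool \<Rightarrow> nat \<Rightarrow> 'b" where
  "inj2 a \<psi> a' m = (if a' = a then \<psi> m else 0)"

definition trace2 where
  "trace2 e O' = (\<Sum>m\<le>e. O' (inj2 False (dl m)) False m + O' (inj2 True (dl m)) True m)"

text \<open>Over a noncommutative ring a trace may depend on the basis, but here the change of basis
  has integer entries. The vectors at (False, m+1) and (True, m) add up to \<open>Em\<close> of a
  basis vector, and the second represents minus the basis vector m of the quotient; comparing
  entries gives the sum of the two diagonal entries.\<close>

lemma trace_split:
  assumes add: "\<And>\<phi> \<psi>. O' (\<lambda>a m. \<phi> a m + \<psi> a m) = (\<lambda>a m. O' \<phi> a m + O' \<psi> a m)"
    and sub: "\<And>\<psi>. O' (Em (Suc e) \<psi>) = Em (Suc e) (A \<psi>)"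
    and quot: "\<And>\<phi>. pim e (O' \<phi>) = B (pim e \<phi>)" and B: "rlin B"
  shows "trace2 e O' = (\<Sum>m\<le>Suc e. A (dl m) m) + (\<Sum>m<e. B (dl m) m)"
proof -
  have "Em (Suc e) (dl 0) = inj2 False (dl 0)"
    by (auto simp: Em_def dl_def inj2_def fun_eq_iff)
  then have first: "O' (inj2 False (dl 0)) False 0 = A (dl 0) 0"
    using sub[of "dl 0"] by (simp add: Em_def)
  have "Em (Suc e) (dl (Suc e)) = inj2 True (dl e)"
    by (auto simp: Em_def dl_def inj2_def fun_eq_iff)
  then have last: "O' (inj2 True (dl e)) True e = A (dl (Suc e)) (Suc e)"
    using sub[of "dl (Suc e)"] by (simp add: Em_def)
  have mid: "O' (inj2 False (dl (Suc m))) False (Suc m) + O' (inj2 True (dl m)) True m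
    = A (dl (Suc m)) (Suc m) + B (dl m) m" if m: "m < e" for m
  proof -
    have "Em (Suc e) (dl (Suc m)) = (\<lambda>a n. inj2 False (dl (Suc m)) a n + inj2 True (dl m) a n)"
      using m by (auto simp: Em_def dl_def inj2_def fun_eq_iff)
    then have "O' (inj2 False (dl (Suc m))) False (Suc m) + O' (inj2 True (dl m)) False (Suc m) = A (dl (Suc m)) (Suc m)"
    proof -
      assume e: "Em (Suc e) (dl (Suc m)) = (\<lambda>a n. inj2 False (dl (Suc m)) a n + inj2 True (dl m) a n)"
      have "O' (inj2 False (dl (Suc m))) False (Suc m) + O' (inj2 True (dl m)) False (Suc m) = O' (Em (Suc e) (dl (Suc m))) False (Suc m)"
        unfolding e add ..
      then show ?thesis
        unfolding sub using m by (simp add: Em_def)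
    qed
    moreover have "pim e (inj2 True (dl m)) = (\<lambda>n. - dl m n)"
      using m by (auto simp: pim_def dl_def inj2_def fun_eq_iff)
    then have "O' (inj2 True (dl m)) False (Suc m) - O' (inj2 True (dl m)) True m = - B (dl m) m"
    proof -
      assume e: "pim e (inj2 True (dl m)) = (\<lambda>n. - dl m n)"
      have "pim e (O' (inj2 True (dl m))) m = - B (dl m) m"
        unfolding quot e rlin_minus[OF B] ..
      then show ?thesis
        using m by (simp add: pim_def)
    qed
    then have r: "O' (inj2 True (dl m)) True m = O' (inj2 True (dl m)) False (Suc m) + B (dl m) m"
      by (simp add: algebra_simps)
    ultimately show ?thesis
      unfolding r add.assoc[symmetric] by simp
  qed
  have "trace2 e O' = (\<Sum>m\<le>e. O' (inj2 False (dl m)) False m) + (\<Sum>m\<le>e. O' (inj2 True (dl m)) True m)"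
    by (simp add: trace2_def sum.distrib)
  also have "(\<Sum>m\<le>e. O' (inj2 False (dl m)) False m) = A (dl 0) 0 + (\<Sum>m<e. O' (inj2 False (dl (Suc m))) False (Suc m))"
    unfolding sum.atMost_shift first ..
  also have "(\<Sum>m\<le>e. O' (inj2 True (dl m)) True m) = (\<Sum>m<e. O' (inj2 True (dl m)) True m) + A (dl (Suc e)) (Suc e)"
    unfolding lessThan_Suc_atMost[symmetric] sum.lessThan_Suc last ..
  also have "A (dl 0) 0 + (\<Sum>m<e. O' (inj2 False (dl (Suc m))) False (Suc m)) + ((\<Sum>m<e. O' (inj2 True (dl m)) True m) + A (dl (Suc e)) (Suc e))
    = A (dl 0) 0 + (\<Sum>m<e. O' (inj2 False (dl (Suc m))) False (Suc m) + O' (inj2 True (dl m)) True m) + A (dl (Suc e)) (Suc e)"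
    by (simp only: sum.distrib ac_simps)
  also have "(\<Sum>m<e. O' (inj2 False (dl (Suc m))) False (Suc m) + O' (inj2 True (dl m)) True m)
    = (\<Sum>m<e. A (dl (Suc m)) (Suc m)) + (\<Sum>m<e. B (dl m) m)"
    unfolding sum.distrib[symmetric] by (rule sum.cong) (simp_all add: mid)
  also have "A (dl 0) 0 + ((\<Sum>m<e. A (dl (Suc m)) (Suc m)) + (\<Sum>m<e. B (dl m) m)) + A (dl (Suc e)) (Suc e)
    = (\<Sum>m\<le>Suc e. A (dl m) m) + (\<Sum>m<e. B (dl m) m)"
    unfolding sum.atMost_Suc sum.atMost_shift[of _ e] by (simp only: ac_simps)
  finally show ?thesis .
qed

text \<open>Crossing unitarity: transposed in the C^2 factor, the R-matrices at u and at u^-1 q^-2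
  are inverse up to a scalar. For y = u q^((1-d)/2) this pairing of parameters is y y' q^(d+1) =
  1.\<close>

lemma L_crossing:
  assumes y0: "y \<noteq> 0" and y': "y' = inverse (y * q ^ Suc d)"
  shows "(\<Sum>a\<in>UNIV. Lop d y' (inj2 b (Lop d y (inj2 a \<psi>) c)) a m) = \<iota> (cc y * cc y') * (if b = c \<and> m \<le> d then \<psi> m else 0)"
proof (rule functional_ext)
  fix f :: "'b \<Rightarrow> 'k"
  assume f: "\<And>x y. f (x + y) = f x + f y" "\<And>x y. f (x - y) = f x - f y" "\<And>x. f (- x) = - f x"
    "f 0 = 0" "\<And>k x. f (\<iota> k * x) = k * f x"
  define ya where "ya = inverse y"
  have yr: "y * ya = 1" "\<And>w. y * (ya * w) = w" "inverse ya = y"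
    using y0 by (simp_all add: ya_def)
  define qa where "qa = inverse q"
  have qr: "q * qa = 1" "\<And>w. q * (qa * w) = w" "inverse qa = q"
    using q0 by (simp_all add: qa_def)
  show "f (\<Sum>a\<in>UNIV. Lop d y' (inj2 b (Lop d y (inj2 a \<psi>) c)) a m) = f (\<iota> (cc y * cc y') * (if b = c \<and> m \<le> d then \<psi> m else 0))"
  proof (cases "m \<le> d")
    case True
    then obtain n where d: "d = m + n"
      using le_iff_add by blast
    show ?thesis
    proof (cases m)
      case m: 0
      show ?thesis
      proof (cases n)
        case n: 0
        show ?thesis
          by (cases b; cases c)
            (simp_all add: UNIV_bool Lop_def inj2_def f d m n y' cc_def power_add qa_def[symmetric] ya_def[symmetric] qr yr;
             simp add: algebra_simps qr yr)+
      next
        case n: (Suc k)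
        define N where "N = q ^ k"
        define Na where "Na = inverse N"
        have Nr: "N * Na = 1" "\<And>w. N * (Na * w) = w" "inverse Na = N"
          using q0 by (simp_all add: N_def Na_def)
        show ?thesis
          by (cases b; cases c)
            (simp_all add: UNIV_bool Lop_def inj2_def f d m n y' cc_def power_add N_def[symmetric] Na_def[symmetric] qa_def[symmetric] ya_def[symmetric] Nr qr yr;
             simp add: algebra_simps Nr qr yr)+
      qed
    next
      case m: (Suc l)
      define M where "M = q ^ l"
      define Ma where "Ma = inverse M"
      have Mr: "M * Ma = 1" "\<And>w. M * (Ma * w) = w" "inverse Ma = M"
        using q0 by (simp_all add: M_def Ma_def)
      show ?thesis
      proof (cases n)
        case n: 0
        show ?thesis
          by (cases b; cases c)
            (simp_all add: UNIV_bool Lop_def inj2_def f d m n y' cc_def power_add M_def[symmetric] Ma_def[symmetric] qa_def[symmetric] ya_def[symmetric] Mr qr yr;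
             simp add: algebra_simps Mr qr yr)+
      next
        case n: (Suc k)
        define N where "N = q ^ k"
        define Na where "Na = inverse N"
        have Nr: "N * Na = 1" "\<And>w. N * (Na * w) = w" "inverse Na = N"
          using q0 by (simp_all add: N_def Na_def)
        show ?thesis
          by (cases b; cases c)
            (simp_all add: UNIV_bool Lop_def inj2_def f d m n y' cc_def power_add M_def[symmetric] Ma_def[symmetric] N_def[symmetric] Na_def[symmetric] qa_def[symmetric] ya_def[symmetric] Mr Nr qr yr;
             simp add: algebra_simps Mr Nr qr yr)+
      qed
    qed
  qed (simp add: Lop_def f UNIV_bool)
qed

end

context qscalars begin

lemma crossing:
  assumes y0: "y \<noteq> 0" and y': "y' = inverse (y * q ^ Suc d)"
  shows "Rop d y' (inj2 b (Rop d y (inj2 False \<psi>) c)) False m + Rop d y' (inj2 b (Rop d y (inj2 True \<psi>) c)) True m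
    = \<iota> (Rpre d y * Rpre d y' * (cc y * cc y')) * (if b = c \<and> m \<le> d then \<psi> m else 0)"
proof -
  have inj: "inj2 b (\<lambda>n. \<iota> k * \<chi> n) = (\<lambda>a n. \<iota> k * inj2 b \<chi> a n)" for k \<chi>
    by (auto simp: inj2_def fun_eq_iff)
  have "Rop d y \<phi> c = (\<lambda>n. \<iota> (Rpre d y) * Lop d y \<phi> c n)" for \<phi>
    by (simp add: Rop_def fun_eq_iff)
  then have "Rop d y' (inj2 b (Rop d y (inj2 a \<psi>) c)) a m
    = \<iota> (Rpre d y * Rpre d y') * Lop d y' (inj2 b (Lop d y (inj2 a \<psi>) c)) a m" for a
    by (simp add: inj Rop_scale) (simp add: Rop_def i_mult mult.assoc)
  then show ?thesis
    using L_crossing[OF assms, of b \<psi> c m]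
    by (simp add: UNIV_bool distrib_left[symmetric] i_mult mult.assoc add.commute)
qed

lemma cop_left:
  assumes "\<And>x a b c. K x a b * c = c * K x a b"
  shows "cop K d x (\<lambda>m. c * \<psi> m) = (\<lambda>m. c * cop K d x \<psi> m)"
proof (induction d arbitrary: x \<psi>)
  case (Suc d)
  have K: "K x a b * (c * z) = c * (K x a b * z)" for x a b z
    by (metis assms mult.assoc)
  have Em: "Em (Suc d) (\<lambda>m. c * \<psi> m) = (\<lambda>a m. c * Em (Suc d) \<psi> a m)"
    by (auto simp: Em_def fun_eq_iff)
  have Lop: "Rop d y (\<lambda>a m. c * \<phi> a m) = (\<lambda>a m. c * Rop d y \<phi> a m)" for y \<phi>
    by (auto simp: Rop_def Lop_def fun_eq_iff algebra_simps i_left_comm[of c])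
  show ?case
    by (auto simp: cop.simps(2) Em dress_def Suc Lop Kop_def K distrib_left fun_eq_iff)
qed auto

end

section \<open>Fusion relation for traces of an operator family against a central family\<close>

locale fusion_pair = fusion \<iota> q K G + nu: fusion \<iota> q N G'
  for \<iota> :: "'k::field \<Rightarrow> 'b::ring_1" and q K G N G' +
  assumes inv_G: "x \<in> G \<Longrightarrow> inverse x \<in> G'"
    and N_central: "N x a b * c = c * N x a b"
begin

text \<open>The dual matrix is evaluated at u^-1 q^-1, whose shifted form is u^-1 q^-1 q^((1-d)/2);
  with x = u q^((1-d)/2) this is the inverse of x q^d.\<close>

definition tau :: "nat \<Rightarrow> 'k \<Rightarrow> 'b" where
  "tau d x = (\<Sum>m\<le>d. cop N d (inverse (x * q ^ d)) (cop K d x (dl m)) m)"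

lemma tau_0: "tau 0 x = 1"
  by (simp add: tau_def dl_def)

lemma cop_1: "x \<in> G \<Longrightarrow> cop K 1 x \<psi> m = (if m \<le> 1 then K x (0 < m) False * \<psi> 0 + K x (0 < m) True * \<psi> 1 else 0)"
  using Gcc[of x 1] by (auto simp: cop.simps(2) dress_def Kop_def Rop_0 Em_def)

lemma nu_cop_1: "x \<in> G' \<Longrightarrow> cop N 1 x \<psi> m = (if m \<le> 1 then N x (0 < m) False * \<psi> 0 + N x (0 < m) True * \<psi> 1 else 0)"
  using nu.Gcc[of x 1] by (auto simp: cop.simps(2) dress_def Kop_def Rop_0 Em_def)

lemma tau_1: "x \<in> G \<Longrightarrow> tau 1 x = (\<Sum>a\<in>UNIV. \<Sum>b\<in>UNIV. N (inverse (x * q)) a b * K x b a)"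
proof -
  assume x: "x \<in> G"
  show ?thesis
    using x inv_G[OF Gq[OF x]] nu_cop_1[of "inverse (x * q)"] cop_1[of x]
    by (simp add: tau_def dl_def UNIV_bool)
qed

lemma Rop_left: "Rop d y (\<lambda>a m. c * \<phi> a m) = (\<lambda>a m. c * Rop d y \<phi> a m)"
  by (auto simp: Rop_def Lop_def fun_eq_iff algebra_simps i_left_comm[of c])

lemma Rop_inj2: "Rop d y \<phi> a m = Rop d y (inj2 False (\<phi> False)) a m + Rop d y (inj2 True (\<phi> True)) a m"
proof -
  have "\<phi> = (\<lambda>a m. inj2 False (\<phi> False) a m + inj2 True (\<phi> True) a m)"
  proof (intro ext)
    show "\<phi> a m = inj2 False (\<phi> False) a m + inj2 True (\<phi> True) a m" for a m
      by (cases a) (simp_all add: inj2_def)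
  qed
  then have "Rop d y \<phi> = Rop d y (\<lambda>a m. inj2 False (\<phi> False) a m + inj2 True (\<phi> True) a m)"
    by (rule arg_cong)
  then show ?thesis
    by (simp only: Rop_add)
qed

lemma Rop_Kop:
  "Rop d y (Kop M \<phi>) a m
    = M False False * Rop d y (inj2 False (\<phi> False)) a m + M False True * Rop d y (inj2 False (\<phi> True)) a m
      + (M True False * Rop d y (inj2 True (\<phi> False)) a m + M True True * Rop d y (inj2 True (\<phi> True)) a m)"
proof -
  have "inj2 b (Kop M \<phi> b) = (\<lambda>a m. M b False * inj2 b (\<phi> False) a m + M b True * inj2 b (\<phi> True) a m)" for b
    by (auto simp: inj2_def Kop_def fun_eq_iff)
  then show ?thesis
    by (subst Rop_inj2) (simp add: Rop_add Rop_left)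
qed

lemma nu_cop_left: "cop N d x (\<lambda>m. c * \<psi> m) = (\<lambda>m. c * cop N d x \<psi> m)"
  by (rule cop_left) (rule N_central)

definition central :: "'b \<Rightarrow> bool" where
  "central w \<longleftrightarrow> (\<forall>b. w * b = b * w)"

lemma central_intros: "central 0" "central 1" "central (\<iota> k)" "central (N x a b)"
  "central v \<Longrightarrow> central w \<Longrightarrow> central (v + w)" "central v \<Longrightarrow> central w \<Longrightarrow> central (v * w)"
  "central w \<Longrightarrow> central (- w)" "central v \<Longrightarrow> central w \<Longrightarrow> central (v - w)"
proof -
  show "central v \<Longrightarrow> central w \<Longrightarrow> central (v * w)"
    unfolding central_def by (metis mult.assoc)
qed (simp_all add: central_def i_central[symmetric] N_central[symmetric] algebra_simps)

lemma nu_gam_central: "nu.gam x * b = b * nu.gam x"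
proof -
  have "central (nu.gam x)"
    unfolding nu.gam_def K_defs R12_def asym_def by (simp add: central_intros)
  then show ?thesis
    by (simp add: central_def)
qed

definition quot_scalar :: "nat \<Rightarrow> 'k \<Rightarrow> 'b" where
  "quot_scalar d x = \<iota> (Rdet d ((inverse (x * q ^ Suc (Suc d)))\<^sup>2 * q ^ d) * Rdet d (x\<^sup>2 * q * q))
     * nu.gam (inverse (x * q ^ Suc (Suc d)) * q ^ d)"

definition fuse_scalar :: "nat \<Rightarrow> 'k \<Rightarrow> 'k" where
  "fuse_scalar e x = (let y = x\<^sup>2 * q; y' = inverse (y * q ^ Suc e) in Rpre e y * Rpre e y' * (cc y * cc y'))"

text \<open>One trace is computed in two ways. The central family is taken in the mirrored form
  \<open>hr\<close>, so that in \<Omega> the two R-matrices enclose the C^2 factor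
  \<open>N K\<close>; tracing over C^2, crossing contracts them to a scalar and the product of two
  traces appears. Splitting instead along the fused subspace and its quotient gives the two traces
  on the right.\<close>

lemma TT:
  assumes x: "x \<in> G"
  shows "\<iota> (fuse_scalar (Suc d) x) * (tau 1 x * tau (Suc d) (x * q))
    = tau (Suc (Suc d)) x + quot_scalar d x * gam x * tau d (x * q * q)"
proof -
  define e where "e = Suc d"
  define x' where "x' = inverse (x * q ^ Suc e)"
  define y where "y = x\<^sup>2 * q"
  define y' where "y' = x'\<^sup>2 * q ^ e"
  define z where "z = inverse (x * q)"
  define \<Omega> where "\<Omega> = (\<lambda>\<phi>. nu.hr e x' (dr e x \<phi>))"
  have x0: "x \<noteq> 0"
    by (rule G0[OF x])
  have x': "x' \<in> G'"
    unfolding x'_def by (intro inv_G Gpow x)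
  have y'_eq: "y' = inverse (y * q ^ Suc e)" and y0: "y \<noteq> 0"
    using x0 q0 by (simp_all add: y'_def y_def x'_def power2_eq_square field_simps)
  have z: "x' * q ^ e = z"
    using x0 q0 by (simp add: x'_def z_def field_simps)
  have hr: "nu.hr e x' \<phi> a = cop N e x' (Rop e y' (Kop (N z) \<phi>) a)" for \<phi> a
    by (simp add: nu.hr_def y'_def z)

  have \<Omega>_add: "\<Omega> (\<lambda>a m. \<phi> a m + \<psi> a m) = (\<lambda>a m. \<Omega> \<phi> a m + \<Omega> \<psi> a m)" for \<phi> \<psi>
  proof -
    have K: "Kop (N z) (\<lambda>a m. f a m + g a m) = (\<lambda>a m. Kop (N z) f a m + Kop (N z) g a m)" for f g :: "bool \<Rightarrow> nat \<Rightarrow> 'b"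
      by (simp add: Kop_def fun_eq_iff algebra_simps)
    show ?thesis
      unfolding \<Omega>_def dr_def dress_add[OF cop_rlin] hr fun_eq_iff K Rop_add rlin_add[OF cop_rlin] by simp
  qed
  define r where "r = Rdet d (x\<^sup>2 * q * q)"
  define r' where "r' = Rdet d (x'\<^sup>2 * q ^ d)"
  define g where "g = nu.gam (x' * q ^ d)"
  define A where "A = (\<lambda>\<psi>. cop N (Suc e) x' (cop K (Suc e) x \<psi>))"
  define B where "B = (\<lambda>\<psi> m. \<iota> r' * (g * (\<iota> r * (gam x * cop N d x' (cop K d (x * q * q) \<psi>) m))))"
  have sub: "\<Omega> (Em (Suc e) \<psi>) = Em (Suc e) (A \<psi>)" for \<psi>
    by (simp add: \<Omega>_def A_def dr_Em[OF x] nu.hr_Em[OF x'])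
  have quot: "pim e (\<Omega> \<phi>) = B (pim e \<phi>)" for \<phi>
    unfolding \<Omega>_def e_def nu.pim_hr[OF x' nu_gam_central] pim_dr[OF x x] nu_cop_left B_def r_def r'_def g_def ..
  have B: "rlin B"
    by (simp add: rlin_def B_def rlin_add[OF cop_rlin] rlin_right[OF cop_rlin] algebra_simps fun_eq_iff)
  have "trace2 e \<Omega> = (\<Sum>m\<le>Suc e. A (dl m) m) + (\<Sum>m<e. B (dl m) m)"
    by (rule trace_split[OF \<Omega>_add sub quot B])
  also have "(\<Sum>m\<le>Suc e. A (dl m) m) = tau (Suc e) x"
    by (simp add: tau_def A_def x'_def)
  also have "(\<Sum>m<e. B (dl m) m) = \<iota> r' * (g * (\<iota> r * (gam x * tau d (x * q * q))))"
  proof -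
    have "inverse (x * q * q * q ^ d) = x'"
      by (simp add: x'_def e_def mult_ac)
    then show ?thesis
      by (simp add: tau_def B_def e_def lessThan_Suc_atMost sum_distrib_left)
  qed
  also have "\<iota> r' * (g * (\<iota> r * (gam x * tau d (x * q * q)))) = quot_scalar d x * gam x * tau d (x * q * q)"
    unfolding quot_scalar_def r_def r'_def g_def x'_def e_def
    by (simp only: i_mult mult.assoc i_left_comm[of "nu.gam _"])
  finally have 1: "trace2 e \<Omega> = tau (Suc e) x + quot_scalar d x * gam x * tau d (x * q * q)" .

  define \<kappa> where "\<kappa> = Rpre e y * Rpre e y' * (cc y * cc y')"
  define M where "M = (\<lambda>b c. N z b False * K x False c + N z b True * K x True c)"
  have KK: "Kop (N z) (Kop (K x) \<phi>) = Kop M \<phi>" for \<phi> :: "bool \<Rightarrow> nat \<Rightarrow> 'b"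
    by (simp add: Kop_def M_def fun_eq_iff algebra_simps)
  \<comment> \<open>The trace over C^2 at a fixed spin index. Entries of the product
    \<open>N K\<close> are moved out to the left, past R, which is scalar, and past
    \<open>cop N\<close>, which is built from central elements; what is left for fixed indices b, c
    is the crossing sum.\<close>
  have diag: "\<Omega> (inj2 False (dl m)) False m + \<Omega> (inj2 True (dl m)) True m
    = \<iota> \<kappa> * ((M False False + M True True) * cop N e x' (cop K e (x * q) (dl m)) m)" for m
  proof -
    define \<chi> where "\<chi> = cop K e (x * q) (dl m)"
    define Z where "Z = (\<lambda>a b c. Rop e y' (inj2 b (Rop e y (inj2 a \<chi>) c)) a)"
    have "inj2 a (dl m) a = dl m" "inj2 a (dl m) (\<not> a) = (\<lambda>n. 0)" for a
      by (simp_all add: inj2_def fun_eq_iff)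
    then have "cop K e (x * q) (inj2 a (dl m) a') n = inj2 a \<chi> a' n" for a a' n
      by (cases "a' = a") (simp_all add: \<chi>_def inj2_def rlin_zero[OF cop_rlin])
    then have "(\<lambda>a'. cop K e (x * q) (inj2 a (dl m) a')) = inj2 a \<chi>" for a
      by blast
    then have \<Omega>: "\<Omega> (inj2 a (dl m)) a = cop N e x' (\<lambda>n. M False False * Z a False False n + M False True * Z a False True n
       + (M True False * Z a True False n + M True True * Z a True True n))" for a
      unfolding \<Omega>_def hr dr_def dress_def KK y_def[symmetric] Z_def Rop_Kop by simp
    have Z: "Z False b c n + Z True b c n = \<iota> \<kappa> * (if b = c \<and> n \<le> e then \<chi> n else 0)" for b c n
      unfolding Z_def \<kappa>_def by (rule crossing[OF y0 y'_eq])
    have ZZ: "cop N e x' (\<lambda>n. M b c * Z False b c n) m + cop N e x' (\<lambda>n. M b c * Z True b c n) m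
      = (if b = c then \<iota> \<kappa> * (M b c * cop N e x' \<chi> m) else 0)" for b c
    proof -
      have "cop N e x' (\<lambda>n. M b c * Z False b c n) m + cop N e x' (\<lambda>n. M b c * Z True b c n) m
        = M b c * cop N e x' (\<lambda>n. Z False b c n + Z True b c n) m"
        unfolding nu_cop_left rlin_add[OF cop_rlin] by (simp add: distrib_left)
      also have "cop N e x' (\<lambda>n. Z False b c n + Z True b c n) = cop N e x' (\<lambda>n. \<iota> \<kappa> * (if b = c then \<chi> n else 0))"
        unfolding Z by (rule cop_cong) simp
      also have "M b c * \<dots> m = (if b = c then \<iota> \<kappa> * (M b c * cop N e x' \<chi> m) else 0)"
        unfolding rlin_scale[OF cop_rlin] by (auto simp: rlin_zero[OF cop_rlin] i_left_comm[of "M c c"])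
      finally show ?thesis .
    qed
    have "\<Omega> (inj2 False (dl m)) False m + \<Omega> (inj2 True (dl m)) True m
      = (cop N e x' (\<lambda>n. M False False * Z False False False n) m + cop N e x' (\<lambda>n. M False False * Z True False False n) m)
      + (cop N e x' (\<lambda>n. M False True * Z False False True n) m + cop N e x' (\<lambda>n. M False True * Z True False True n) m)
      + (cop N e x' (\<lambda>n. M True False * Z False True False n) m + cop N e x' (\<lambda>n. M True False * Z True True False n) m)
      + (cop N e x' (\<lambda>n. M True True * Z False True True n) m + cop N e x' (\<lambda>n. M True True * Z True True True n) m)"
      unfolding \<Omega> rlin_add[OF cop_rlin] by (simp only: ac_simps)
    then show ?thesis
      unfolding ZZ by (simp add: \<chi>_def algebra_simps)
  qed
  have "trace2 e \<Omega> = \<iota> \<kappa> * ((M False False + M True True) * (\<Sum>m\<le>e. cop N e x' (cop K e (x * q) (dl m)) m))"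
    by (simp add: trace2_def diag sum_distrib_left)
  also have "M False False + M True True = tau 1 x"
    unfolding tau_1[OF x] M_def z_def UNIV_bool by (simp add: add_ac)
  also have "(\<Sum>m\<le>e. cop N e x' (cop K e (x * q) (dl m)) m) = tau e (x * q)"
    by (simp add: tau_def x'_def mult.assoc)
  also have "\<kappa> = fuse_scalar e x"
    by (simp add: fuse_scalar_def \<kappa>_def y_def[symmetric] y'_eq Let_def)
  finally show ?thesis
    using 1 by (simp add: e_def)
qed

end

section \<open>The reflection equation from the defining relations\<close>

text \<open>\<open>w0\<close>, \<open>w1\<close> are the modes W_0, W_1, and the other letters are
  generating series at two points, the second one primed. The G-series carry the factor 1/(k_+ k_-
  (q + 1/q)), which turns the constants of the relations into \<kappa> = k_+ k_- and s = q + 1/q;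
  \<open>u\<close> and \<open>v\<close> stand for (q + 1/q) U at the two points.\<close>

locale two_point = scalars \<iota> for \<iota> :: "'k::field \<Rightarrow> 'b::ring_1" +
  fixes q qi s \<kappa> u v :: 'k and w0 w1 Wp Wm Gp Gm Wp' Wm' Gp' Gm' :: 'b
  assumes qqi: "q * qi = 1" and s0: "s \<noteq> 0"
    and a1: "w0 * Wm = Wm * w0 + \<iota> \<kappa> * (Gm - Gp)" "w0 * Wm' = Wm' * w0 + \<iota> \<kappa> * (Gm' - Gp')"
    and b1: "w1 * Wp = Wp * w1 - \<iota> \<kappa> * (Gm - Gp)" "w1 * Wp' = Wp' * w1 - \<iota> \<kappa> * (Gm' - Gp')"
    and a2: "\<iota> q * (w0 * Gp) - \<iota> qi * (Gp * w0) = \<iota> u * Wp - \<iota> s * Wm - \<iota> s * w0"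
      "\<iota> q * (w0 * Gp') - \<iota> qi * (Gp' * w0) = \<iota> v * Wp' - \<iota> s * Wm' - \<iota> s * w0"
    and a3: "\<iota> q * (Gm * w0) - \<iota> qi * (w0 * Gm) = \<iota> u * Wp - \<iota> s * Wm - \<iota> s * w0"
      "\<iota> q * (Gm' * w0) - \<iota> qi * (w0 * Gm') = \<iota> v * Wp' - \<iota> s * Wm' - \<iota> s * w0"
    and b2: "\<iota> q * (Gp * w1) - \<iota> qi * (w1 * Gp) = \<iota> u * Wm - \<iota> s * Wp - \<iota> s * w1"
      "\<iota> q * (Gp' * w1) - \<iota> qi * (w1 * Gp') = \<iota> v * Wm' - \<iota> s * Wp' - \<iota> s * w1"
    and b3: "\<iota> q * (w1 * Gm) - \<iota> qi * (Gm * w1) = \<iota> u * Wm - \<iota> s * Wp - \<iota> s * w1"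
      "\<iota> q * (w1 * Gm') - \<iota> qi * (Gm' * w1) = \<iota> v * Wm' - \<iota> s * Wp' - \<iota> s * w1"
    and c0: "w0 * Wp = Wp * w0" "w0 * Wp' = Wp' * w0" and c1: "w1 * Wm = Wm * w1" "w1 * Wm' = Wm' * w1"
    and cc: "Wp' * Wp = Wp * Wp'" "Wm' * Wm = Wm * Wm'" "Gp' * Gp = Gp * Gp'" "Gm' * Gm = Gm * Gm'"
    and sWpWm: "Wp * Wm' - Wm' * Wp + (Wm * Wp' - Wp' * Wm) = 0"
    and sWpGp: "Wp * Gp' - Gp' * Wp + (Gp * Wp' - Wp' * Gp) = 0"
    and sWpGm: "Wp * Gm' - Gm' * Wp + (Gm * Wp' - Wp' * Gm) = 0"
    and sWmGp: "Wm * Gp' - Gp' * Wm + (Gp * Wm' - Wm' * Gp) = 0"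
    and sWmGm: "Wm * Gm' - Gm' * Wm + (Gm * Wm' - Wm' * Gm) = 0"
    and sGpGm: "Gp * Gm' - Gm' * Gp + (Gm * Gp' - Gp' * Gm) = 0"
begin

lemmas lc = i_left_comm[of w0] i_left_comm[of w1] i_left_comm[of Wp] i_left_comm[of Wm] i_left_comm[of Gp]
  i_left_comm[of Gm] i_left_comm[of Wp'] i_left_comm[of Wm'] i_left_comm[of Gp'] i_left_comm[of Gm']

text \<open>The relations are symmetric under exchanging W_{-k} with W_{k+1} and G with its
  tilde.\<close>

lemma flip: "two_point \<iota> q qi s \<kappa> u v w1 w0 Wm Wp Gm Gp Wm' Wp' Gm' Gp'"
proof
  have neg: "\<iota> \<kappa> * (b - c) = - (\<iota> \<kappa> * (c - b))" for b c
    by (simp add: algebra_simps)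
  show "w1 * Wp = Wp * w1 + \<iota> \<kappa> * (Gp - Gm)" "w1 * Wp' = Wp' * w1 + \<iota> \<kappa> * (Gp' - Gm')"
    "w0 * Wm = Wm * w0 - \<iota> \<kappa> * (Gp - Gm)" "w0 * Wm' = Wm' * w0 - \<iota> \<kappa> * (Gp' - Gm')"
    by (simp_all add: a1 b1 neg[of Gm Gp] neg[of Gm' Gp'])
  have e: "b - c + (d - e) = 0 \<Longrightarrow> d - e + (b - c) = (0::'b)" for b c d e
    by (simp add: algebra_simps)
  show "Wm * Wp' - Wp' * Wm + (Wp * Wm' - Wm' * Wp) = 0" "Gm * Gp' - Gp' * Gm + (Gp * Gm' - Gm' * Gp) = 0"
    using sWpWm sGpGm by (simp_all only: e)
qed (fact qqi s0 a2 a3 b2 b3 c0 c1 cc sWpGp sWpGm sWmGp sWmGm)+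

text \<open>A nested q-commutator is symmetric in its two outer arguments when these
  commute.\<close>

lemma qswap:
  assumes "G * H = H * G" "\<iota> q * (G * w) - \<iota> qi * (w * G) = P" "\<iota> q * (H * w) - \<iota> qi * (w * H) = P'"
  shows "\<iota> q * (H * P) - \<iota> qi * (P * H) = \<iota> q * (G * P') - \<iota> qi * (P' * G)"
proof -
  have "G * (H * z) = H * (G * z)" for z
    using assms(1) by (metis mult.assoc)
  then show ?thesis
    unfolding assms(2,3)[symmetric]
    by (simp add: algebra_simps i_left_comm[of G] i_left_comm[of H] i_left_comm[of w] i_i assms(1))
qed

lemma qswap':
  assumes "G * H = H * G" "\<iota> q * (w * G) - \<iota> qi * (G * w) = P" "\<iota> q * (w * H) - \<iota> qi * (H * w) = P'"
  shows "\<iota> q * (P * H) - \<iota> qi * (H * P) = \<iota> q * (P' * G) - \<iota> qi * (G * P')"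
proof -
  have "G * (H * z) = H * (G * z)" for z
    using assms(1) by (metis mult.assoc)
  then show ?thesis
    unfolding assms(2,3)[symmetric]
    by (simp add: algebra_simps i_left_comm[of G] i_left_comm[of H] i_left_comm[of w] i_i assms(1))
qed

text \<open>Apply \<open>qswap\<close> to \<open>w0\<close> and the two commuting series Gm, Gm'.
  The right hand sides of \<open>a3\<close> still contain \<open>w0\<close>; its q-commutators are
  evaluated by \<open>a3\<close> once more and give the linear remainder.\<close>

lemma WpGm_exchange:
  "\<iota> q * (Gm' * (\<iota> u * Wp - \<iota> s * Wm)) - \<iota> qi * ((\<iota> u * Wp - \<iota> s * Wm) * Gm')
    - (\<iota> q * (Gm * (\<iota> v * Wp' - \<iota> s * Wm')) - \<iota> qi * ((\<iota> v * Wp' - \<iota> s * Wm') * Gm))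
    = \<iota> s * (\<iota> v * Wp' - \<iota> s * Wm' - (\<iota> u * Wp - \<iota> s * Wm))" (is "?l = _")
proof -
  have "?l - \<iota> s * ((\<iota> q * (Gm' * w0) - \<iota> qi * (w0 * Gm')) - (\<iota> q * (Gm * w0) - \<iota> qi * (w0 * Gm))) = 0"
    using qswap[OF cc(4)[symmetric] a3] by (simp add: algebra_simps lc i_i)
  then show ?thesis
    unfolding a3 by (simp add: algebra_simps)
qed

lemma WpGp_exchange:
  "\<iota> q * ((\<iota> u * Wp - \<iota> s * Wm) * Gp') - \<iota> qi * (Gp' * (\<iota> u * Wp - \<iota> s * Wm))
    - (\<iota> q * ((\<iota> v * Wp' - \<iota> s * Wm') * Gp) - \<iota> qi * (Gp * (\<iota> v * Wp' - \<iota> s * Wm')))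
    = \<iota> s * (\<iota> v * Wp' - \<iota> s * Wm' - (\<iota> u * Wp - \<iota> s * Wm))" (is "?l = _")
proof -
  have "?l - \<iota> s * ((\<iota> q * (w0 * Gp') - \<iota> qi * (Gp' * w0)) - (\<iota> q * (w0 * Gp) - \<iota> qi * (Gp * w0))) = 0"
    using qswap'[OF cc(3)[symmetric] a2] by (simp add: algebra_simps lc i_i)
  then show ?thesis
    unfolding a2 by (simp add: algebra_simps)
qed

lemmas WmGp_exchange = two_point.WpGm_exchange[OF flip] and WmGm_exchange = two_point.WpGp_exchange[OF flip]

lemma solve_q: "\<iota> q * Y - \<iota> qi * X = Z \<Longrightarrow> X = \<iota> (q * q) * Y - \<iota> q * Z"
  and solve_qi: "\<iota> q * Y - \<iota> qi * X = Z \<Longrightarrow> Y = \<iota> (qi * qi) * X + \<iota> qi * Z"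
proof -
  have "\<iota> q * (\<iota> qi * w) = w" "\<iota> qi * (\<iota> q * w) = w" for w
    using qqi by (simp_all add: i_i mult.commute[of qi])
  then show "\<iota> q * Y - \<iota> qi * X = Z \<Longrightarrow> X = \<iota> (q * q) * Y - \<iota> q * Z"
    "\<iota> q * Y - \<iota> qi * X = Z \<Longrightarrow> Y = \<iota> (qi * qi) * X + \<iota> qi * Z"
    by (auto simp: right_diff_distrib i_mult mult.assoc)
qed

lemmas w1_Gp = solve_q[OF b2(1)] solve_q[OF b2(2)]
lemmas w0_Gp = solve_qi[OF a2(1)] solve_qi[OF a2(2)]

lemma assoc_rule: "w * G = z \<Longrightarrow> w * (G * t) = z * (t::'b)"
  by (metis mult.assoc)

text \<open>Let S be the left side of \<open>sWpGp\<close>, which is zero. Moving \<open>w1\<close>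
  through its products with \<open>b1\<close> and \<open>b2\<close> shows that the difference of the
  two sides here is q S w1 - q^-1 w1 S.\<close>

lemma WpWm_commutator:
  "\<iota> (v - u) * (Wp * Wm' - Wm' * Wp) - \<iota> (\<kappa> * s) * (Gm - Gp - Gm' + Gp')
    = \<iota> \<kappa> * (\<iota> q * (Gp' * Gm) - \<iota> qi * (Gm * Gp') - \<iota> q * (Gp * Gm') + \<iota> qi * (Gm' * Gp))"
proof (rule functional_ext)
  fix f :: "'b \<Rightarrow> 'k"
  assume f: "\<And>x y. f (x + y) = f x + f y" "\<And>x y. f (x - y) = f x - f y" "\<And>x. f (- x) = - f x"
    "f 0 = 0" "\<And>k x. f (\<iota> k * x) = k * f x"
  have qr: "q * qi = 1" "\<And>w. q * (qi * w) = w"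
    using qqi by (simp_all add: mult.assoc[symmetric])
  have S: "Wp * Gp' + Gp * Wp' - Gp' * Wp - Wp' * Gp = 0"
    using sWpGp by (simp add: algebra_simps)
  have z: "f (w1 * (Wp * Gp' + Gp * Wp' - Gp' * Wp - Wp' * Gp)) = 0" "f ((Wp * Gp' + Gp * Wp' - Gp' * Wp - Wp' * Gp) * w1) = 0"
    unfolding S by (simp_all add: f)
  have 4: "f Wp * 0 = 0" "f (Wm' * Wp) = f (Wp * Wm') + (f (Wm * Wp') - f (Wp' * Wm))"
    using arg_cong[OF sWpWm, of f] by (simp_all add: f algebra_simps)
  have "f (\<iota> (v - u) * (Wp * Wm' - Wm' * Wp) - \<iota> (\<kappa> * s) * (Gm - Gp - Gm' + Gp'))
    - f (\<iota> \<kappa> * (\<iota> q * (Gp' * Gm) - \<iota> qi * (Gm * Gp') - \<iota> q * (Gp * Gm') + \<iota> qi * (Gm' * Gp)))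
    = qi * (q * (q * f ((Wp * Gp' + Gp * Wp' - Gp' * Wp - Wp' * Gp) * w1))
        - f (w1 * (Wp * Gp' + Gp * Wp' - Gp' * Wp - Wp' * Gp)))"
    by (simp add: algebra_simps lc i_i f b1 w1_Gp assoc_rule[OF b1(1)] assoc_rule[OF b1(2)] assoc_rule[OF w1_Gp(1)] assoc_rule[OF w1_Gp(2)] cc qr 4)
  then show "f (\<iota> (v - u) * (Wp * Wm' - Wm' * Wp) - \<iota> (\<kappa> * s) * (Gm - Gp - Gm' + Gp'))
    = f (\<iota> \<kappa> * (\<iota> q * (Gp' * Gm) - \<iota> qi * (Gm * Gp') - \<iota> q * (Gp * Gm') + \<iota> qi * (Gm' * Gp)))"
    unfolding z by simp
qed

definition qc :: "'b \<Rightarrow> 'b \<Rightarrow> 'b" where "qc X Y = \<iota> q * (X * Y) - \<iota> qi * (Y * X)"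

text \<open>By \<open>a1\<close>, \<kappa> Gm' is the commutator of \<open>w0\<close> and Wm' up to
  a term in Gp', which commutes with Gp. The rest is the Jacobi-type identity [G,[w,W]] =
  [w,[G,W]_q]_q - [[w,G]_q,W]_q.\<close>

lemma GpGm_step:
  "\<iota> \<kappa> * (Gp * Gm' - Gm' * Gp) = qc w0 (qc Gp Wm') - qc (\<iota> u * Wp - \<iota> s * Wm - \<iota> s * w0) Wm'"
proof (rule functional_ext)
  fix f :: "'b \<Rightarrow> 'k"
  assume f: "\<And>x y. f (x + y) = f x + f y" "\<And>x y. f (x - y) = f x - f y" "\<And>x. f (- x) = - f x"
    "f 0 = 0" "\<And>k x. f (\<iota> k * x) = k * f x"
  have qr: "q * qi = 1" "\<And>w. q * (qi * w) = w"
    using qqi by (simp_all add: mult.assoc[symmetric])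
  have "\<iota> \<kappa> * (Gp * Gm' - Gm' * Gp) = Gp * (\<iota> \<kappa> * (Gm' - Gp')) - (\<iota> \<kappa> * (Gm' - Gp')) * Gp"
    using cc(3) by (simp add: algebra_simps lc)
  also have "\<iota> \<kappa> * (Gm' - Gp') = w0 * Wm' - Wm' * w0"
    by (simp add: a1)
  finally have e: "\<iota> \<kappa> * (Gp * Gm' - Gm' * Gp) = Gp * (w0 * Wm' - Wm' * w0) - (w0 * Wm' - Wm' * w0) * Gp" .
  show "f (\<iota> \<kappa> * (Gp * Gm' - Gm' * Gp)) = f (qc w0 (qc Gp Wm') - qc (\<iota> u * Wp - \<iota> s * Wm - \<iota> s * w0) Wm')"
    unfolding e qc_def by (simp add: algebra_simps lc i_i f w0_Gp(1) assoc_rule[OF w0_Gp(1)] qr)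
qed

lemma swap: "two_point \<iota> q qi s \<kappa> v u w0 w1 Wp' Wm' Gp' Gm' Wp Wm Gp Gm"
proof
  have e: "b - c + (d - e) = 0 \<Longrightarrow> e - d + (c - b) = (0::'b)" for b c d e
    by (simp add: algebra_simps)
  show "Wp' * Wm - Wm * Wp' + (Wm' * Wp - Wp * Wm') = 0"
    "Wp' * Gp - Gp * Wp' + (Gp' * Wp - Wp * Gp') = 0"
    "Wp' * Gm - Gm * Wp' + (Gm' * Wp - Wp * Gm') = 0"
    "Wm' * Gp - Gp * Wm' + (Gp' * Wm - Wm * Gp') = 0"
    "Wm' * Gm - Gm * Wm' + (Gm' * Wm - Wm * Gm') = 0"
    "Gp' * Gm - Gm * Gp' + (Gm' * Gp - Gp * Gm') = 0"
    using sWpWm sWpGp sWpGm sWmGp sWmGm sGpGm by (simp_all only: e)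
qed (fact qqi s0 a1 b1 a2 a3 b2 b3 c0 c1 cc[symmetric])+

text \<open>Weighted with v and u, the inner q-commutators of \<open>GpGm_step\<close> for the two
  orders of the points combine by \<open>WmGp_exchange\<close> into \<open>Y\<close>, whose
  q-commutator with \<open>w0\<close> can be evaluated from the first-mode relations.\<close>

lemma GpGm_commutator:
  "\<iota> (\<kappa> * (v - u)) * (Gp * Gm' - Gm' * Gp)
    = \<iota> (s * (q - qi)) * (Wp' * (\<iota> u * Wp - \<iota> s * Wm) - Wp * (\<iota> v * Wp' - \<iota> s * Wm'))
      - (\<iota> v * qc (\<iota> u * Wp - \<iota> s * Wm) Wm' - \<iota> u * qc (\<iota> v * Wp' - \<iota> s * Wm') Wm)"
proof -
  define Y where "Y = \<iota> (s * (q - qi)) * (Wp' * Gp - Wp * Gp') - \<iota> s * (\<iota> v * Wm' - \<iota> s * Wp' - (\<iota> u * Wm - \<iota> s * Wp))"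
  have "qc w0 Z = \<iota> q * (w0 * Z) - \<iota> qi * (Z * w0)" for Z
    by (simp add: qc_def)
  have qc_comb: "qc w0 (\<iota> v * Z - \<iota> u * Z') = \<iota> v * qc w0 Z - \<iota> u * qc w0 Z'" for Z Z'
    by (simp add: qc_def algebra_simps lc i_i)
  have X: "\<iota> v * qc Gp Wm' - \<iota> u * qc Gp' Wm = Y"
  proof (rule functional_ext)
    fix f :: "'b \<Rightarrow> 'k"
    assume f: "\<And>x y. f (x + y) = f x + f y" "\<And>x y. f (x - y) = f x - f y" "\<And>x. f (- x) = - f x"
      "f 0 = 0" "\<And>k x. f (\<iota> k * x) = k * f x"
    have 1: "f (Wp' * Gp) = f (Wp * Gp') - f (Gp' * Wp) + f (Gp * Wp')"
      using arg_cong[OF sWpGp, of f] by (simp add: f algebra_simps)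
    show "f (\<iota> v * qc Gp Wm' - \<iota> u * qc Gp' Wm) = f Y"
      using arg_cong[OF WmGp_exchange, of f] by (simp add: qc_def Y_def algebra_simps lc i_i f 1)
  qed
  have D: "Gp * Gm' - Gm' * Gp = Gp' * Gm - Gm * Gp'"
    using sGpGm by (simp add: algebra_simps)
  have split: "\<iota> (\<kappa> * (v - u)) * z = \<iota> v * (\<iota> \<kappa> * z) - \<iota> u * (\<iota> \<kappa> * z)" for z
    by (simp only: i_i left_diff_distrib[symmetric] i_diff[symmetric]) (simp add: algebra_simps)
  have "\<iota> (\<kappa> * (v - u)) * (Gp * Gm' - Gm' * Gp)
    = \<iota> v * (\<iota> \<kappa> * (Gp * Gm' - Gm' * Gp)) - \<iota> u * (\<iota> \<kappa> * (Gp' * Gm - Gm * Gp'))"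
    by (simp only: split D)
  also have "\<dots> = qc w0 Y - \<iota> v * qc (\<iota> u * Wp - \<iota> s * Wm - \<iota> s * w0) Wm' + \<iota> u * qc (\<iota> v * Wp' - \<iota> s * Wm' - \<iota> s * w0) Wm"
    unfolding GpGm_step two_point.GpGm_step[OF swap] X[symmetric] qc_comb by (simp add: algebra_simps)
  also have "\<dots> = \<iota> (s * (q - qi)) * (Wp' * (\<iota> u * Wp - \<iota> s * Wm) - Wp * (\<iota> v * Wp' - \<iota> s * Wm'))
      - (\<iota> v * qc (\<iota> u * Wp - \<iota> s * Wm) Wm' - \<iota> u * qc (\<iota> v * Wp' - \<iota> s * Wm') Wm)"
  proof (rule functional_ext)
    fix f :: "'b \<Rightarrow> 'k"
    assume f: "\<And>x y. f (x + y) = f x + f y" "\<And>x y. f (x - y) = f x - f y" "\<And>x. f (- x) = - f x"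
      "f 0 = 0" "\<And>k x. f (\<iota> k * x) = k * f x"
    have qr: "q * qi = 1" "\<And>w. q * (qi * w) = w"
      using qqi by (simp_all add: mult.assoc[symmetric])
    show "f (qc w0 Y - \<iota> v * qc (\<iota> u * Wp - \<iota> s * Wm - \<iota> s * w0) Wm' + \<iota> u * qc (\<iota> v * Wp' - \<iota> s * Wm' - \<iota> s * w0) Wm)
      = f (\<iota> (s * (q - qi)) * (Wp' * (\<iota> u * Wp - \<iota> s * Wm) - Wp * (\<iota> v * Wp' - \<iota> s * Wm'))
      - (\<iota> v * qc (\<iota> u * Wp - \<iota> s * Wm) Wm' - \<iota> u * qc (\<iota> v * Wp' - \<iota> s * Wm') Wm))"
      by (simp add: qc_def Y_def algebra_simps lc i_i f w0_Gp assoc_rule[OF w0_Gp(1)] assoc_rule[OF w0_Gp(2)]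
        c0 assoc_rule[OF c0(1)] assoc_rule[OF c0(2)] cc qr)
  qed
  finally show ?thesis .
qed

end

section \<open>The reflection equation entry by entry\<close>

locale two_point_RE = two_point \<iota> q qi "q + qi" "kp * km" "q * (x * x) + qi * (xi * xi)" "q * (y * y) + qi * (yi * yi)"
    w0 w1 Wp Wm Gp Gm Wp' Wm' Gp' Gm'
  for \<iota> :: "'k::field \<Rightarrow> 'b::ring_1" and q qi kp km x xi y yi w0 w1 Wp Wm Gp Gm Wp' Wm' Gp' Gm' +
  assumes xxi: "x * xi = 1" and yyi: "y * yi = 1"
begin

text \<open>The K-operator at the first point multiplied by q - 1/q, which clears its
  denominators.\<close>

definition KX :: "bool \<Rightarrow> bool \<Rightarrow> 'b" where
  "KX a b = (if a then (if b then \<iota> ((q - qi) * x * q) * Wm - \<iota> ((q - qi) * xi * qi) * Wp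
        else \<iota> (km * (q - qi)) * Gm + \<iota> (km * (q + qi)))
      else (if b then \<iota> (kp * (q - qi)) * Gp + \<iota> (kp * (q + qi))
        else \<iota> ((q - qi) * x * q) * Wp - \<iota> ((q - qi) * xi * qi) * Wm))"

definition KY :: "bool \<Rightarrow> bool \<Rightarrow> 'b" where
  "KY a b = (if a then (if b then \<iota> ((q - qi) * y * q) * Wm' - \<iota> ((q - qi) * yi * qi) * Wp'
        else \<iota> (km * (q - qi)) * Gm' + \<iota> (km * (q + qi)))
      else (if b then \<iota> (kp * (q - qi)) * Gp' + \<iota> (kp * (q + qi))
        else \<iota> ((q - qi) * y * q) * Wp' - \<iota> ((q - qi) * yi * qi) * Wm'))"

definition Rm :: "'k \<Rightarrow> 'k \<Rightarrow> (bool \<Rightarrow> bool \<Rightarrow> 'b) \<Rightarrow> bool \<Rightarrow> bool \<Rightarrow> 'b" where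
  "Rm z zi w a b = (if a = b then \<iota> (z * q - zi * qi) * w a b else \<iota> (z - zi) * w a b + \<iota> (q - qi) * w b a)"

definition X1 where "X1 w = (\<lambda>a b::bool. KX a False * w False b + KX a True * w True b)"
definition Y2 where "Y2 w = (\<lambda>a::bool. \<lambda>b. KY b False * w a False + KY b True * w a True)"

definition unit2 :: "bool \<Rightarrow> bool \<Rightarrow> bool \<Rightarrow> bool \<Rightarrow> 'b" where
  "unit2 c d a b = (if a = c \<and> b = d then 1 else 0)"

text \<open>Each of the sixteen entries of the difference of both sides is zero or a scalar
  combination of six relations: the four exchange relations between a W- and a G-series, and the two
  commutators \<open>WpWm_commutator\<close> and \<open>GpGm_commutator\<close>. The coefficients
  are Laurent polynomials in x, y, q times k_+ or k_- where an off-diagonal K-entry takes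
  part.\<close>

lemma RE_unit:
  "Rm (x * yi) (xi * y) (X1 (Rm (x * y) (xi * yi) (Y2 (unit2 c d)))) a b
    = Y2 (Rm (x * y) (xi * yi) (X1 (Rm (x * yi) (xi * y) (unit2 c d)))) a b"
proof (rule functional_ext)
  fix f :: "'b \<Rightarrow> 'k"
  assume f: "\<And>x y. f (x + y) = f x + f y" "\<And>x y. f (x - y) = f x - f y" "\<And>x. f (- x) = - f x"
    "f 0 = 0" "\<And>k x. f (\<iota> k * x) = k * f x"
  have fi: "f (\<iota> k) = k * f 1" for k
    using f(5)[of k 1] by simp
  have r: "q * qi = 1" "\<And>w. q * (qi * w) = w" "x * xi = 1" "\<And>w. x * (xi * w) = w" "y * yi = 1" "\<And>w. y * (yi * w) = w"
    using qqi xxi yyi by (simp_all add: mult.assoc[symmetric])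
  have s: "f (Wp' * Wm) = f (Wp * Wm') - f (Wm' * Wp) + f (Wm * Wp')"
    "f (Wp' * Gp) = f (Wp * Gp') - f (Gp' * Wp) + f (Gp * Wp')"
    "f (Wp' * Gm) = f (Wp * Gm') - f (Gm' * Wp) + f (Gm * Wp')"
    "f (Wm' * Gp) = f (Wm * Gp') - f (Gp' * Wm) + f (Gp * Wm')"
    "f (Wm' * Gm) = f (Wm * Gm') - f (Gm' * Wm) + f (Gm * Wm')"
    "f (Gp' * Gm) = f (Gp * Gm') - f (Gm' * Gp) + f (Gm * Gp')"
    using arg_cong[OF sWpWm, of f] arg_cong[OF sWpGp, of f] arg_cong[OF sWpGm, of f]
      arg_cong[OF sWmGp, of f] arg_cong[OF sWmGm, of f] arg_cong[OF sGpGm, of f]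
    by (simp_all add: f algebra_simps)
  note fs = algebra_simps lc i_i f fi cc s r
  \<comment> \<open>Each of the six abbreviations is a functional applied to the left side minus the
    same functional applied to the right side of one relation.\<close>
  let ?va = "f ((\<iota> q * (Gm' * (\<iota> (q * (x * x) + qi * (xi * xi)) * Wp - \<iota> (q + qi) * Wm)) - \<iota> qi * ((\<iota> (q * (x * x) + qi * (xi * xi)) * Wp - \<iota> (q + qi) * Wm) * Gm')) - (\<iota> q * (Gm * (\<iota> (q * (y * y) + qi * (yi * yi)) * Wp' - \<iota> (q + qi) * Wm')) - \<iota> qi * ((\<iota> (q * (y * y) + qi * (yi * yi)) * Wp' - \<iota> (q + qi) * Wm') * Gm))) - f (\<iota> (q + qi) * ((\<iota> (q * (y * y) + qi * (yi * yi)) * Wp' - \<iota> (q + qi) * Wm') - (\<iota> (q * (x * x) + qi * (xi * xi)) * Wp - \<iota> (q + qi) * Wm)))"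
  let ?vb = "f ((\<iota> q * ((\<iota> (q * (x * x) + qi * (xi * xi)) * Wp - \<iota> (q + qi) * Wm) * Gp') - \<iota> qi * (Gp' * (\<iota> (q * (x * x) + qi * (xi * xi)) * Wp - \<iota> (q + qi) * Wm))) - (\<iota> q * ((\<iota> (q * (y * y) + qi * (yi * yi)) * Wp' - \<iota> (q + qi) * Wm') * Gp) - \<iota> qi * (Gp * (\<iota> (q * (y * y) + qi * (yi * yi)) * Wp' - \<iota> (q + qi) * Wm')))) - f (\<iota> (q + qi) * ((\<iota> (q * (y * y) + qi * (yi * yi)) * Wp' - \<iota> (q + qi) * Wm') - (\<iota> (q * (x * x) + qi * (xi * xi)) * Wp - \<iota> (q + qi) * Wm)))"
  let ?vc = "f ((\<iota> q * (Gp' * (\<iota> (q * (x * x) + qi * (xi * xi)) * Wm - \<iota> (q + qi) * Wp)) - \<iota> qi * ((\<iota> (q * (x * x) + qi * (xi * xi)) * Wm - \<iota> (q + qi) * Wp) * Gp')) - (\<iota> q * (Gp * (\<iota> (q * (y * y) + qi * (yi * yi)) * Wm' - \<iota> (q + qi) * Wp')) - \<iota> qi * ((\<iota> (q * (y * y) + qi * (yi * yi)) * Wm' - \<iota> (q + qi) * Wp') * Gp))) - f (\<iota> (q + qi) * ((\<iota> (q * (y * y) + qi * (yi * yi)) * Wm' - \<iota> (q + qi) * Wp') - (\<iota> (q * (x * x) + qi * (xi * xi)) * Wm - \<iota> (q + qi) * Wp)))"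
  let ?vd = "f ((\<iota> q * ((\<iota> (q * (x * x) + qi * (xi * xi)) * Wm - \<iota> (q + qi) * Wp) * Gm') - \<iota> qi * (Gm' * (\<iota> (q * (x * x) + qi * (xi * xi)) * Wm - \<iota> (q + qi) * Wp))) - (\<iota> q * ((\<iota> (q * (y * y) + qi * (yi * yi)) * Wm' - \<iota> (q + qi) * Wp') * Gm) - \<iota> qi * (Gm * (\<iota> (q * (y * y) + qi * (yi * yi)) * Wm' - \<iota> (q + qi) * Wp')))) - f (\<iota> (q + qi) * ((\<iota> (q * (y * y) + qi * (yi * yi)) * Wm' - \<iota> (q + qi) * Wp') - (\<iota> (q * (x * x) + qi * (xi * xi)) * Wm - \<iota> (q + qi) * Wp)))"
  let ?iii = "f (\<iota> ((q * (y * y) + qi * (yi * yi)) - (q * (x * x) + qi * (xi * xi))) * (Wp * Wm' - Wm' * Wp) - \<iota> (kp * km * (q + qi)) * (Gm - Gp - Gm' + Gp')) - f (\<iota> (kp * km) * (\<iota> q * (Gp' * Gm) - \<iota> qi * (Gm * Gp') - \<iota> q * (Gp * Gm') + \<iota> qi * (Gm' * Gp)))"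
  let ?iv = "f (\<iota> (kp * km * ((q * (y * y) + qi * (yi * yi)) - (q * (x * x) + qi * (xi * xi)))) * (Gp * Gm' - Gm' * Gp)) - f (\<iota> ((q + qi) * (q - qi)) * (Wp' * (\<iota> (q * (x * x) + qi * (xi * xi)) * Wp - \<iota> (q + qi) * Wm) - Wp * (\<iota> (q * (y * y) + qi * (yi * yi)) * Wp' - \<iota> (q + qi) * Wm')) - (\<iota> (q * (y * y) + qi * (yi * yi)) * (\<iota> q * ((\<iota> (q * (x * x) + qi * (xi * xi)) * Wp - \<iota> (q + qi) * Wm) * Wm') - \<iota> qi * (Wm' * (\<iota> (q * (x * x) + qi * (xi * xi)) * Wp - \<iota> (q + qi) * Wm))) - \<iota> (q * (x * x) + qi * (xi * xi)) * (\<iota> q * ((\<iota> (q * (y * y) + qi * (yi * yi)) * Wp' - \<iota> (q + qi) * Wm') * Wm) - \<iota> qi * (Wm * (\<iota> (q * (y * y) + qi * (yi * yi)) * Wp' - \<iota> (q + qi) * Wm')))))"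
  have va0: "?va = 0"
    by (simp only: WpGm_exchange diff_self)
  have vb0: "?vb = 0"
    by (simp only: WpGp_exchange diff_self)
  have vc0: "?vc = 0"
    by (simp only: WmGp_exchange diff_self)
  have vd0: "?vd = 0"
    by (simp only: WmGm_exchange diff_self)
  have iii0: "?iii = 0"
    by (simp only: WpWm_commutator diff_self)
  have iv0: "?iv = 0"
    by (simp only: GpGm_commutator[unfolded qc_def] diff_self)
  let ?D = "\<lambda>a b c d. f (Rm (x * yi) (xi * y) (X1 (Rm (x * y) (xi * yi) (Y2 (unit2 c d)))) a b)
    - f (Y2 (Rm (x * y) (xi * yi) (X1 (Rm (x * yi) (xi * y) (unit2 c d)))) a b)"
  note rc = i_central[of _ Wp, symmetric] i_central[of _ Wm, symmetric] i_central[of _ Gp, symmetric] i_central[of _ Gm, symmetric]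
    i_central[of _ Wp', symmetric] i_central[of _ Wm', symmetric] i_central[of _ Gp', symmetric] i_central[of _ Gm', symmetric]
    i_mult[symmetric]
  note defs = Rm_def X1_def Y2_def unit2_def KX_def KY_def
  have D00: "?D False False False False = (q - qi) * (q - qi) * ((x*yi*q - xi*y*qi)) * ?iii"
    by (simp add: defs algebra_simps lc i_i f fi cc s r rc)
  have D01: "?D False False False True = (q - qi) * (q - qi) * (kp*x*q) * ?vb + (q - qi) * (q - qi) * (kp*xi*qi) * ?vc"
    by (simp add: defs algebra_simps lc i_i f fi cc s r rc)
  have D02: "?D False False True False = (q - qi) * (q - qi) * (-kp*y) * ?vb + (q - qi) * (q - qi) * (-kp*yi) * ?vc"
    by (simp add: defs algebra_simps lc i_i f fi cc s r rc)
  have D03: "?D False False True True = 0"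
    by (simp add: defs algebra_simps lc i_i f fi cc s r rc)
  have D10: "?D False True False False = (q - qi) * (q - qi) * (-km*x*q) * ?va + (q - qi) * (q - qi) * (-km*xi*qi) * ?vd"
    by (simp add: defs algebra_simps lc i_i f fi cc s r rc)
  have D11: "?D False True False True = (q - qi) * (q - qi) * (-(x*y*q - xi*yi*qi)) * ?iii"
    by (simp add: defs algebra_simps lc i_i f fi cc s r rc)
  have D12: "?D False True True False = (q - qi) * (q - qi) * (-1) * ?iv"
    by (simp add: defs algebra_simps lc i_i f fi cc s r rc)
  have D13: "?D False True True True = (q - qi) * (q - qi) * (kp*yi) * ?vb + (q - qi) * (q - qi) * (kp*y) * ?vc"
    by (simp add: defs algebra_simps lc i_i f fi cc s r rc)
  have D20: "?D True False False False = (q - qi) * (q - qi) * (km*y) * ?va + (q - qi) * (q - qi) * (km*yi) * ?vd"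
    by (simp add: defs algebra_simps lc i_i f fi cc s r rc)
  have D21: "?D True False False True = (q - qi) * (q - qi) * (1) * ?iv"
    by (simp add: defs algebra_simps lc i_i f fi cc s r rc)
  have D22: "?D True False True False = (q - qi) * (q - qi) * ((x*y*q - xi*yi*qi)) * ?iii"
    by (simp add: defs algebra_simps lc i_i f fi cc s r rc)
  have D23: "?D True False True True = (q - qi) * (q - qi) * (-kp*xi*qi) * ?vb + (q - qi) * (q - qi) * (-kp*x*q) * ?vc"
    by (simp add: defs algebra_simps lc i_i f fi cc s r rc)
  have D30: "?D True True False False = 0"
    by (simp add: defs algebra_simps lc i_i f fi cc s r rc)
  have D31: "?D True True False True = (q - qi) * (q - qi) * (-km*yi) * ?va + (q - qi) * (q - qi) * (-km*y) * ?vd"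
    by (simp add: defs algebra_simps lc i_i f fi cc s r rc)
  have D32: "?D True True True False = (q - qi) * (q - qi) * (km*xi*qi) * ?va + (q - qi) * (q - qi) * (km*x*q) * ?vd"
    by (simp add: defs algebra_simps lc i_i f fi cc s r rc)
  have D33: "?D True True True True = (q - qi) * (q - qi) * (-(x*yi*q - xi*y*qi)) * ?iii"
    by (simp add: defs algebra_simps lc i_i f fi cc s r rc)
  have "?D a b c d = 0"
    by (cases a; cases b; cases c; cases d)
      (simp_all only: D00 D01 D02 D03 D10 D11 D12 D13 D20 D21 D22 D23 D30 D31 D32 D33 va0 vb0 vc0 vd0 iii0 iv0 mult_zero_right add_0_right)
  then show "f (Rm (x * yi) (xi * y) (X1 (Rm (x * y) (xi * yi) (Y2 (unit2 c d)))) a b)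
    = f (Y2 (Rm (x * y) (xi * yi) (X1 (Rm (x * yi) (xi * y) (unit2 c d)))) a b)"
    by simp
qed

end

section \<open>Laurent series of generators\<close>

text \<open>Convolution with lower bounds that may lie below the exact orders, so that products
  whose factors have been changed can be compared term by term.\<close>

lemma fls_times_nth_bounds:
  fixes f g :: "'a::semiring_0 fls"
  assumes f: "\<And>i. i < A \<Longrightarrow> fls_nth f i = 0" and g: "\<And>i. i < B \<Longrightarrow> fls_nth g i = 0"
  shows "fls_nth (f * g) n = (\<Sum>i=A..n - B. fls_nth f i * fls_nth g (n - i))"
proof (cases "f = 0 \<or> g = 0")
  case False
  then have A: "A \<le> fls_subdegree f" and B: "B \<le> fls_subdegree g"
    using f g by (auto intro: fls_subdegree_geI)
  show ?thesis
    unfolding fls_times_nth(2)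
  proof (rule sum.mono_neutral_left)
    show "\<forall>i\<in>{A..n - B} - {fls_subdegree f..n - fls_subdegree g}. fls_nth f i * fls_nth g (n - i) = 0"
      by (auto simp: not_le)
  qed (use A B in auto)
qed auto

context scalars
begin

lemma fls_map_nth: "fls_nth (fls_map \<iota> f) n = \<iota> (fls_nth f n)"
  by (simp add: fls_nth_fls_map)

lemma scalars_fls_map: "scalars (fls_map \<iota>)"
proof
  fix k l :: "'k fls" and b :: "'b fls"
  show "fls_map \<iota> (k + l) = fls_map \<iota> k + fls_map \<iota> l"
    by (rule fls_eqI) (simp add: fls_map_nth i_add)
  show "fls_map \<iota> 1 = 1"
    by (rule fls_eqI) (simp add: fls_map_nth)
  show "fls_map \<iota> (k * l) = fls_map \<iota> k * fls_map \<iota> l"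
  proof (rule fls_eqI)
    fix n
    have "fls_nth (fls_map \<iota> k * fls_map \<iota> l) n
      = (\<Sum>i=fls_subdegree k..n - fls_subdegree l. fls_nth (fls_map \<iota> k) i * fls_nth (fls_map \<iota> l) (n - i))"
      by (rule fls_times_nth_bounds) (simp_all add: fls_map_nth)
    then show "fls_nth (fls_map \<iota> (k * l)) n = fls_nth (fls_map \<iota> k * fls_map \<iota> l) n"
      by (simp add: fls_map_nth fls_times_nth(2) i_sum i_mult)
  qed
  show "fls_map \<iota> k * b = b * fls_map \<iota> k"
  proof (rule fls_eqI)
    fix n
    have "fls_nth (fls_map \<iota> k * b) n
      = (\<Sum>i=fls_subdegree k..n - fls_subdegree b. fls_nth (fls_map \<iota> k) i * fls_nth b (n - i))"
      by (rule fls_times_nth_bounds) (simp_all add: fls_map_nth)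
    also have "\<dots> = (\<Sum>i=fls_subdegree b..n - fls_subdegree k. fls_nth b i * fls_nth (fls_map \<iota> k) (n - i))"
      by (rule sum.reindex_bij_witness[of _ "\<lambda>i. n - i" "\<lambda>i. n - i"]) (auto simp: fls_map_nth i_central)
    also have "\<dots> = fls_nth (b * fls_map \<iota> k) n"
      by (rule fls_times_nth_bounds[symmetric]) (simp_all add: fls_map_nth)
    finally show "fls_nth (fls_map \<iota> k * b) n = fls_nth (b * fls_map \<iota> k) n" .
  qed
qed

end

context scalars
begin

text \<open>The series with terms a_k s^(k+1) for a scalar series \<open>s\<close> of positive
  order. It is given by coefficients, each a finite sum because s^(k+1) starts at order k+1 or
  later.\<close>

definition gser :: "(nat \<Rightarrow> 'b) \<Rightarrow> 'k fls \<Rightarrow> 'b fls" where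
  "gser a s = Abs_fls (\<lambda>n. \<Sum>k<nat n. \<iota> (fls_nth (s ^ (k + 1)) n) * a k)"

lemma gser_nth: "fls_nth (gser a s) n = (\<Sum>k<nat n. \<iota> (fls_nth (s ^ (k + 1)) n) * a k)"
  unfolding gser_def by (rule nth_Abs_fls_lower_bound[where N = 0]) simp

lemma gser_nth_low: "n < 1 \<Longrightarrow> fls_nth (gser a s) n = 0"
  by (simp add: gser_nth)

lemma fls_pow_low:
  assumes "0 < fls_subdegree (s :: 'k fls)" "n < int k + 1"
  shows "fls_nth (s ^ (k + 1)) n = 0"
proof -
  have "int k + 1 \<le> int (k + 1) * fls_subdegree s"
  proof -
    have "int k + 1 = int (k + 1) * 1"
      by simp
    also have "\<dots> \<le> int (k + 1) * fls_subdegree s"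
      using assms(1) by (intro mult_left_mono) simp_all
    finally show ?thesis .
  qed
  then have "n < fls_subdegree (s ^ (k + 1))"
    using assms(2) by (simp only: fls_subdegree_pow)
  then show ?thesis
    by simp
qed

lemma gser_nth_le:
  assumes "0 < fls_subdegree s" "nat n \<le> N"
  shows "fls_nth (gser a s) n = (\<Sum>k<N. \<iota> (fls_nth (s ^ (k + 1)) n) * a k)"
  unfolding gser_nth
proof (rule sum.mono_neutral_left)
  show "\<forall>k\<in>{..<N} - {..<nat n}. \<iota> (fls_nth (s ^ (k + 1)) n) * a k = 0"
  proof
    fix k assume "k \<in> {..<N} - {..<nat n}"
    then have "n < int k + 1"
      by auto
    then show "\<iota> (fls_nth (s ^ (k + 1)) n) * a k = 0"
      by (simp only: fls_pow_low[OF assms(1)]) simp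
  qed
qed (use assms(2) in auto)

lemma gser_mult_nth:
  assumes s: "0 < fls_subdegree s" and t: "0 < fls_subdegree t" and N: "nat n \<le> N"
  shows "fls_nth (gser a s * gser b t) n
    = (\<Sum>k<N. \<Sum>l<N. \<iota> (fls_nth (s ^ (k + 1) * t ^ (l + 1)) n) * (a k * b l))"
proof -
  have "fls_nth (gser a s * gser b t) n = (\<Sum>i=1..n - 1. fls_nth (gser a s) i * fls_nth (gser b t) (n - i))"
    by (rule fls_times_nth_bounds) (simp_all add: gser_nth_low)
  also have "\<dots> = (\<Sum>i=1..n - 1. \<Sum>k<N. \<Sum>l<N. \<iota> (fls_nth (s ^ (k + 1)) i * fls_nth (t ^ (l + 1)) (n - i)) * (a k * b l))"
  proof (rule sum.cong[OF refl])
    fix i assume "i \<in> {1..n - 1}"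
    then have "nat i \<le> N" "nat (n - i) \<le> N"
      using N by auto
    then show "fls_nth (gser a s) i * fls_nth (gser b t) (n - i)
      = (\<Sum>k<N. \<Sum>l<N. \<iota> (fls_nth (s ^ (k + 1)) i * fls_nth (t ^ (l + 1)) (n - i)) * (a k * b l))"
      by (simp add: gser_nth_le[OF s] gser_nth_le[OF t] sum_product i_mult mult.assoc i_left_comm[of "a _"]
          del: power_Suc)
  qed
  also have "\<dots> = (\<Sum>k<N. \<Sum>l<N. (\<Sum>i=1..n - 1. \<iota> (fls_nth (s ^ (k + 1)) i * fls_nth (t ^ (l + 1)) (n - i)) * (a k * b l)))"
    by (subst sum.swap) (rule sum.cong[OF refl], rule sum.swap)
  also have "\<dots> = (\<Sum>k<N. \<Sum>l<N. \<iota> (fls_nth (s ^ (k + 1) * t ^ (l + 1)) n) * (a k * b l))"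
  proof (intro sum.cong refl)
    fix k l
    have "fls_nth (s ^ (k + 1) * t ^ (l + 1)) n = (\<Sum>i=1..n - 1. fls_nth (s ^ (k + 1)) i * fls_nth (t ^ (l + 1)) (n - i))"
      by (rule fls_times_nth_bounds) (use fls_pow_low[OF s] fls_pow_low[OF t] in \<open>auto simp del: power_Suc\<close>)
    then show "(\<Sum>i=1..n - 1. \<iota> (fls_nth (s ^ (k + 1)) i * fls_nth (t ^ (l + 1)) (n - i)) * (a k * b l))
        = \<iota> (fls_nth (s ^ (k + 1) * t ^ (l + 1)) n) * (a k * b l)"
      by (simp only: i_sum sum_distrib_right)
  qed
  finally show ?thesis .
qed

lemma gser_commutator_nth:
  assumes s: "0 < fls_subdegree s" and t: "0 < fls_subdegree t" and N: "nat n \<le> N"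
  shows "fls_nth (gser a s * gser b t - gser b t * gser a s) n
    = (\<Sum>k<N. \<Sum>l<N. \<iota> (fls_nth (s ^ (k + 1) * t ^ (l + 1)) n) * (a k * b l - b l * a k))"
proof -
  have "fls_nth (gser b t * gser a s) n
    = (\<Sum>k<N. \<Sum>l<N. \<iota> (fls_nth (s ^ (k + 1) * t ^ (l + 1)) n) * (b l * a k))"
    unfolding gser_mult_nth[OF t s N] by (subst sum.swap) (simp only: mult.commute[of "t ^ _"])
  then show ?thesis
    by (simp only: fls_minus_nth gser_mult_nth[OF s t N] sum_subtractf[symmetric] right_diff_distrib)
qed

text \<open>Both commutators of modes k and l carry the same scalar s^(k+1) t^(l+1), so a relation
  summed over the two commutators passes to the series.\<close>

lemma gser_commutator_sum:
  assumes "0 < fls_subdegree s" "0 < fls_subdegree t"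
    and "\<And>k l. a k * b l - b l * a k + (c k * d l - d l * c k) = 0"
  shows "gser a s * gser b t - gser b t * gser a s + (gser c s * gser d t - gser d t * gser c s) = 0"
  by (rule fls_eqI)
    (simp only: fls_plus_nth gser_commutator_nth[OF assms(1,2) order_refl] sum.distrib[symmetric]
      distrib_left[symmetric] assms(3) mult_zero_right sum.neutral_const fls_zero_nth)

lemma gser_commute:
  assumes "0 < fls_subdegree s" "0 < fls_subdegree t" and "\<And>k l. a k * b l = b l * a k"
  shows "gser a s * gser b t = gser b t * gser a s"
proof -
  have "gser a s * gser b t - gser b t * gser a s = 0"
    by (rule fls_eqI) (simp only: gser_commutator_nth[OF assms(1,2) order_refl] assms(3) diff_self
      mult_zero_right sum.neutral_const fls_zero_nth)
  then show ?thesis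
    by simp
qed

lemma gser_left: "fls_const c * gser a s = gser (\<lambda>k. c * a k) s"
  and gser_right: "gser a s * fls_const c = gser (\<lambda>k. a k * c) s"
  by (auto intro!: fls_eqI simp: gser_nth sum_distrib_left sum_distrib_right i_left_comm[of c] mult.assoc simp del: power_Suc)

lemma gser_add: "gser a s + gser b s = gser (\<lambda>k. a k + b k) s"
  and gser_diff: "gser a s - gser b s = gser (\<lambda>k. a k - b k) s"
  by (auto intro!: fls_eqI simp: gser_nth sum.distrib sum_subtractf algebra_simps simp del: power_Suc)

text \<open>With s = 1/U, shifting the modes by one means multiplying the series by U and removing
  the first mode. This is the source of the factors \<open>u\<close>, \<open>v\<close> and of the
  terms in \<open>w0\<close>, \<open>w1\<close> in \<open>two_point\<close>.\<close>

lemma gser_shift: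
  assumes s: "0 < fls_subdegree s"
  shows "gser a s = fls_map \<iota> s * (fls_const (a 0) + gser (\<lambda>k. a (Suc k)) s)"
proof (rule fls_eqI)
  fix n
  define N where "N = nat n"
  have s_low: "i < 1 \<Longrightarrow> fls_nth s i = 0" for i
    using fls_pow_low[OF s, of i 0] by simp
  have c: "fls_nth (fls_map \<iota> s * fls_const (a 0)) n = \<iota> (fls_nth s n) * a 0"
    by (simp add: fls_map_nth)
  have "fls_nth (fls_map \<iota> s * gser (\<lambda>k. a (Suc k)) s) n
    = (\<Sum>i=1..n - 1. fls_nth (fls_map \<iota> s) i * fls_nth (gser (\<lambda>k. a (Suc k)) s) (n - i))"
    by (rule fls_times_nth_bounds) (simp_all add: gser_nth_low fls_map_nth s_low)
  also have "\<dots> = (\<Sum>i=1..n - 1. \<Sum>k<N. \<iota> (fls_nth s i * fls_nth (s ^ (k + 1)) (n - i)) * a (Suc k))"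
  proof (rule sum.cong[OF refl])
    fix i assume "i \<in> {1..n - 1}"
    then have "nat (n - i) \<le> N"
      by (auto simp: N_def)
    then show "fls_nth (fls_map \<iota> s) i * fls_nth (gser (\<lambda>k. a (Suc k)) s) (n - i)
      = (\<Sum>k<N. \<iota> (fls_nth s i * fls_nth (s ^ (k + 1)) (n - i)) * a (Suc k))"
      by (simp only: gser_nth_le[OF s] sum_distrib_left fls_map_nth i_mult mult.assoc)
  qed
  also have "\<dots> = (\<Sum>k<N. (\<Sum>i=1..n - 1. \<iota> (fls_nth s i * fls_nth (s ^ (k + 1)) (n - i)) * a (Suc k)))"
    by (rule sum.swap)
  also have "\<dots> = (\<Sum>k<N. \<iota> (fls_nth (s ^ (Suc k + 1)) n) * a (Suc k))"
  proof (intro sum.cong refl)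
    fix k
    have "fls_nth (s * s ^ (k + 1)) n = (\<Sum>i=1..n - 1. fls_nth s i * fls_nth (s ^ (k + 1)) (n - i))"
      by (rule fls_times_nth_bounds) (use fls_pow_low[OF s] s_low in \<open>auto simp del: power_Suc\<close>)
    then show "(\<Sum>i=1..n - 1. \<iota> (fls_nth s i * fls_nth (s ^ (k + 1)) (n - i)) * a (Suc k)) = \<iota> (fls_nth (s ^ (Suc k + 1)) n) * a (Suc k)"
      by (simp add: i_sum sum_distrib_right)
  qed
  finally have "fls_nth (fls_map \<iota> s * (fls_const (a 0) + gser (\<lambda>k. a (Suc k)) s)) n
    = \<iota> (fls_nth s n) * a 0 + (\<Sum>k<N. \<iota> (fls_nth (s ^ (Suc k + 1)) n) * a (Suc k))"
    by (simp only: distrib_left fls_plus_nth c)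
  also have "\<dots> = (\<Sum>k<Suc N. \<iota> (fls_nth (s ^ (k + 1)) n) * a k)"
    by (subst sum.lessThan_Suc_shift) simp
  also have "\<dots> = fls_nth (gser a s) n"
    by (rule gser_nth_le[OF s, symmetric]) (simp add: N_def)
  finally show "fls_nth (gser a s) n = fls_nth (fls_map \<iota> s * (fls_const (a 0) + gser (\<lambda>k. a (Suc k)) s)) n" ..
qed

end

context two_point_RE
begin

text \<open>Both sides are linear over right multiplication, so the four unit vectors of C^2 tensor
  C^2 suffice; the third index is a spectator.\<close>

lemma KX_RE:
  assumes q0: "q \<noteq> 0" and Q: "qscalars \<iota> q"
  shows "qscalars.R12 \<iota> q (x / y) (K1 KX (qscalars.R12 \<iota> q (x * y) (K2 KY \<phi>)))
    = K2 KY (qscalars.R12 \<iota> q (x * y) (K1 KX (qscalars.R12 \<iota> q (x / y) \<phi>)))"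
proof (intro ext)
  fix a b m
  interpret Q: qscalars \<iota> q
    by (rule Q)
  have inv: "inverse q = qi" "inverse x = xi" "inverse y = yi"
    "inverse yi = y"
    using qqi xxi yyi by (simp_all add: inverse_unique mult.commute[of yi])
  have nz: "x \<noteq> 0" "y \<noteq> 0"
    using xxi yyi by auto
  have R: "Q.R12 (x * y) \<psi> a b m = Rm (x * y) (xi * yi) (\<lambda>a b. \<psi> a b m) a b"
    "Q.R12 (x / y) \<psi> a b m = Rm (x * yi) (xi * y) (\<lambda>a b. \<psi> a b m) a b" for \<psi> a b m
    by (simp_all add: Q.R12_def Rm_def cc_def inv nz field_class.field_divide_inverse mult_ac)
  have K: "K1 KX \<psi> a b m = X1 (\<lambda>a b. \<psi> a b m) a b" "K2 KY \<psi> a b m = Y2 (\<lambda>a b. \<psi> a b m) a b" for \<psi> :: "bool \<Rightarrow> bool \<Rightarrow> nat \<Rightarrow> 'b" and a b m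
    by (simp_all add: K_defs X1_def Y2_def)
  define \<psi> where "\<psi> = (\<lambda>a b. \<phi> a b m)"
  have Rr: "Rm z zi (\<lambda>a b. w a b * c) = (\<lambda>a b. Rm z zi w a b * c)"
    "Rm z zi (\<lambda>a b. w a b + w' a b) = (\<lambda>a b. Rm z zi w a b + Rm z zi w' a b)" for z zi w w' c
    by (auto simp: Rm_def fun_eq_iff algebra_simps)
  have Xr: "X1 (\<lambda>a b. w a b * c) = (\<lambda>a b. X1 w a b * c)" "X1 (\<lambda>a b. w a b + w' a b) = (\<lambda>a b. X1 w a b + X1 w' a b)"
    "Y2 (\<lambda>a b. w a b * c) = (\<lambda>a b. Y2 w a b * c)" "Y2 (\<lambda>a b. w a b + w' a b) = (\<lambda>a b. Y2 w a b + Y2 w' a b)" for w w' c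
    by (auto simp: X1_def Y2_def fun_eq_iff algebra_simps)
  have \<psi>: "\<psi> = (\<lambda>a b. (unit2 False False a b * \<psi> False False + unit2 False True a b * \<psi> False True)
      + (unit2 True False a b * \<psi> True False + unit2 True True a b * \<psi> True True))"
  proof (intro ext)
    show "\<psi> a b = (unit2 False False a b * \<psi> False False + unit2 False True a b * \<psi> False True)
      + (unit2 True False a b * \<psi> True False + unit2 True True a b * \<psi> True True)" for a b
      by (cases a; cases b) (simp_all add: unit2_def)
  qed
  have "Rm (x * yi) (xi * y) (X1 (Rm (x * y) (xi * yi) (Y2 \<psi>))) a b
    = Y2 (Rm (x * y) (xi * yi) (X1 (Rm (x * yi) (xi * y) \<psi>))) a b"
    apply (subst (1 2) \<psi>)
    apply (simp only: Rr Xr RE_unit)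
    done
  then show "Q.R12 (x / y) (K1 KX (Q.R12 (x * y) (K2 KY \<phi>))) a b m
    = K2 KY (Q.R12 (x * y) (K1 KX (Q.R12 (x / y) \<phi>))) a b m"
    unfolding R K \<psi>_def .
qed

end

section \<open>Series built from any elements satisfying the defining relations\<close>

lemma fls_subdegree_Ufun:
  assumes "fls_subdegree x < 0" "q \<noteq> 0" "q + inverse q \<noteq> 0"
  shows "fls_subdegree (Ufun q x) = 2 * fls_subdegree x"
proof -
  define A where "A = fls_const q * x\<^sup>2"
  define B where "B = fls_const (inverse q) * (inverse x)\<^sup>2"
  have x0: "x \<noteq> 0"
    using assms(1) by auto
  have A: "A \<noteq> 0" "fls_subdegree A = 2 * fls_subdegree x"
    using x0 assms(2) by (simp_all add: A_def power2_eq_square)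
  have B: "fls_subdegree B = - 2 * fls_subdegree x"
    using x0 assms(2) by (simp add: B_def power2_eq_square fls_inverse_subdegree)
  have AB: "fls_subdegree (A + B) = 2 * fls_subdegree x"
    using fls_subdegree_add_eq1[OF A(1), of B] A(2) B assms(1) by simp
  then have "A + B \<noteq> 0"
    using assms(1) by auto
  moreover have "Ufun q x = fls_const (inverse (q + inverse q)) * (A + B)"
    unfolding Ufun_def A_def B_def field_class.field_divide_inverse fls_inverse_const by (rule mult.commute)
  ultimately show ?thesis
    using AB assms(3) by simp
qed

text \<open>Works in an arbitrary ring containing elements subject to the relations, so that ring
  arithmetic on types is available; the quotient algebra is supplied at the end.\<close>

locale aq_rep = scalars \<iota> for \<iota> :: "complex \<Rightarrow> 'a::ring_1" +
  fixes q kp km :: complex and Wn Wp Gn Gt :: "nat \<Rightarrow> 'a"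
  assumes q0: "q \<noteq> 0" and qroot: "\<And>n::nat. 0 < n \<Longrightarrow> q ^ n \<noteq> 1" and kp0: "kp \<noteq> 0" and km0: "km \<noteq> 0"
    and W0_Wp: "Wn 0 * Wp k - Wp k * Wn 0 = \<iota> (1 / (q + inverse q)) * (Gt k - Gn k)"
    and Wn_W1: "Wn k * Wp 0 - Wp 0 * Wn k = \<iota> (1 / (q + inverse q)) * (Gt k - Gn k)"
    and W0_G: "\<iota> q * Wn 0 * Gn k - \<iota> (inverse q) * Gn k * Wn 0 = \<iota> (rho q kp km) * (Wn (k + 1) - Wp k)"
    and Gt_W0: "\<iota> q * Gt k * Wn 0 - \<iota> (inverse q) * Wn 0 * Gt k = \<iota> (rho q kp km) * (Wn (k + 1) - Wp k)"
    and G_W1: "\<iota> q * Gn k * Wp 0 - \<iota> (inverse q) * Wp 0 * Gn k = \<iota> (rho q kp km) * (Wp (k + 1) - Wn k)"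
    and W1_Gt: "\<iota> q * Wp 0 * Gt k - \<iota> (inverse q) * Gt k * Wp 0 = \<iota> (rho q kp km) * (Wp (k + 1) - Wn k)"
    and comm_same: "Wn k * Wn l = Wn l * Wn k" "Wp k * Wp l = Wp l * Wp k" "Gn k * Gn l = Gn l * Gn k" "Gt k * Gt l = Gt l * Gt k"
    and comm_WW: "Wn k * Wp l - Wp l * Wn k + (Wp k * Wn l - Wn l * Wp k) = 0"
    and comm_WnG: "Wn k * Gn l - Gn l * Wn k + (Gn k * Wn l - Wn l * Gn k) = 0"
    and comm_WnGt: "Wn k * Gt l - Gt l * Wn k + (Gt k * Wn l - Wn l * Gt k) = 0"
    and comm_WpG: "Wp k * Gn l - Gn l * Wp k + (Gn k * Wp l - Wp l * Gn k) = 0"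
    and comm_WpGt: "Wp k * Gt l - Gt l * Wp k + (Gt k * Wp l - Wp l * Gt k) = 0"
    and comm_GG: "Gt k * Gn l - Gn l * Gt k + (Gn k * Gt l - Gt l * Gn k) = 0"
begin

abbreviation J :: "complex fls \<Rightarrow> 'a fls" where "J \<equiv> fls_map \<iota>"

sublocale ser: scalars J
  by (rule scalars_fls_map)

lemma J_const: "J (fls_const c) = fls_const (\<iota> c)"
  by (rule fls_eqI) (simp add: fls_map_nth)

lemma q_nz: "q + inverse q \<noteq> 0" "q - inverse q \<noteq> 0"
proof -
  show "q + inverse q \<noteq> 0"
  proof
    assume "q + inverse q = 0"
    then have "q * (q + inverse q) = 0"
      by simp
    then have "q ^ 2 = - 1"
      using q0 by (simp add: distrib_left power2_eq_square eq_neg_iff_add_eq_0)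
    then have "(q ^ 2) ^ 2 = 1"
      by simp
    then have "q ^ 4 = 1"
      by (simp flip: power_mult)
    with qroot[of 4] show False
      by simp
  qed
  show "q - inverse q \<noteq> 0"
  proof
    assume "q - inverse q = 0"
    then have "q * (q - inverse q) = 0"
      by simp
    then have "q ^ 2 = 1"
      using q0 by (simp add: right_diff_distrib power2_eq_square)
    with qroot[of 2] show False
      by simp
  qed
qed

lemma s_nz: "fls_const (q + inverse q) \<noteq> 0"
  using q_nz(1) by (rule fls_const_nonzero)

lemma Ufun_scale: "fls_const q * (x * x) + fls_const (inverse q) * (inverse x * inverse x) = (fls_const q + fls_const (inverse q)) * Ufun q x"
proof -
  have "c * (X * inverse c) = X" if "c \<noteq> 0" for c X :: "complex fls"
    using that right_inverse[of c] by (simp add: mult.left_commute[of c])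
  from this[OF s_nz] show ?thesis
    by (simp only: Ufun_def power2_eq_square fls_plus_const field_class.field_divide_inverse)
qed

text \<open>The scaling of the G-generators announced for \<open>two_point\<close>;
  \<open>Gc_rho\<close> and \<open>Gc_k\<close> are the two effects it is chosen for.\<close>

definition Gc :: complex where "Gc = 1 / (kp * km * (q + inverse q))"

definition sW :: "complex fls \<Rightarrow> 'a fls" where "sW x = gser Wn (inverse (Ufun q x))"
definition sV :: "complex fls \<Rightarrow> 'a fls" where "sV x = gser Wp (inverse (Ufun q x))"
definition sG :: "complex fls \<Rightarrow> 'a fls" where "sG x = gser (\<lambda>k. \<iota> Gc * Gn k) (inverse (Ufun q x))"
definition sH :: "complex fls \<Rightarrow> 'a fls" where "sH x = gser (\<lambda>k. \<iota> Gc * Gt k) (inverse (Ufun q x))"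

lemma Gc_left: "b * (\<iota> Gc * c) = \<iota> Gc * (b * c)"
  by (rule i_left_comm)

lemma pos_U: "fls_subdegree x < 0 \<Longrightarrow> 0 < fls_subdegree (inverse (Ufun q x))"
  using fls_subdegree_Ufun[of x q] q0 q_nz by (simp add: fls_inverse_subdegree)

lemma Gc_rho: "Gc * rho q kp km = q + inverse q" and Gc_k: "kp * km * Gc = 1 / (q + inverse q)"
  using q_nz kp0 km0 by (simp_all add: Gc_def rho_def power2_eq_square)

text \<open>Summing the mode relation over k produces the shifted series of \<open>B\<close>;
  \<open>gser_shift\<close> rewrites it as U times the series minus the mode
  \<open>B 0\<close>.\<close>

lemma first_order:
  fixes A B C D :: "nat \<Rightarrow> 'a"
  assumes x: "fls_subdegree x < 0"
    and rel: "\<And>k. \<iota> q * (a * (\<iota> Gc * A k)) - \<iota> (inverse q) * (\<iota> Gc * A k * a) = \<iota> (q + inverse q) * (B (Suc k) - C k)"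
  shows "J (fls_const q) * (fls_const a * gser (\<lambda>k. \<iota> Gc * A k) (inverse (Ufun q x)))
      - J (fls_const (inverse q)) * (gser (\<lambda>k. \<iota> Gc * A k) (inverse (Ufun q x)) * fls_const a)
    = J (fls_const q * (x * x) + fls_const (inverse q) * (inverse x * inverse x)) * gser B (inverse (Ufun q x))
      - J (fls_const q + fls_const (inverse q)) * gser C (inverse (Ufun q x))
      - J (fls_const q + fls_const (inverse q)) * fls_const (B 0)"
proof -
  let ?s = "inverse (Ufun q x)"
  have s: "0 < fls_subdegree ?s"
    by (rule pos_U[OF x])
  then have U: "Ufun q x \<noteq> 0"
    by auto
  have "J (fls_const q) * (fls_const a * gser (\<lambda>k. \<iota> Gc * A k) ?s)
      - J (fls_const (inverse q)) * (gser (\<lambda>k. \<iota> Gc * A k) ?s * fls_const a)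
    = fls_const (\<iota> (q + inverse q)) * (gser (\<lambda>k. B (Suc k)) ?s - gser C ?s)"
    unfolding J_const gser_left gser_right gser_diff rel ..
  also have "fls_const (\<iota> (q + inverse q)) = J (fls_const q + fls_const (inverse q))"
    by (simp only: J_const[symmetric] fls_plus_const)
  also have u: "fls_const q * (x * x) + fls_const (inverse q) * (inverse x * inverse x) = (fls_const q + fls_const (inverse q)) * Ufun q x"
    by (rule Ufun_scale)
  have "J (fls_const q * (x * x) + fls_const (inverse q) * (inverse x * inverse x)) * gser B ?s
    = J (fls_const q + fls_const (inverse q)) * (fls_const (B 0) + gser (\<lambda>k. B (Suc k)) ?s)"
    unfolding u gser_shift[OF s, of B] ser.i_i using U by (simp add: mult.assoc)
  then have "J (fls_const q + fls_const (inverse q)) * (gser (\<lambda>k. B (Suc k)) ?s - gser C ?s)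
    = J (fls_const q * (x * x) + fls_const (inverse q) * (inverse x * inverse x)) * gser B ?s
      - J (fls_const q + fls_const (inverse q)) * gser C ?s - J (fls_const q + fls_const (inverse q)) * fls_const (B 0)"
    by (simp add: algebra_simps)
  finally show ?thesis .
qed

lemma first_order':
  fixes A B C D :: "nat \<Rightarrow> 'a"
  assumes x: "fls_subdegree x < 0"
    and rel: "\<And>k. \<iota> q * (\<iota> Gc * A k * a) - \<iota> (inverse q) * (a * (\<iota> Gc * A k)) = \<iota> (q + inverse q) * (B (Suc k) - C k)"
  shows "J (fls_const q) * (gser (\<lambda>k. \<iota> Gc * A k) (inverse (Ufun q x)) * fls_const a)
      - J (fls_const (inverse q)) * (fls_const a * gser (\<lambda>k. \<iota> Gc * A k) (inverse (Ufun q x)))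
    = J (fls_const q * (x * x) + fls_const (inverse q) * (inverse x * inverse x)) * gser B (inverse (Ufun q x))
      - J (fls_const q + fls_const (inverse q)) * gser C (inverse (Ufun q x))
      - J (fls_const q + fls_const (inverse q)) * fls_const (B 0)"
proof -
  let ?s = "inverse (Ufun q x)"
  have s: "0 < fls_subdegree ?s"
    by (rule pos_U[OF x])
  then have U: "Ufun q x \<noteq> 0"
    by auto
  have "J (fls_const q) * (gser (\<lambda>k. \<iota> Gc * A k) ?s * fls_const a)
      - J (fls_const (inverse q)) * (fls_const a * gser (\<lambda>k. \<iota> Gc * A k) ?s)
    = fls_const (\<iota> (q + inverse q)) * (gser (\<lambda>k. B (Suc k)) ?s - gser C ?s)"
    unfolding J_const gser_left gser_right gser_diff rel ..
  also have "fls_const (\<iota> (q + inverse q)) = J (fls_const q + fls_const (inverse q))"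
    by (simp only: J_const[symmetric] fls_plus_const)
  also have u: "fls_const q * (x * x) + fls_const (inverse q) * (inverse x * inverse x) = (fls_const q + fls_const (inverse q)) * Ufun q x"
    by (rule Ufun_scale)
  have "J (fls_const q * (x * x) + fls_const (inverse q) * (inverse x * inverse x)) * gser B ?s
    = J (fls_const q + fls_const (inverse q)) * (fls_const (B 0) + gser (\<lambda>k. B (Suc k)) ?s)"
    unfolding u gser_shift[OF s, of B] ser.i_i using U by (simp add: mult.assoc)
  then have "J (fls_const q + fls_const (inverse q)) * (gser (\<lambda>k. B (Suc k)) ?s - gser C ?s)
    = J (fls_const q * (x * x) + fls_const (inverse q) * (inverse x * inverse x)) * gser B ?s
      - J (fls_const q + fls_const (inverse q)) * gser C ?s - J (fls_const q + fls_const (inverse q)) * fls_const (B 0)"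
    by (simp add: algebra_simps)
  finally show ?thesis .
qed

lemma mode_rel:
  assumes "\<iota> q * b * c - \<iota> (inverse q) * d * e = \<iota> (rho q kp km) * z"
  shows "\<iota> q * (\<iota> Gc * (b * c)) - \<iota> (inverse q) * (\<iota> Gc * (d * e)) = \<iota> (q + inverse q) * z"
proof -
  have "\<iota> q * (\<iota> Gc * (b * c)) - \<iota> (inverse q) * (\<iota> Gc * (d * e)) = \<iota> Gc * (\<iota> q * b * c - \<iota> (inverse q) * d * e)"
    by (simp add: right_diff_distrib mult.assoc i_left_comm[of "\<iota> Gc"])
  then show ?thesis
    unfolding assms by (simp only: i_i Gc_rho)
qed

lemma w0_sG: "fls_subdegree x < 0 \<Longrightarrow>
    J (fls_const q) * (fls_const (Wn 0) * sG x) - J (fls_const (inverse q)) * (sG x * fls_const (Wn 0))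
    = J (fls_const q * (x * x) + fls_const (inverse q) * (inverse x * inverse x)) * sW x
      - J (fls_const q + fls_const (inverse q)) * sV x - J (fls_const q + fls_const (inverse q)) * fls_const (Wn 0)"
  unfolding sG_def sW_def sV_def
  by (rule first_order) (use mode_rel[OF W0_G] in \<open>simp_all add: Gc_left[of "Wn _"] Gc_left[of "Wp _"] mult.assoc\<close>)

lemma w1_sH: "fls_subdegree x < 0 \<Longrightarrow>
    J (fls_const q) * (fls_const (Wp 0) * sH x) - J (fls_const (inverse q)) * (sH x * fls_const (Wp 0))
    = J (fls_const q * (x * x) + fls_const (inverse q) * (inverse x * inverse x)) * sV x
      - J (fls_const q + fls_const (inverse q)) * sW x - J (fls_const q + fls_const (inverse q)) * fls_const (Wp 0)"
  unfolding sH_def sW_def sV_def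
  by (rule first_order) (use mode_rel[OF W1_Gt] in \<open>simp_all add: Gc_left[of "Wn _"] Gc_left[of "Wp _"] mult.assoc\<close>)

lemma sH_w0: "fls_subdegree x < 0 \<Longrightarrow>
    J (fls_const q) * (sH x * fls_const (Wn 0)) - J (fls_const (inverse q)) * (fls_const (Wn 0) * sH x)
    = J (fls_const q * (x * x) + fls_const (inverse q) * (inverse x * inverse x)) * sW x
      - J (fls_const q + fls_const (inverse q)) * sV x - J (fls_const q + fls_const (inverse q)) * fls_const (Wn 0)"
  unfolding sH_def sW_def sV_def
  by (rule first_order') (use mode_rel[OF Gt_W0] in \<open>simp_all add: Gc_left[of "Wn _"] Gc_left[of "Wp _"] mult.assoc\<close>)

lemma sG_w1: "fls_subdegree x < 0 \<Longrightarrow>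
    J (fls_const q) * (sG x * fls_const (Wp 0)) - J (fls_const (inverse q)) * (fls_const (Wp 0) * sG x)
    = J (fls_const q * (x * x) + fls_const (inverse q) * (inverse x * inverse x)) * sV x
      - J (fls_const q + fls_const (inverse q)) * sW x - J (fls_const q + fls_const (inverse q)) * fls_const (Wp 0)"
  unfolding sG_def sW_def sV_def
  by (rule first_order') (use mode_rel[OF G_W1] in \<open>simp_all add: Gc_left[of "Wn _"] Gc_left[of "Wp _"] mult.assoc\<close>)

lemma sH_sG: "J (fls_const kp * fls_const km) * (sH x - sG x) = gser (\<lambda>k. \<iota> (1 / (q + inverse q)) * (Gt k - Gn k)) (inverse (Ufun q x))"
  unfolding fls_const_mult_const J_const sH_def sG_def gser_diff gser_left Gc_k[symmetric]
  by (simp add: i_mult algebra_simps)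

lemma w0_sV: "fls_const (Wn 0) * sV x = sV x * fls_const (Wn 0) + J (fls_const kp * fls_const km) * (sH x - sG x)"
  unfolding sH_sG W0_Wp[symmetric] gser_diff[symmetric] gser_left[symmetric] gser_right[symmetric] sV_def by simp

lemma w1_sW: "fls_const (Wp 0) * sW x = sW x * fls_const (Wp 0) - J (fls_const kp * fls_const km) * (sH x - sG x)"
  unfolding sH_sG Wn_W1[symmetric] gser_diff[symmetric] gser_left[symmetric] gser_right[symmetric] sW_def by simp

lemma Gc_comm: "b * (\<iota> Gc * c) - \<iota> Gc * c * b + (\<iota> Gc * d * e - e * (\<iota> Gc * d)) = \<iota> Gc * (b * c - c * b + (d * e - e * d))"
  by (simp add: Gc_left[of b] Gc_left[of e] algebra_simps)

lemma two_point_RE: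
  assumes x: "fls_subdegree x < 0" and y: "fls_subdegree y < 0"
  shows "two_point_RE J (fls_const q) (fls_const (inverse q)) (fls_const kp) (fls_const km)
    x (inverse x) y (inverse y) (fls_const (Wn 0)) (fls_const (Wp 0)) (sW x) (sV x) (sG x) (sH x) (sW y) (sV y) (sG y) (sH y)"
proof
  note px = pos_U[OF x] and py = pos_U[OF y]
  show "fls_const q * fls_const (inverse q) = 1" "fls_const q + fls_const (inverse q) \<noteq> 0" "x * inverse x = 1" "y * inverse y = 1"
    using s_nz q0 x y by (auto simp: fls_plus_const fls_const_mult_const intro!: right_inverse)
  have W0V0: "fls_const (Wn 0) * sW z = sW z * fls_const (Wn 0)" "fls_const (Wp 0) * sV z = sV z * fls_const (Wp 0)" for z
    unfolding sW_def sV_def gser_left gser_right by (simp_all add: comm_same(1,2)[of 0])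
  show "fls_const (Wn 0) * sW x = sW x * fls_const (Wn 0)" "fls_const (Wp 0) * sV x = sV x * fls_const (Wp 0)"
    by (fact W0V0)+
  show "sW y * sW x = sW x * sW y" "sV y * sV x = sV x * sV y" "sG y * sG x = sG x * sG y" "sH y * sH x = sH x * sH y"
    unfolding sW_def sV_def sG_def sH_def using comm_same
    by (auto intro!: gser_commute px py simp: Gc_left[of "Gn _"] Gc_left[of "Gt _"] mult.assoc)
  show "sW x * sV y - sV y * sW x + (sV x * sW y - sW y * sV x) = 0"
    unfolding sW_def sV_def by (rule gser_commutator_sum[OF px py comm_WW])
  show "sW x * sG y - sG y * sW x + (sG x * sW y - sW y * sG x) = 0"
    unfolding sW_def sG_def by (rule gser_commutator_sum[OF px py]) (simp only: Gc_comm comm_WnG mult_zero_right)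
  show "sW x * sH y - sH y * sW x + (sH x * sW y - sW y * sH x) = 0"
    unfolding sW_def sH_def by (rule gser_commutator_sum[OF px py]) (simp only: Gc_comm comm_WnGt mult_zero_right)
  show "sV x * sG y - sG y * sV x + (sG x * sV y - sV y * sG x) = 0"
    unfolding sV_def sG_def by (rule gser_commutator_sum[OF px py]) (simp only: Gc_comm comm_WpG mult_zero_right)
  show "sV x * sH y - sH y * sV x + (sH x * sV y - sV y * sH x) = 0"
    unfolding sV_def sH_def by (rule gser_commutator_sum[OF px py]) (simp only: Gc_comm comm_WpGt mult_zero_right)
  show "sG x * sH y - sH y * sG x + (sH x * sG y - sG y * sH x) = 0"
    unfolding sG_def sH_def
  proof (rule gser_commutator_sum[OF px py])
    fix k l
    have "Gn k * Gt l - Gt l * Gn k + (Gt k * Gn l - Gn l * Gt k) = 0"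
      using comm_GG[of k l] by (simp add: algebra_simps)
    then have "\<iota> Gc * (\<iota> Gc * (Gn k * Gt l - Gt l * Gn k + (Gt k * Gn l - Gn l * Gt k))) = 0"
      by simp
    then show "\<iota> Gc * Gn k * (\<iota> Gc * Gt l) - \<iota> Gc * Gt l * (\<iota> Gc * Gn k) + (\<iota> Gc * Gt k * (\<iota> Gc * Gn l) - \<iota> Gc * Gn l * (\<iota> Gc * Gt k)) = 0"
      by (simp add: mult.assoc Gc_left[of "Gn _"] Gc_left[of "Gt _"] distrib_left right_diff_distrib)
  qed
  show "fls_const (Wn 0) * sW y = sW y * fls_const (Wn 0)" "fls_const (Wp 0) * sV y = sV y * fls_const (Wp 0)"
    by (fact W0V0)+
qed (intro w0_sV w1_sW w0_sG sH_w0 sG_w1 w1_sH x y)+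

end

section \<open>Numerical K-matrices\<close>

definition Nmat :: "'k::field \<Rightarrow> 'k \<Rightarrow> 'k \<Rightarrow> 'k \<Rightarrow> 'k \<Rightarrow> bool \<Rightarrow> bool \<Rightarrow> 'k" where
  "Nmat ep em kp km x a b = (if a then (if b then x * em + inverse x * ep else km * cc (x\<^sup>2))
     else (if b then kp * cc (x\<^sup>2) else x * ep + inverse x * em))"

lemma Nmat_RE:
  fixes q x y :: "'k::field"
  assumes q0: "q \<noteq> 0" and x0: "x \<noteq> 0" and y0: "y \<noteq> 0"
  shows "qscalars.R12 id q (x / y) (scalars.K1 (Nmat ep em kp km x) (qscalars.R12 id q (x * y) (scalars.K2 (Nmat ep em kp km y) \<phi>)))
    = scalars.K2 (Nmat ep em kp km y) (qscalars.R12 id q (x * y) (scalars.K1 (Nmat ep em kp km x) (qscalars.R12 id q (x / y) \<phi>)))"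
proof (intro ext)
  fix a b m
  interpret qscalars "id :: 'k \<Rightarrow> 'k" q
    by unfold_locales (simp_all add: q0)
  define xi yi qi where "xi = inverse x" and "yi = inverse y" and "qi = inverse q"
  have r: "q * qi = 1" "\<And>w. q * (qi * w) = w" "x * xi = 1" "\<And>w. x * (xi * w) = w" "y * yi = 1" "\<And>w. y * (yi * w) = w"
    "inverse xi = x" "inverse yi = y" "inverse qi = q"
    using q0 x0 y0 by (simp_all add: xi_def yi_def qi_def)
  show "R12 (x / y) (K1 (Nmat ep em kp km x) (R12 (x * y) (K2 (Nmat ep em kp km y) \<phi>))) a b m
    = K2 (Nmat ep em kp km y) (R12 (x * y) (K1 (Nmat ep em kp km x) (R12 (x / y) \<phi>))) a b m"
    by (cases a; cases b;
      simp add: R12_def K_defs Nmat_def cc_def field_class.field_divide_inverse power2_eq_square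
        xi_def[symmetric] yi_def[symmetric] qi_def[symmetric] r;
      simp add: algebra_simps r)
qed

text \<open>A zero of \<open>cc\<close> satisfies z = 1/z, but z and 1/z have opposite
  orders.\<close>

lemma cc_nonzero:
  assumes "fls_subdegree (z :: complex fls) \<noteq> 0"
  shows "cc z \<noteq> 0"
proof
  assume "cc z = 0"
  then have "inverse z = z"
    by (simp add: cc_def)
  then have "- fls_subdegree z = fls_subdegree z"
    using fls_inverse_subdegree[of z] by simp
  with assms show False
    by simp
qed

lemma subdegree_scale: "c \<noteq> 0 \<Longrightarrow> fls_subdegree (x * fls_const c) = fls_subdegree (x :: complex fls)"
  by (cases "x = 0") auto

lemma cc_const: "cc (fls_const c) = fls_const (c - inverse c)"
  by (simp add: cc_def fls_minus_const fls_inverse_const)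

locale root_free =
  fixes q :: complex
  assumes q0: "q \<noteq> 0" and qroot: "\<And>n::nat. 0 < n \<Longrightarrow> q ^ n \<noteq> 1"
begin

lemma cc_qn: "0 < n \<Longrightarrow> cc (fls_const q ^ n) \<noteq> 0"
proof -
  assume n: "0 < n"
  have "q ^ n - inverse (q ^ n) \<noteq> 0"
  proof
    assume "q ^ n - inverse (q ^ n) = 0"
    then have "q ^ n * (q ^ n - inverse (q ^ n)) = 0"
      by simp
    then have "q ^ (n + n) = 1"
      using q0 by (simp add: right_diff_distrib power_add)
    with qroot[of "n + n"] n show False
      by simp
  qed
  then show ?thesis
    unfolding fls_const_power[symmetric] cc_const by (rule fls_const_nonzero)
qed

lemma subdegree_cc:
  assumes "fls_subdegree x * e < 0" "fls_subdegree y * e < 0"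
  shows "cc (x * y * fls_const q ^ n) \<noteq> 0"
proof (rule cc_nonzero)
  have "x \<noteq> 0" "y \<noteq> 0"
    using assms by auto
  then have "fls_subdegree (x * y * fls_const q ^ n) = fls_subdegree x + fls_subdegree y"
    using q0 unfolding fls_const_power[symmetric] by (simp add: subdegree_scale)
  moreover have "(fls_subdegree x + fls_subdegree y) * e < 0"
    using assms by (simp add: distrib_right)
  ultimately show "fls_subdegree (x * y * fls_const q ^ n) \<noteq> 0"
    by auto
qed

definition knum :: "complex \<Rightarrow> complex \<Rightarrow> complex \<Rightarrow> complex \<Rightarrow> complex fls \<Rightarrow> bool \<Rightarrow> bool \<Rightarrow> complex fls" where
  "knum ep em kp km = Nmat (fls_const ep) (fls_const em) (fls_const (kp / (q - inverse q))) (fls_const (km / (q - inverse q)))"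

text \<open>Since the variable of the series is u^-1, \<open>Gplus\<close> contains u and
  \<open>Gminus\<close> contains u^-1. Within either set the product of two members keeps the sign
  of its order, so \<open>cc\<close> of it is nonzero.\<close>

abbreviation Gminus :: "complex fls set" where "Gminus \<equiv> {x. 0 < fls_subdegree x}"
abbreviation Gplus :: "complex fls set" where "Gplus \<equiv> {x. fls_subdegree x < 0}"

lemma fusion_knum: "fusion id (fls_const q) (knum ep em kp km) Gminus"
proof
  fix x y :: "complex fls" and n and \<phi> :: "bool \<Rightarrow> bool \<Rightarrow> nat \<Rightarrow> complex fls"
  assume x: "x \<in> Gminus"
  then show x0: "x \<noteq> 0"
    by auto
  show "x * fls_const q \<in> Gminus"
    using x q0 by (simp add: subdegree_scale)
  assume y: "y \<in> Gminus"
  then have y0: "y \<noteq> 0"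
    by auto
  show "cc (x * y * fls_const q ^ n) \<noteq> 0"
    using x y by (intro subdegree_cc[of x "-1"]) auto
  show "qscalars.R12 id (fls_const q) (x / y) (scalars.K1 (knum ep em kp km x) (qscalars.R12 id (fls_const q) (x * y) (scalars.K2 (knum ep em kp km y) \<phi>)))
    = scalars.K2 (knum ep em kp km y) (qscalars.R12 id (fls_const q) (x * y) (scalars.K1 (knum ep em kp km x) (qscalars.R12 id (fls_const q) (x / y) \<phi>)))"
    unfolding knum_def by (rule Nmat_RE[OF fls_const_nonzero[OF q0] x0 y0])
next
  show "cc (fls_const q) \<noteq> 0"
    using cc_qn[of 1] by simp
qed (use q0 in simp_all)

lemma knum_transpose: "(\<lambda>x a b. knum ep em kp km x b a) = knum ep em km kp"
  by (auto simp: knum_def Nmat_def fun_eq_iff)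

lemma numeric_fusion_knum: "numeric_fusion (fls_const q) (knum ep em kp km) Gminus"
proof -
  interpret fusion id "fls_const q" "knum ep em kp km" Gminus
    by (rule fusion_knum)
  interpret tr: fusion id "fls_const q" "\<lambda>x a b. knum ep em kp km x b a" Gminus
    unfolding knum_transpose by (rule fusion_knum)
  show ?thesis
    by unfold_locales (rule cc_qn)
qed

end

text \<open>A functional linear over the scalars commutes with R and with scalar K-matrices, so the
  reflection equation over the field passes to vectors with entries in the ring.\<close>

lemma (in scalars) fusion_lift:
  assumes "fusion (id :: 'k \<Rightarrow> 'k) q N G"
  shows "fusion \<iota> q (\<lambda>x a b. \<iota> (N x a b)) G"
proof -
  interpret N: fusion "id :: 'k \<Rightarrow> 'k" q N G
    by (rule assms)
  interpret Q: qscalars \<iota> q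
    by unfold_locales (rule N.q0)
  show ?thesis
  proof
    fix x y n and \<phi> :: "bool \<Rightarrow> bool \<Rightarrow> nat \<Rightarrow> 'b"
    show "x \<in> G \<Longrightarrow> x \<noteq> 0" "x \<in> G \<Longrightarrow> x * q \<in> G" "cc q \<noteq> 0"
      "x \<in> G \<Longrightarrow> y \<in> G \<Longrightarrow> cc (x * y * q ^ n) \<noteq> 0"
      by (fact N.G0 N.Gq N.q2 N.Gcc2)+
    assume xy: "x \<in> G" "y \<in> G"
    show "Q.R12 (x / y) (K1 (\<lambda>a b. \<iota> (N x a b)) (Q.R12 (x * y) (K2 (\<lambda>a b. \<iota> (N y a b)) \<phi>)))
      = K2 (\<lambda>a b. \<iota> (N y a b)) (Q.R12 (x * y) (K1 (\<lambda>a b. \<iota> (N x a b)) (Q.R12 (x / y) \<phi>)))"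
    proof (intro ext, rule functional_ext)
      fix a b m and f :: "'b \<Rightarrow> 'k"
      assume f: "\<And>x y. f (x + y) = f x + f y" "\<And>x y. f (x - y) = f x - f y" "\<And>x. f (- x) = - f x"
        "f 0 = 0" "\<And>k x. f (\<iota> k * x) = k * f x"
      have R: "f (Q.R12 z \<psi> a b m) = N.R12 z (\<lambda>a b m. f (\<psi> a b m)) a b m" for z \<psi> a b m
        by (simp add: Q.R12_def N.R12_def f)
      have K: "f (K1 (\<lambda>a b. \<iota> (M a b)) \<psi> a b m) = N.K1 M (\<lambda>a b m. f (\<psi> a b m)) a b m"
        "f (K2 (\<lambda>a b. \<iota> (M a b)) \<psi> a b m) = N.K2 M (\<lambda>a b m. f (\<psi> a b m)) a b m"
        for M :: "bool \<Rightarrow> bool \<Rightarrow> 'k" and \<psi> :: "bool \<Rightarrow> bool \<Rightarrow> nat \<Rightarrow> 'b" and a b m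
        by (simp_all add: K_defs N.K_defs f)
      show "f (Q.R12 (x / y) (K1 (\<lambda>a b. \<iota> (N x a b)) (Q.R12 (x * y) (K2 (\<lambda>a b. \<iota> (N y a b)) \<phi>))) a b m)
        = f (K2 (\<lambda>a b. \<iota> (N y a b)) (Q.R12 (x * y) (K1 (\<lambda>a b. \<iota> (N x a b)) (Q.R12 (x / y) \<phi>))) a b m)"
        unfolding R K N.RE[OF xy] ..
    qed
  qed
qed

context aq_rep
begin

sublocale root_free q
  by unfold_locales (fact q0 qroot)+

definition Kser :: "complex fls \<Rightarrow> bool \<Rightarrow> bool \<Rightarrow> 'a fls" where
  "Kser x a b = (if a
     then (if b then J (x * fls_const q) * sV x - J (inverse x * fls_const (inverse q)) * sW x
       else fls_const (\<iota> (1 / (kp * (q + inverse q)))) * gser Gt (inverse (Ufun q x)) + fls_const (\<iota> (km * (q + inverse q) / (q - inverse q))))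
     else (if b then fls_const (\<iota> (1 / (km * (q + inverse q)))) * gser Gn (inverse (Ufun q x)) + fls_const (\<iota> (kp * (q + inverse q) / (q - inverse q)))
       else J (x * fls_const q) * sW x - J (inverse x * fls_const (inverse q)) * sV x))"

lemma KX_Kser:
  assumes "two_point_RE J (fls_const q) (fls_const (inverse q)) (fls_const kp) (fls_const km) x (inverse x) y (inverse y)
     w0 w1 (sW x) (sV x) (sG x) (sH x) Wp' Wm' Gp' Gm'"
  shows "two_point_RE.KX J (fls_const q) (fls_const (inverse q)) (fls_const kp) (fls_const km) x (inverse x) (sW x) (sV x) (sG x) (sH x)
    = (\<lambda>a b. J (fls_const (q - inverse q)) * Kser x a b)"
proof (intro ext)
  fix a b
  have e: "kp * (q - inverse q) * Gc = (q - inverse q) * (1 / (km * (q + inverse q)))"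
    "km * (q - inverse q) * Gc = (q - inverse q) * (1 / (kp * (q + inverse q)))"
    using kp0 km0 by (simp_all add: Gc_def)
  have G: "J (fls_const kp * fls_const (q - inverse q)) * sG x
    = J (fls_const (q - inverse q)) * (fls_const (\<iota> (1 / (km * (q + inverse q)))) * gser Gn (inverse (Ufun q x)))"
    unfolding sG_def gser_left[symmetric] J_const[symmetric] ser.i_i fls_const_mult_const
    by (simp only: e)
  have H: "J (fls_const km * fls_const (q - inverse q)) * sH x
    = J (fls_const (q - inverse q)) * (fls_const (\<iota> (1 / (kp * (q + inverse q)))) * gser Gt (inverse (Ufun q x)))"
    unfolding sH_def gser_left[symmetric] J_const[symmetric] ser.i_i fls_const_mult_const
    by (simp only: e)
  have C: "J (fls_const kp * (fls_const q + fls_const (inverse q))) = J (fls_const (q - inverse q)) * fls_const (\<iota> (kp * (q + inverse q) / (q - inverse q)))"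
    "J (fls_const km * (fls_const q + fls_const (inverse q))) = J (fls_const (q - inverse q)) * fls_const (\<iota> (km * (q + inverse q) / (q - inverse q)))"
    using q_nz by (simp_all add: J_const[symmetric] ser.i_mult[symmetric] fls_plus_const)
  show "two_point_RE.KX J (fls_const q) (fls_const (inverse q)) (fls_const kp) (fls_const km) x (inverse x) (sW x) (sV x) (sG x) (sH x) a b
    = J (fls_const (q - inverse q)) * Kser x a b"
    unfolding two_point_RE.KX_def[OF assms] Kser_def fls_minus_const G H C
    by (cases a; cases b) (simp_all only: if_True if_False distrib_left right_diff_distrib ser.i_i mult_ac)
qed

lemma KY_Kser:
  fixes x y :: "complex fls"
  assumes "fls_subdegree x < 0" "fls_subdegree y < 0"
  shows "two_point_RE.KY J (fls_const q) (fls_const (inverse q)) (fls_const kp) (fls_const km) y (inverse y) (sW y) (sV y) (sG y) (sH y)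
    = (\<lambda>a b. J (fls_const (q - inverse q)) * Kser y a b)"
  using KX_Kser[OF two_point_RE[OF assms(2) assms(1)]]
  unfolding two_point_RE.KX_def[OF two_point_RE[OF assms(2) assms(1)]] two_point_RE.KY_def[OF two_point_RE[OF assms]]
    fun_eq_iff .

lemma fusion_Kser: "fusion J (fls_const q) Kser Gplus"
proof
  fix x y :: "complex fls" and n and \<phi> :: "bool \<Rightarrow> bool \<Rightarrow> nat \<Rightarrow> 'a fls"
  assume x: "x \<in> Gplus"
  then show x0: "x \<noteq> 0"
    by auto
  show "x * fls_const q \<in> Gplus"
    using x q0 by (simp add: subdegree_scale)
  assume y: "y \<in> Gplus"
  show "cc (x * y * fls_const q ^ n) \<noteq> 0"
    using x y by (intro subdegree_cc[of x 1]) auto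
  interpret Q: qscalars J "fls_const q"
    by unfold_locales (rule fls_const_nonzero[OF q0])
  interpret two_point_RE J "fls_const q" "fls_const (inverse q)" "fls_const kp" "fls_const km"
    x "inverse x" y "inverse y" "fls_const (Wn 0)" "fls_const (Wp 0)" "sW x" "sV x" "sG x" "sH x" "sW y" "sV y" "sG y" "sH y"
    using x y by (intro two_point_RE) auto
  let ?d = "fls_const (q - inverse q)"
  have KX: "KX = (\<lambda>a b. J ?d * Kser x a b)"
    by (rule KX_Kser) unfold_locales
  have KY: "KY = (\<lambda>a b. J ?d * Kser y a b)"
    using x y by (intro KY_Kser) auto
  have K: "ser.K1 (\<lambda>a b. J ?d * M a b) \<psi> = (\<lambda>a b m. J ?d * ser.K1 M \<psi> a b m)"
    "ser.K2 (\<lambda>a b. J ?d * M a b) \<psi> = (\<lambda>a b m. J ?d * ser.K2 M \<psi> a b m)"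
    "ser.K1 M (\<lambda>a b m. J ?d * \<psi> a b m) = (\<lambda>a b m. J ?d * ser.K1 M \<psi> a b m)"
    "ser.K2 M (\<lambda>a b m. J ?d * \<psi> a b m) = (\<lambda>a b m. J ?d * ser.K2 M \<psi> a b m)" for M and \<psi> :: "bool \<Rightarrow> bool \<Rightarrow> nat \<Rightarrow> 'a fls"
    by (simp_all only: ser.K_defs fun_eq_iff simp_thms mult.assoc distrib_left ser.i_left_comm[of "M _ _"])
  have "Q.R12 (x / y) (ser.K1 KX (Q.R12 (x * y) (ser.K2 KY \<phi>)))
    = ser.K2 KY (Q.R12 (x * y) (ser.K1 KX (Q.R12 (x / y) \<phi>)))"
    by (rule KX_RE) (simp add: q0, unfold_locales)
  \<comment> \<open>\<open>KX\<close> and \<open>KY\<close> each contribute the central factor q -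
    1/q; both are pulled out here and cancelled below.\<close>
  then have "J ?d * (J ?d * Q.R12 (x / y) (ser.K1 (Kser x) (Q.R12 (x * y) (ser.K2 (Kser y) \<phi>))) a b m)
    = J ?d * (J ?d * ser.K2 (Kser y) (Q.R12 (x * y) (ser.K1 (Kser x) (Q.R12 (x / y) \<phi>))) a b m)" for a b m
    unfolding KX KY K Q.op_scale by (simp only: fun_eq_iff)
  then show "Q.R12 (x / y) (ser.K1 (Kser x) (Q.R12 (x * y) (ser.K2 (Kser y) \<phi>)))
    = ser.K2 (Kser y) (Q.R12 (x * y) (ser.K1 (Kser x) (Q.R12 (x / y) \<phi>)))"
    using q_nz(2) by (intro ext) (metis ser.i_cancel fls_const_nonzero)
next
  show "cc (fls_const q) \<noteq> 0"
    using cc_qn[of 1] by simp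
qed (use q0 in simp_all)

sublocale op: fusion J "fls_const q" Kser Gplus
  by (rule fusion_Kser)

end

section \<open>Commutation of the transfer series\<close>

context scalars
begin

lemma gser_nth_below:
  assumes s: "0 < fls_subdegree s" and n: "n < fls_subdegree s"
  shows "fls_nth (gser a s) n = 0"
proof -
  have "fls_nth (s ^ (k + 1)) n = 0" for k
  proof -
    have "1 * fls_subdegree s \<le> int (k + 1) * fls_subdegree s"
      using s by (intro mult_right_mono) simp_all
    then have "n < fls_subdegree (s ^ (k + 1))"
      using n unfolding fls_subdegree_pow by simp
    then show ?thesis
      by simp
  qed
  then show ?thesis
    by (simp only: gser_nth) simp
qed

text \<open>Dividing by s, f commutes with a_0 plus a remainder of the order of s or higher. For s
  of large order the remainder cannot reach a given coefficient, so f commutes with a_0; then a_0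
  cancels and the series of the shifted modes satisfies the same hypothesis.\<close>

lemma commute_first_mode:
  assumes "\<And>M. \<exists>s. M < fls_subdegree s \<and> 0 < fls_subdegree s \<and> f * gser a s = gser a s * f"
  shows "f * fls_const (a 0) = fls_const (a 0) * f"
    and "\<exists>s. M < fls_subdegree s \<and> 0 < fls_subdegree s \<and> f * gser (\<lambda>k. a (Suc k)) s = gser (\<lambda>k. a (Suc k)) s * f"
proof -
  interpret ser: scalars "fls_map \<iota>"
    by (rule scalars_fls_map)
  let ?c = "fls_const (a 0)" and ?g = "gser (\<lambda>k. a (Suc k))"
  have sum: "f * (?c + ?g s) = (?c + ?g s) * f"
    if s: "0 < fls_subdegree s" and comm: "f * gser a s = gser a s * f" for s
  proof (rule ser.i_cancel)
    show "s \<noteq> 0"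
      using s by auto
    show "fls_map \<iota> s * (f * (?c + ?g s)) = fls_map \<iota> s * ((?c + ?g s) * f)"
      using comm unfolding gser_shift[OF s, of a] by (simp only: ser.i_left_comm[of f] mult.assoc)
  qed
  show c: "f * ?c = ?c * f"
  proof (rule fls_eqI)
    fix n
    \<comment> \<open>The order of s is taken so large that the products of f with the remainder
      start beyond the coefficient n.\<close>
    obtain s where s: "n - fls_subdegree f < fls_subdegree s" "0 < fls_subdegree s" "f * gser a s = gser a s * f"
      using assms by blast
    have low: "i < fls_subdegree s \<Longrightarrow> fls_nth (?g s) i = 0" "i < fls_subdegree f \<Longrightarrow> fls_nth f i = 0" for i
      using gser_nth_below[OF s(2)] by simp_all
    have "fls_nth (f * ?g s) n = (\<Sum>i=fls_subdegree f..n - fls_subdegree s. fls_nth f i * fls_nth (?g s) (n - i))"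
      by (rule fls_times_nth_bounds[OF low(2,1)])
    also have "\<dots> = 0"
      using s(1) by (intro sum.neutral) auto
    finally have "fls_nth (f * ?g s) n = 0" .
    moreover have "fls_nth (?g s * f) n = (\<Sum>i=fls_subdegree s..n - fls_subdegree f. fls_nth (?g s) i * fls_nth f (n - i))"
      by (rule fls_times_nth_bounds[OF low(1,2)])
    then have "fls_nth (?g s * f) n = 0"
      using s(1) by (simp add: sum.neutral)
    moreover have "fls_nth (f * ?c) n + fls_nth (f * ?g s) n = fls_nth (?c * f) n + fls_nth (?g s * f) n"
      using sum[OF s(2,3)] by (simp only: distrib_left distrib_right fls_plus_nth[symmetric])
    ultimately show "fls_nth (f * ?c) n = fls_nth (?c * f) n"
      by simp
  qed
  show "\<exists>s. M < fls_subdegree s \<and> 0 < fls_subdegree s \<and> f * ?g s = ?g s * f"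
  proof -
    obtain s where s: "M < fls_subdegree s" "0 < fls_subdegree s" "f * gser a s = gser a s * f"
      using assms by blast
    then have "f * ?g s = ?g s * f"
      using sum[OF s(2,3)] c by (simp only: distrib_left distrib_right add_left_cancel)
    with s show ?thesis
      by blast
  qed
qed

lemma commute_modes:
  assumes "\<And>M. \<exists>s. M < fls_subdegree s \<and> 0 < fls_subdegree s \<and> f * gser a s = gser a s * f"
  shows "f * fls_const (a k) = fls_const (a k) * f"
  using assms
proof (induction k arbitrary: a)
  case 0
  then show ?case
    by (rule commute_first_mode(1))
next
  case (Suc k)
  show ?case
    by (rule Suc.IH) (rule commute_first_mode(2)[OF Suc.prems])
qed

definition commutant :: "'b set \<Rightarrow> 'b set" where
  "commutant X = {a. \<forall>b\<in>X. a * b = b * a}"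

definition coefs :: "'b set \<Rightarrow> 'b fls \<Rightarrow> bool" where
  "coefs X f \<longleftrightarrow> (\<forall>n. fls_nth f n \<in> commutant X)"

lemma commutant_closed:
  "0 \<in> commutant X" "a \<in> commutant X \<Longrightarrow> b \<in> commutant X \<Longrightarrow> a + b \<in> commutant X"
  "a \<in> commutant X \<Longrightarrow> b \<in> commutant X \<Longrightarrow> a - b \<in> commutant X"
  "a \<in> commutant X \<Longrightarrow> b \<in> commutant X \<Longrightarrow> a * b \<in> commutant X"
  "\<iota> k \<in> commutant X"
proof -
  show "a \<in> commutant X \<Longrightarrow> b \<in> commutant X \<Longrightarrow> a * b \<in> commutant X"
    unfolding commutant_def by (auto simp: mult.assoc) (metis mult.assoc)
qed (auto simp: commutant_def algebra_simps i_central)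

lemma commutant_sum: "(\<And>i. i \<in> A \<Longrightarrow> g i \<in> commutant X) \<Longrightarrow> sum g A \<in> commutant X"
  by (induction A rule: infinite_finite_induct) (auto intro: commutant_closed)

lemma coefs_closed:
  "coefs X 0" "coefs X f \<Longrightarrow> coefs X g \<Longrightarrow> coefs X (f + g)" "coefs X f \<Longrightarrow> coefs X g \<Longrightarrow> coefs X (f - g)"
  "coefs X f \<Longrightarrow> coefs X g \<Longrightarrow> coefs X (f * g)" "coefs X (fls_map \<iota> k)" "b \<in> commutant X \<Longrightarrow> coefs X (fls_const b)"
  by (auto simp: coefs_def fls_map_nth fls_times_nth(2) intro!: commutant_closed commutant_sum)

lemma coefs_gser: "(\<And>k. a k \<in> commutant X) \<Longrightarrow> coefs X (gser a s)"
  by (auto simp: coefs_def gser_nth intro!: commutant_closed commutant_sum simp del: power_Suc)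

lemma coefs_commute: "(\<And>b. b \<in> X \<Longrightarrow> f * fls_const b = fls_const b * f) \<Longrightarrow> coefs X f"
  unfolding coefs_def commutant_def
proof (intro allI CollectI ballI)
  fix n b
  assume "\<And>b. b \<in> X \<Longrightarrow> f * fls_const b = fls_const b * f" "b \<in> X"
  then have "fls_nth (f * fls_const b) n = fls_nth (fls_const b * f) n"
    by simp
  then show "fls_nth f n * b = b * fls_nth f n"
    by simp
qed

end

context aq_rep
begin

text \<open>Commutation is assumed only for parameters of very negative order, because
  \<open>gam_commute\<close> excludes some values. These parameters already separate the
  modes.\<close>

lemma Kser_commute_modes:
  assumes comm: "\<And>v a b. \<lbrakk>v \<in> Gplus; fls_subdegree v < M\<rbrakk> \<Longrightarrow> f * Kser v a b = Kser v a b * f"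
  shows "f * fls_const (Wn k) = fls_const (Wn k) * f" "f * fls_const (Wp k) = fls_const (Wp k) * f"
    "f * fls_const (Gn k) = fls_const (Gn k) * f" "f * fls_const (Gt k) = fls_const (Gt k) * f"
proof -
  have series: "f * sW v = sW v * f" "f * sV v = sV v * f"
    "f * gser Gn (inverse (Ufun q v)) = gser Gn (inverse (Ufun q v)) * f"
    "f * gser Gt (inverse (Ufun q v)) = gser Gt (inverse (Ufun q v)) * f"
    if v: "v \<in> Gplus" "fls_subdegree v < M" for v
  proof -
    let ?p = "v * fls_const q" and ?m = "inverse v * fls_const (inverse q)"
    have pm: "inverse ?p = ?m"
      by (simp add: fls_inverse_const)
    have d: "?p * ?p - ?m * ?m \<noteq> 0"
      using op.Gcc[OF op.Gq[OF v(1)], of 0]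
      unfolding power_0 mult_1_right cc_def power2_eq_square inverse_mult_distrib[of ?p ?p] pm .
    have F: "Kser v False False = J ?p * sW v - J ?m * sV v" and T: "Kser v True True = J ?p * sV v - J ?m * sW v"
      by (simp_all add: Kser_def)
    \<comment> \<open>The two diagonal entries form a linear system for the two W-series with
      determinant p^2 - p^-2, where p = vq; it is nonzero on the parameter domain.\<close>
    have W: "J (?p * ?p - ?m * ?m) * sW v = J ?p * Kser v False False + J ?m * Kser v True True"
      and V: "J (?p * ?p - ?m * ?m) * sV v = J ?m * Kser v False False + J ?p * Kser v True True"
      unfolding F T right_diff_distrib ser.i_i ser.i_diff left_diff_distrib mult.commute[of ?m ?p] by simp_all
    have comb: "f * (J k * Kser v a b + J l * Kser v a' b') = (J k * Kser v a b + J l * Kser v a' b') * f" for k l a b a' b'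
      by (simp only: distrib_left distrib_right ser.i_left_comm[of f] mult.assoc comm[OF v])
    have cancel': "f * g = g * f" if "e \<noteq> 0" "f * (J e * g) = J e * g * f" for e g
      using that(2) unfolding ser.i_left_comm[of f] mult.assoc by (rule ser.i_cancel[OF that(1)])
    note cancel = cancel'[OF d]
    show "f * sW v = sW v * f" "f * sV v = sV v * f"
      by (rule cancel, unfold W V, rule comb)+
    have off: "f * g = g * f" if "r \<noteq> 0" and "f * (fls_const (\<iota> r) * g + fls_const (\<iota> r')) = (fls_const (\<iota> r) * g + fls_const (\<iota> r')) * f" for r r' g
    proof (rule ser.i_cancel)
      show "fls_const r \<noteq> 0"
        using that(1) by (rule fls_const_nonzero)
      show "J (fls_const r) * (f * g) = J (fls_const r) * (g * f)"
        using that(2) unfolding J_const[symmetric]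
        by (simp only: distrib_left distrib_right ser.i_left_comm[of f] ser.i_central[of "fls_const r'" f] add_right_cancel mult.assoc)
    qed
    show "f * gser Gn (inverse (Ufun q v)) = gser Gn (inverse (Ufun q v)) * f"
      by (rule off[of "1 / (km * (q + inverse q))" _ "kp * (q + inverse q) / (q - inverse q)"])
        (use comm[OF v, of False True] km0 q_nz in \<open>simp_all add: Kser_def\<close>)
    show "f * gser Gt (inverse (Ufun q v)) = gser Gt (inverse (Ufun q v)) * f"
      by (rule off[of "1 / (kp * (q + inverse q))" _ "km * (q + inverse q) / (q - inverse q)"])
        (use comm[OF v, of True False] kp0 q_nz in \<open>simp_all add: Kser_def\<close>)
  qed
  have ex: "\<exists>v. v \<in> Gplus \<and> fls_subdegree v < M \<and> N < fls_subdegree (inverse (Ufun q v)) \<and> 0 < fls_subdegree (inverse (Ufun q v))" for N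
  proof -
    define n where "n = nat (\<bar>M\<bar> + \<bar>N\<bar> + 1)"
    \<comment> \<open>A power u^n with n beyond the prescribed bounds; the inverse of U then has
      order 2n.\<close>
    define v :: "complex fls" where "v = fls_X_inv ^ n"
    have v: "fls_subdegree v = - int n"
      unfolding v_def by (simp add: fls_subdegree_pow)
    have "v \<in> Gplus" "fls_subdegree v < M"
      by (auto simp: v n_def)
    moreover have "fls_subdegree (inverse (Ufun q v)) = 2 * int n"
      using fls_subdegree_Ufun[of v q] q0 q_nz v by (simp add: n_def fls_inverse_subdegree)
    ultimately show ?thesis
      by (intro exI[of _ v]) (auto simp: n_def)
  qed
  show "f * fls_const (Wn k) = fls_const (Wn k) * f"
    by (rule commute_modes) (use ex series(1)[unfolded sW_def] in meson)
  show "f * fls_const (Wp k) = fls_const (Wp k) * f"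
    by (rule commute_modes) (use ex series(2)[unfolded sV_def] in meson)
  show "f * fls_const (Gn k) = fls_const (Gn k) * f"
    by (rule commute_modes) (use ex series(3) in meson)
  show "f * fls_const (Gt k) = fls_const (Gt k) * f"
    by (rule commute_modes) (use ex series(4) in meson)
qed

text \<open>If v has lower order than x, then v/x has nonzero order, and the scalars to be cancelled
  in \<open>gam_commute\<close> are nonzero.\<close>

lemma gam_modes:
  assumes x: "x \<in> Gplus"
  shows "op.gam x * fls_const (Wn k) = fls_const (Wn k) * op.gam x" "op.gam x * fls_const (Wp k) = fls_const (Wp k) * op.gam x"
    "op.gam x * fls_const (Gn k) = fls_const (Gn k) * op.gam x" "op.gam x * fls_const (Gt k) = fls_const (Gt k) * op.gam x"
proof -
  have "op.gam x * Kser v a b = Kser v a b * op.gam x" if v: "v \<in> Gplus" "fls_subdegree v < fls_subdegree x" for v a b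
  proof (rule op.gam_commute[symmetric, OF v(1) x])
    have x0: "x \<noteq> 0" "v \<noteq> 0"
      using x v(1) by auto
    have "v / (x * fls_const q) = (v * inverse x) * fls_const (inverse q)" "v * fls_const q / x = (v * inverse x) * fls_const q"
      by (simp_all add: field_class.field_divide_inverse fls_inverse_const mult_ac)
    moreover have "fls_subdegree (v * inverse x) \<noteq> 0"
      using x0 v by (simp add: fls_inverse_subdegree)
    ultimately show "cc (v / (x * fls_const q)) \<noteq> 0" "cc (v * fls_const q / x) \<noteq> 0"
      using q0 by (simp_all only: subdegree_scale cc_nonzero inverse_nonzero_iff_nonzero not_False_eq_True)
  qed
  from Kser_commute_modes[OF this] show "op.gam x * fls_const (Wn k) = fls_const (Wn k) * op.gam x" "op.gam x * fls_const (Wp k) = fls_const (Wp k) * op.gam x"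
    "op.gam x * fls_const (Gn k) = fls_const (Gn k) * op.gam x" "op.gam x * fls_const (Gt k) = fls_const (Gt k) * op.gam x"
    by blast+
qed

lemma coefs_Kser:
  assumes "\<And>k. Wn k \<in> commutant X" "\<And>k. Wp k \<in> commutant X" "\<And>k. Gn k \<in> commutant X" "\<And>k. Gt k \<in> commutant X"
  shows "coefs X (Kser x a b)"
  using assms unfolding Kser_def sW_def sV_def
  by (simp add: coefs_closed commutant_closed coefs_gser)

lemma coefs_gam:
  assumes "\<And>x a b. coefs X (Kser x a b)"
  shows "coefs X (op.gam x)"
proof -
  have asym: "coefs X (asym a b m)" for a b m
    using coefs_closed(5)[of X 1] coefs_closed(3)[OF coefs_closed(1), OF coefs_closed(5)[of X 1]] coefs_closed(1)
    by (simp add: asym_def)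
  show ?thesis
    unfolding op.gam_def ser.K_defs op.R12_def by (simp add: coefs_closed assms asym)
qed

end

section \<open>The commuting family and the transfer series\<close>

locale aq_transfer = aq_rep \<iota> q kp km Wn Wp Gn Gt
  for \<iota> :: "complex \<Rightarrow> 'a::ring_1" and q kp km Wn Wp Gn Gt +
  fixes ebp ebm kbp kbm :: complex
begin

text \<open>The transposed spin-1/2 dual matrix as a function of its inverted argument. The order of
  the last two constants results from the exchange in the dual substitution followed by the exchange
  due to transposition.\<close>

definition Nser :: "complex fls \<Rightarrow> bool \<Rightarrow> bool \<Rightarrow> 'a fls" where
  "Nser x a b = J (knum ebm ebp (- kbp) (- kbm) x a b)"

sublocale pair: fusion_pair J "fls_const q" Kser Gplus Nser Gminus
proof -
  have "fusion J (fls_const q) Nser Gminus"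
    using ser.fusion_lift[OF fusion_knum] unfolding Nser_def[abs_def] .
  then interpret nu: fusion J "fls_const q" Nser Gminus .
  show "fusion_pair J (fls_const q) Kser Gplus Nser Gminus"
    by unfold_locales (auto simp: fls_inverse_subdegree Nser_def ser.i_central)
qed

text \<open>The combination of generators that appears in the spin-1/2 transfer series; its
  coefficients are those found in \<open>coefs_tau_1\<close>.\<close>

definition Imode :: "nat \<Rightarrow> 'a" where
  "Imode k = \<iota> ebp * Wn k + \<iota> ebm * Wp k + \<iota> (kbp / ((q - inverse q) * (kp * (q + inverse q)))) * Gt k
     + \<iota> (kbm / ((q - inverse q) * (km * (q + inverse q)))) * Gn k"

text \<open>The commutator is a quadratic form in the four coefficients, and the factor of each
  square or mixed product is a defining relation between modes k and l.\<close>

lemma Imode_commute: "Imode k * Imode l = Imode l * Imode k"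
proof -
  define c d where "c = kbp / ((q - inverse q) * (kp * (q + inverse q)))" and "d = kbm / ((q - inverse q) * (km * (q + inverse q)))"
  note lc = i_left_comm[of "Wn _"] i_left_comm[of "Wp _"] i_left_comm[of "Gn _"] i_left_comm[of "Gt _"]
  have "Imode k * Imode l - Imode l * Imode k
    = \<iota> (ebp * ebp) * (Wn k * Wn l - Wn l * Wn k) + \<iota> (ebm * ebm) * (Wp k * Wp l - Wp l * Wp k)
      + \<iota> (c * c) * (Gt k * Gt l - Gt l * Gt k) + \<iota> (d * d) * (Gn k * Gn l - Gn l * Gn k)
      + \<iota> (ebp * ebm) * (Wn k * Wp l - Wp l * Wn k + (Wp k * Wn l - Wn l * Wp k))
      + \<iota> (ebp * d) * (Wn k * Gn l - Gn l * Wn k + (Gn k * Wn l - Wn l * Gn k))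
      + \<iota> (ebp * c) * (Wn k * Gt l - Gt l * Wn k + (Gt k * Wn l - Wn l * Gt k))
      + \<iota> (ebm * d) * (Wp k * Gn l - Gn l * Wp k + (Gn k * Wp l - Wp l * Gn k))
      + \<iota> (ebm * c) * (Wp k * Gt l - Gt l * Wp k + (Gt k * Wp l - Wp l * Gt k))
      + \<iota> (c * d) * (Gt k * Gn l - Gn l * Gt k + (Gn k * Gt l - Gt l * Gn k))"
    unfolding Imode_def c_def[symmetric] d_def[symmetric]
    by (simp add: algebra_simps lc i_i)
  also have "\<dots> = 0"
    by (simp only: comm_same[of k l] diff_self comm_WW comm_WnG comm_WnGt comm_WpG comm_WpGt comm_GG mult_zero_right add_0)
  finally show ?thesis
    by simp
qed

text \<open>The transfer coefficients will lie in the double commutant of this set, which is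
  commutative because the set itself is.\<close>

definition genset :: "'a set" where
  "genset = range Imode \<union> {fls_nth (op.gam x) n |x n. x \<in> Gplus}"

text \<open>With p = xq and m = 1/p, the terms in the products of diagonal entries that mix p and m
  cancel and leave the common factor c = p^2 - m^2. The off-diagonal entries have the same factor:
  \<open>cc\<close> of m^2 is -c, and the sign cancels that of the dual constants.\<close>

lemma coefs_tau_1:
  assumes x: "x \<in> Gplus" and I: "\<And>k. Imode k \<in> commutant X"
  shows "coefs X (pair.tau 1 x)"
proof -
  define Q Qi where "Q = fls_const q" and "Qi = fls_const (inverse q)"
  define p m where "p = x * Q" and "m = inverse x * Qi"
  define c where "c = p * p - m * m"
  define e f where "e = fls_const ebp" and "f = fls_const ebm"
  define a b where "a = kbp / (q - inverse q)" and "b = kbm / (q - inverse q)"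
  define s where "s = inverse (Ufun q x)"
  define \<alpha> \<beta> where "\<alpha> = kp * (q + inverse q) / (q - inverse q)" and "\<beta> = km * (q + inverse q) / (q - inverse q)"
  have mp: "inverse p = m" "inverse m = p"
    by (simp_all add: p_def m_def Q_def Qi_def fls_inverse_const)
  have xq: "inverse (x * fls_const q) = m"
    using mp(1) by (simp only: p_def Q_def)
  have cm: "cc (m\<^sup>2) = - c"
    unfolding cc_def power2_eq_square inverse_mult_distrib mp c_def by simp
  have neg: "fls_const (- z) = - fls_const z" for z :: complex
    by (rule fls_eqI) simp
  have N: "Nser m False False = J (m * f + p * e)" "Nser m True True = J (m * e + p * f)"
    "Nser m False True = J (c * fls_const a)" "Nser m True False = J (c * fls_const b)"
    by (simp_all add: Nser_def knum_def Nmat_def mp cm e_def f_def a_def b_def minus_divide_left[symmetric] neg mult.commute)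
  have K: "Kser x False False = J p * sW x - J m * sV x" "Kser x True True = J p * sV x - J m * sW x"
    "Kser x True False = J (fls_const (1 / (kp * (q + inverse q)))) * gser Gt s + J (fls_const \<beta>)"
    "Kser x False True = J (fls_const (1 / (km * (q + inverse q)))) * gser Gn s + J (fls_const \<alpha>)"
    by (simp_all add: Kser_def p_def m_def Q_def Qi_def s_def J_const \<alpha>_def \<beta>_def)
  have diag: "J (m * f + p * e) * (J p * sW x - J m * sV x) + J (m * e + p * f) * (J p * sV x - J m * sW x)
    = J c * (J e * sW x + J f * sV x)"
  proof -
    have "J (m * f + p * e) * (J p * sW x - J m * sV x) + J (m * e + p * f) * (J p * sV x - J m * sW x)
      = J ((m * f + p * e) * p - (m * e + p * f) * m) * sW x + J ((m * e + p * f) * p - (m * f + p * e) * m) * sV x"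
      by (simp only: right_diff_distrib ser.i_i ser.i_diff left_diff_distrib) (simp add: algebra_simps)
    also have "(m * f + p * e) * p - (m * e + p * f) * m = c * e"
      by (simp add: c_def algebra_simps)
    also have "(m * e + p * f) * p - (m * f + p * e) * m = c * f"
      by (simp add: c_def algebra_simps)
    finally show ?thesis
      by (simp only: distrib_left ser.i_i)
  qed
  have "pair.tau 1 x = J c * (J e * sW x + J f * sV x)
    + (J (c * fls_const a) * (J (fls_const (1 / (kp * (q + inverse q)))) * gser Gt s + J (fls_const \<beta>))
      + J (c * fls_const b) * (J (fls_const (1 / (km * (q + inverse q)))) * gser Gn s + J (fls_const \<alpha>)))"
    unfolding pair.tau_1[OF x] UNIV_bool xq diag[symmetric] by (simp add: N K add_ac)
  also have "\<dots> = J c * (J e * sW x + J f * sV x + J (fls_const (a * (1 / (kp * (q + inverse q))))) * gser Gt s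
      + J (fls_const (b * (1 / (km * (q + inverse q))))) * gser Gn s) + J (c * fls_const a * fls_const \<beta> + c * fls_const b * fls_const \<alpha>)"
    unfolding fls_const_mult_const[symmetric] ser.i_mult ser.i_add by (simp only: distrib_left mult.assoc add_ac)
  also have "J e * sW x + J f * sV x + J (fls_const (a * (1 / (kp * (q + inverse q))))) * gser Gt s
      + J (fls_const (b * (1 / (km * (q + inverse q))))) * gser Gn s = gser Imode s"
    unfolding e_def f_def J_const sW_def sV_def s_def gser_left gser_add Imode_def[abs_def] a_def b_def
    by (simp add: add_ac)
  also have "coefs X (J c * gser Imode s + J (c * fls_const a * fls_const \<beta> + c * fls_const b * fls_const \<alpha>))"
    by (intro coefs_closed coefs_gser I)
  finally show ?thesis .
qed

text \<open>Coefficients of the determinant commute with all generators, hence with the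
  \<open>Imode\<close> and with each other, since the determinant is itself built from generators
  and scalars.\<close>

lemma genset_commute:
  assumes "b \<in> genset" "c \<in> genset"
  shows "b * c = c * b"
proof -
  have modes: "fls_nth (op.gam x) n * a = a * fls_nth (op.gam x) n"
    if "x \<in> Gplus" "a \<in> range Wn \<union> range Wp \<union> range Gn \<union> range Gt" for x n a
  proof -
    have "op.gam x * fls_const a = fls_const a * op.gam x"
      using that(2) gam_modes[OF that(1)] by auto
    then have "fls_nth (op.gam x * fls_const a) n = fls_nth (fls_const a * op.gam x) n"
      by simp
    then show ?thesis
      by simp
  qed
  have gen: "Wn k \<in> commutant {fls_nth (op.gam x) n}" "Wp k \<in> commutant {fls_nth (op.gam x) n}"
    "Gn k \<in> commutant {fls_nth (op.gam x) n}" "Gt k \<in> commutant {fls_nth (op.gam x) n}" if "x \<in> Gplus" for x n k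
    using modes[OF that] by (auto simp: commutant_def)
  have gI: "fls_nth (op.gam x) n * Imode k = Imode k * fls_nth (op.gam x) n" if "x \<in> Gplus" for x n k
  proof -
    have "Imode k \<in> commutant {fls_nth (op.gam x) n}"
      unfolding Imode_def by (intro commutant_closed gen that)
    then show ?thesis
      by (simp add: commutant_def)
  qed
  have gg: "fls_nth (op.gam x) n * fls_nth (op.gam y) m = fls_nth (op.gam y) m * fls_nth (op.gam x) n" if "x \<in> Gplus" for x y n m
  proof -
    have "coefs {fls_nth (op.gam x) n} (op.gam y)"
      by (intro coefs_gam coefs_Kser gen that)
    then show ?thesis
      by (auto simp: coefs_def commutant_def)
  qed
  show ?thesis
    using assms unfolding genset_def by (auto simp: Imode_commute gI gg)
qed

text \<open>In \<open>TT\<close> the trace of highest spin has coefficient 1, so it is expressed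
  without division through the determinants, the spin-1/2 trace and lower traces, all with
  coefficients in the double commutant.\<close>

lemma coefs_tau:
  "x \<in> Gplus \<Longrightarrow> coefs (commutant genset) (pair.tau d x)"
proof (induction d arbitrary: x rule: induct_nat_012)
  case 0
  then show ?case
    using coefs_closed(5)[of _ 1] by (simp add: pair.tau_0)
next
  case 1
  have "Imode k \<in> commutant (commutant genset)" for k
    by (auto simp: commutant_def genset_def)
  then show ?case
    using coefs_tau_1[OF 1] by simp
next
  case (ge2 d)
  let ?X = "commutant genset"
  have x: "x * fls_const q \<in> Gplus" "x * fls_const q * fls_const q \<in> Gplus"
    using op.Gq[OF ge2.prems] op.Gq by blast+
  have gam: "coefs ?X (op.gam x)"
  proof -
    have "fls_nth (op.gam x) n \<in> genset" for n
      using ge2.prems unfolding genset_def by blast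
    then show ?thesis
      by (auto simp: coefs_def commutant_def)
  qed
  have nu: "coefs ?X (pair.nu.gam y)" for y
    by (rule coefs_commute) (rule pair.nu_gam_central)
  have "Imode k \<in> commutant ?X" for k
    by (auto simp: commutant_def genset_def)
  then have 1: "coefs ?X (pair.tau 1 x)"
    by (rule coefs_tau_1[OF ge2.prems])
  have "pair.tau (Suc (Suc d)) x = J (pair.fuse_scalar (Suc d) x) * (pair.tau 1 x * pair.tau (Suc d) (x * fls_const q))
    - pair.quot_scalar d x * op.gam x * pair.tau d (x * fls_const q * fls_const q)"
    using pair.TT[OF ge2.prems, of d] by simp
  also have "coefs ?X \<dots>"
    unfolding pair.quot_scalar_def by (intro coefs_closed ge2.IH x gam nu 1)
  finally show ?case .
qed

end

section \<open>Fusion in matrix form\<close>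

definition mv :: "'a::semiring_0 mat \<Rightarrow> (nat \<Rightarrow> 'a) \<Rightarrow> nat \<Rightarrow> 'a" where
  "mv M f i = (\<Sum>k<dim_col M. M $$ (i, k) * f k)"

lemma mv_mult:
  assumes "i < dim_row A" "dim_col A = dim_row B"
  shows "mv (A * B) f i = mv A (mv B f) i"
proof -
  have "mv (A * B) f i = (\<Sum>k<dim_col B. (\<Sum>j<dim_row B. A $$ (i, j) * B $$ (j, k)) * f k)"
    unfolding mv_def by (rule sum.cong) (use assms in \<open>simp_all add: scalar_prod_def atLeast0LessThan\<close>)
  also have "\<dots> = (\<Sum>j<dim_row B. A $$ (i, j) * (\<Sum>k<dim_col B. B $$ (j, k) * f k))"
    by (simp add: sum_distrib_right sum_distrib_left mult.assoc) (rule sum.swap)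
  finally show ?thesis
    using assms by (simp add: mv_def)
qed

lemma mv_cong: "(\<And>k. k < dim_col M \<Longrightarrow> f k = g k) \<Longrightarrow> mv M f i = mv M g i"
  by (simp add: mv_def)

lemma sum_double: "(\<Sum>i<2 * d. g i) = (\<Sum>m<d. g m) + (\<Sum>m<d. g (d + m :: nat))" for g :: "nat \<Rightarrow> 'a::comm_monoid_add"
proof -
  have "(\<Sum>i<2 * d. g i) = (\<Sum>i\<in>{..<d} \<union> {d..<d + d}. g i)"
    by (rule sum.cong) auto
  also have "\<dots> = (\<Sum>m<d. g m) + (\<Sum>i\<in>{d..<d + d}. g i)"
    by (rule sum.union_disjoint) auto
  also have "(\<Sum>i\<in>{d..<d + d}. g i) = (\<Sum>m<d. g (d + m))"
    by (rule sum.reindex_bij_witness[of _ "\<lambda>m. d + m" "\<lambda>i. i - d"]) auto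
  finally show ?thesis .
qed

definition split2 :: "nat \<Rightarrow> (nat \<Rightarrow> 'a) \<Rightarrow> bool \<Rightarrow> nat \<Rightarrow> 'a" where
  "split2 d f a m = f (of_bool a * d + m)"

lemma mv_kron_left:
  fixes f :: "nat \<Rightarrow> 'a::semiring_1"
  assumes "dim_row M = 2" "dim_col M = 2" "m < d"
  shows "split2 d (mv (kron M (1\<^sub>m d)) f) a m
    = M $$ (of_bool a, 0) * split2 d f False m + M $$ (of_bool a, 1) * split2 d f True m"
proof -
  have m2: "m < 2 * d" "d + m < 2 * d"
    using assms(3) by linarith+
  have "mv (kron M (1\<^sub>m d)) f (of_bool a * d + m) = (\<Sum>i<2 * d. kron M (1\<^sub>m d) $$ (of_bool a * d + m, i) * f i)"
    by (simp add: mv_def kron_def assms)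
  also have "\<dots> = (\<Sum>n<d. (if n = m then M $$ (of_bool a, 0) * f n else 0)) + (\<Sum>n<d. (if n = m then M $$ (of_bool a, 1) * f (d + n) else 0))"
    unfolding sum_double
    by (intro arg_cong2[of _ _ _ _ "(+)"] sum.cong) (use assms(3) in \<open>auto simp: kron_def assms m2\<close>)
  finally show ?thesis
    using assms(3) by (simp add: split2_def)
qed

lemma mv_kron_right:
  fixes f :: "nat \<Rightarrow> 'a::semiring_1"
  assumes "dim_row C = d" "dim_col C = d" "m < d"
  shows "split2 d (mv (kron (1\<^sub>m 2) C) f) a m = mv C (split2 d f a) m"
proof -
  have m2: "m < 2 * d" "d + m < 2 * d"
    using assms(3) by linarith+
  have "mv (kron (1\<^sub>m 2) C) f (of_bool a * d + m) = (\<Sum>i<2 * d. kron (1\<^sub>m 2) C $$ (of_bool a * d + m, i) * f i)"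
    by (simp add: mv_def kron_def assms)
  also have "\<dots> = (\<Sum>n<d. (if a then 0 else C $$ (m, n) * f n)) + (\<Sum>n<d. (if a then C $$ (m, n) * f (d + n) else 0))"
    unfolding sum_double
    by (intro arg_cong2[of _ _ _ _ "(+)"] sum.cong) (use assms(3) in \<open>auto simp: kron_def assms m2\<close>)
  finally show ?thesis
    by (simp add: split2_def mv_def assms)
qed

section \<open>Removing the square roots from the fusion maps\<close>

locale q_root =
  fixes q qh :: complex
  assumes q0: "q \<noteq> 0" and qroot: "\<And>n::nat. 0 < n \<Longrightarrow> q ^ n \<noteq> 1" and qh: "qh\<^sup>2 = q"
begin

lemma qh0: "qh \<noteq> 0"
  using qh q0 by auto

lemma cc_q: "0 < n \<Longrightarrow> q ^ n - inverse (q ^ n) \<noteq> 0"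
proof
  assume n: "0 < n" and "q ^ n - inverse (q ^ n) = 0"
  then have "q ^ n * (q ^ n - inverse (q ^ n)) = 0"
    by simp
  then have "q ^ (n + n) = 1"
    using q0 by (simp add: right_diff_distrib power_add)
  with qroot[of "n + n"] n show False
    by simp
qed

lemma q_diff: "q - inverse q \<noteq> 0"
  using cc_q[of 1] by simp

lemma qnum_nat: "qnum q (int n) = (q ^ n - inverse (q ^ n)) / (q - inverse q)"
  by (simp add: qnum_def power_int_minus)

lemma qnum_nz: "0 < n \<Longrightarrow> qnum q (int n) \<noteq> 0"
  unfolding qnum_nat using cc_q[of n] q_diff by simp

definition Bc :: "nat \<Rightarrow> nat \<Rightarrow> complex" where
  "Bc d p = Bcoef q (int d) (int d - 2 * int p)"

text \<open>The identity through which square roots disappear: products of the rescaled entries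
  contain \<open>Bc\<close> only in such pairs.\<close>

lemma Bc_sq: "p < d \<Longrightarrow> Bc d p * Bc d p = qnum q (int (d - p)) * qnum q (int (Suc p))"
proof -
  assume p: "p < d"
  have "(int d + (int d - 2 * int p)) div 2 = int (d - p)" "(int d - (int d - 2 * int p)) div 2 + 1 = int (Suc p)"
    using p by simp_all
  then show ?thesis
    using power2_csqrt[of "qnum q (int (d - p)) * qnum q (int (Suc p))"]
    by (simp only: Bc_def Bcoef_def power2_eq_square)
qed

lemma Bc_nz: "p < d \<Longrightarrow> Bc d p \<noteq> 0"
  using Bc_sq[of p d] qnum_nz[of "d - p"] qnum_nz[of "Suc p"] by auto

text \<open>The diagonal rescaling between the spin basis and the basis of \<open>cop\<close>. Its
  square is the q-binomial weight (\<open>wt_sc\<close>).\<close>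

definition sc :: "nat \<Rightarrow> nat \<Rightarrow> complex" where
  "sc d m = (\<Prod>p<m. Bc d p / qnum q (int (Suc p)))"

lemma sc_nz: "m \<le> d \<Longrightarrow> sc d m \<noteq> 0"
  using Bc_nz qnum_nz by (auto simp: sc_def simp del: of_nat_Suc)

lemma sc_Suc: "sc d (Suc m) * qnum q (int (Suc m)) = sc d m * Bc d m"
  using qnum_nz[of "Suc m"] by (simp add: sc_def)

lemma sc_up: "m < d \<Longrightarrow> sc d m * qnum q (int (d - m)) = sc d (Suc m) * Bc d m"
proof -
  assume m: "m < d"
  have "sc d (Suc m) * Bc d m * qnum q (int (Suc m)) = sc d (Suc m) * qnum q (int (Suc m)) * Bc d m"
    by (simp only: mult_ac)
  also have "\<dots> = sc d m * (Bc d m * Bc d m)"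
    by (simp only: sc_Suc mult.assoc)
  also have "\<dots> = sc d m * qnum q (int (d - m)) * qnum q (int (Suc m))"
    by (simp only: Bc_sq[OF m] mult.assoc)
  finally show ?thesis
    using qnum_nz[of "Suc m"] by simp
qed

definition e_coef :: "nat \<Rightarrow> bool \<Rightarrow> nat \<Rightarrow> complex" where
  "e_coef d a m = sc (d - 1) m / sc d (of_bool a + m)"

lemma E_diag_sc: "m < d \<Longrightarrow> E_diag q d (Suc m) = sc (d - 1) m / sc d m"
proof -
  assume m: "m < d"
  have "E_diag q d (Suc m) = (\<Prod>p<m. Bc (d - 1) p / Bc d p)"
    using m by (simp add: E_diag_def Bc_def of_nat_diff algebra_simps)
  also have "\<dots> = (\<Prod>p<m. (Bc (d - 1) p / qnum q (int (Suc p))) / (Bc d p / qnum q (int (Suc p))))"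
    using qnum_nz by (intro prod.cong) (simp_all del: of_nat_Suc)
  finally show ?thesis
    by (simp only: sc_def prod_dividef)
qed

lemma fus_E_entry:
  assumes m: "m < d" and n: "n \<le> d"
  shows "fus_E q d $$ (of_bool a * d + m, n) = (if n = of_bool a + m then e_coef d a m else 0)"
proof (cases a)
  case False
  then show ?thesis
    using m n E_diag_sc[OF m] by (auto simp: fus_E_def mat1_def E_entry_def e_coef_def)
next
  case True
  have "fus_E q d $$ (d + m, n) = E_entry q d (d + m + 1) (n + 1)"
    using m n by (simp add: fus_E_def mat1_def)
  also have "\<dots> = (if n = Suc m then e_coef d True m else 0)"
  proof (cases "n = Suc m")
    case True
    have c: "(d + m + 1 = n + 1 \<and> n + 1 \<le> d) = False" "(2 \<le> n + 1 \<and> d + m + 1 = d + (n + 1 - 1)) = True"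
      "n + 1 - 1 = Suc m" "int d + 2 - 2 * int (Suc m) = int d - 2 * int m"
      using True m by auto
    have "E_entry q d (d + m + 1) (n + 1) = qnum q (int (Suc m)) * (sc (d - 1) m / sc d m) / Bc d m"
      unfolding E_entry_def c(1,2) if_True if_False Let_def unfolding c(3,4) E_diag_sc[OF m] Bc_def ..
    also have "\<dots> = e_coef d True m"
      using Bc_nz[OF m] sc_nz[of m d] sc_nz[of "Suc m" d] qnum_nz[of "Suc m"] sc_Suc[of d m] m
      by (simp add: e_coef_def divide_simps) (simp add: mult_ac)
    finally show ?thesis
      using True by simp
  next
    case False
    have "\<not> (d + m + 1 = n + 1 \<and> n + 1 \<le> d)" "\<not> (2 \<le> n + 1 \<and> d + m + 1 = d + (n + 1 - 1))"
      using False m by linarith+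
    with False show ?thesis
      by (simp only: E_entry_def if_False)
  qed
  finally show ?thesis
    using True by simp
qed

lemma e_coef_nz: "m < d \<Longrightarrow> e_coef d a m \<noteq> 0"
  using sc_nz[of m "d - 1"] sc_nz[of "of_bool a + m" d] by (cases a) (auto simp: e_coef_def)

text \<open>Row n of F is supported where column n of E is, at no more than two places, and its
  diagonal entry is defined so that the products add up to 1. As F is only applied to vectors in the
  image of E, this left-inverse property is what \<open>F_mv\<close> uses.\<close>

lemma F_row:
  assumes n: "n \<le> d" and d: "0 < d"
  shows "\<exists>r s. (\<forall>i<2 * d. fus_F q d $$ (n, i) = (if i = n \<and> n < d then r else 0) + (if 0 < n \<and> i = d + (n - 1) then s else 0))
    \<and> (if n < d then r * e_coef d False n else 0) + (if 0 < n then s * e_coef d True (n - 1) else 0) = 1"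
proof -
  have E: "E_entry q d (m + 1) (m + 1) = e_coef d False m" "E_entry q d (d + m + 1) (Suc m + 1) = e_coef d True m" if "m < d" for m
    using fus_E_entry[of m d m False] fus_E_entry[of m d "Suc m" True] that by (simp_all add: fus_E_def mat1_def)
  have F: "fus_F q d $$ (n, i) = F_entry q d (n + 1) (i + 1)" if "i < 2 * d" for i
    using n that by (simp add: fus_F_def mat1_def)
  consider "n = 0" | "0 < n" "n < d" | "n = d"
    using n by linarith
  then show ?thesis
  proof cases
    case 1
    have "sc (d - 1) 0 = 1" "sc d 0 = 1"
      by (simp_all add: sc_def)
    then show ?thesis
      using 1 d F by (intro exI[of _ 1] exI[of _ 0]) (auto simp: F_entry_def e_coef_def)
  next
    case 2
    then obtain l where l: "n = Suc l"
      by (cases n) auto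
    have E2: "E_entry q d (n + 1 + d - 1) (n + 1) = e_coef d True l" "E_entry q d (n + 1) (n + 1) = e_coef d False n"
      using E(2)[of l] E(1)[of n] 2 l by (simp_all add: add.commute)
    show ?thesis
      using 2 F l e_coef_nz[of n d False]
      by (intro exI[of _ "(1 - F_off q d (n + 1) * e_coef d True l) / e_coef d False n"] exI[of _ "F_off q d (n + 1)"])
        (auto simp: F_entry_def E2[simplified l, simplified] E2 split: if_splits)
  next
    case 3
    have E2: "E_entry q d (2 * d) (d + 1) = e_coef d True (d - 1)"
      using E(2)[of "d - 1"] d by (simp add: mult_2)
    have "fus_F q d $$ (n, i) = (if i = d + (n - 1) then inverse (e_coef d True (d - 1)) else 0)" if i: "i < 2 * d" for i
    proof -
      have c: "(n + 1 = 1 \<and> i + 1 = 1) = False" "(2 \<le> n + 1 \<and> n + 1 \<le> d \<and> i + 1 = n + 1 + d - 1) = False"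
        "(2 \<le> n + 1 \<and> n + 1 \<le> d \<and> i + 1 = n + 1) = False" "(n + 1 = d + 1 \<and> i + 1 = 2 * d) = (i = d + (n - 1))"
        using 3 d by auto
      show ?thesis
        unfolding F[OF i] F_entry_def c if_False E2 ..
    qed
    then show ?thesis
      using 3 d e_coef_nz[of "d - 1" d True]
      by (intro exI[of _ 0] exI[of _ "inverse (e_coef d True (d - 1))"]) simp
  qed
qed

end

lemma kron_entry:
  fixes A B :: "'b::times mat"
  assumes "dim_row A = 2" "dim_col A = 2" "dim_row B = e" "dim_col B = e" "m < e" "n < e"
  shows "kron A B $$ (of_bool a * e + m, of_bool b * e + n) = A $$ (of_bool a, of_bool b) * B $$ (m, n)"
proof -
  have "m < 2 * e" "n < 2 * e" "e + m < 2 * e" "e + n < 2 * e"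
    using assms(5,6) by linarith+
  then show ?thesis
    using assms(5,6) by (cases a; cases b) (simp_all add: kron_def assms(1-4))
qed

context q_root
begin

lemma qh_powi_even: "qh powi (e + 2 * int n) = qh powi e * q ^ n"
proof -
  have "qh powi (2 * int n) = (qh ^ 2) ^ n"
    by (metis of_nat_mult of_nat_numeral power_int_of_nat power_mult)
  then show ?thesis
    using qh0 by (simp add: power_int_add qh)
qed

lemma cfun_shift:
  assumes "e = e' + 2 * int n"
  shows "cfun (z * fls_const (qh powi e)) = cc (z * fls_const (qh powi e') * fls_const q ^ n)"
proof -
  have "fls_const (qh powi e) = fls_const (qh powi e') * fls_const q ^ n"
    unfolding assms qh_powi_even fls_const_mult_const[symmetric] fls_const_power[symmetric] ..
  then show ?thesis
    by (simp only: cfun_def cc_def mult.assoc)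
qed

text \<open>The half-integer exponents of q in R all differ from (1-d)/2 by integers; putting that
  power into \<open>y\<close> leaves integer powers only.\<close>

lemma Rmat_entry:
  assumes d: "0 < d" and m: "m \<le> d" and n: "n \<le> d" and y: "y = z * fls_const (qh powi (1 - int d))"
  shows "Rmat q qh d z $$ (of_bool a * (d + 1) + m, of_bool b * (d + 1) + n) = (\<Prod>i=1..<d. cc (y * fls_const q ^ i))
    * (if a = b then if m = n then if a then cc (y * fls_const q ^ m) else cc (y * fls_const q ^ (d - m)) else 0
       else if a then if n = Suc m then fls_const ((q - inverse q) * Bc d m) else 0
       else if m = Suc n then fls_const ((q - inverse q) * Bc d n) else 0)"
proof -
  let ?i = "of_bool a * (d + 1) + m" and ?j = "of_bool b * (d + 1) + n"
  define D where "D = 1\<^sub>m (2 * (d + 1)) + kron sigma_z (S_three d)"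
  have sig [simp]: "dim_row sigma_plus = 2" "dim_col sigma_plus = 2" "dim_row sigma_minus = 2" "dim_col sigma_minus = 2"
    "dim_row sigma_z = 2" "dim_col sigma_z = 2"
    by (simp_all add: sigma_plus_def sigma_minus_def sigma_z_def mat_of_rows_list_def)
  have S [simp]: "dim_row (S_plus q d) = d + 1" "dim_col (S_plus q d) = d + 1" "dim_row (S_minus q d) = d + 1"
    "dim_col (S_minus q d) = d + 1" "dim_row (S_three d) = d + 1" "dim_col (S_three d) = d + 1"
    by (simp_all add: S_plus_def S_minus_def S_three_def mat1_def)
  have kd [simp]: "dim_row (kron A B) = dim_row A * dim_row B" "dim_col (kron A B) = dim_col A * dim_col B" for A B :: "'c::times mat"
    by (simp_all add: kron_def)
  have ij: "?i < 2 * (d + 1)" "?j < 2 * (d + 1)"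
    using m n by (cases a; cases b; simp)+
  have ij_eq: "?i = ?j \<longleftrightarrow> a = b \<and> m = n"
    using m n by (cases a; cases b) auto
  have lt: "m < d + 1" "n < d + 1"
    using m n by simp_all
  have sigma: "sigma_plus $$ (of_bool a, of_bool b) = of_bool (\<not> a \<and> b)" "sigma_minus $$ (of_bool a, of_bool b) = of_bool (a \<and> \<not> b)"
    by (cases a; cases b; simp add: sigma_plus_def sigma_minus_def mat_of_rows_list_def)+
  have spin: "S_minus q d $$ (m, n) = (if m = Suc n then Bc d n else 0)" "S_plus q d $$ (m, n) = (if n = Suc m then Bc d m else 0)"
    using lt by (simp_all add: S_plus_def S_minus_def mat1_def Bc_def algebra_simps)
  have pm: "kron sigma_plus (S_minus q d) $$ (?i, ?j) = (if \<not> a \<and> b \<and> m = Suc n then Bc d n else 0)"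
    and mp: "kron sigma_minus (S_plus q d) $$ (?i, ?j) = (if a \<and> \<not> b \<and> n = Suc m then Bc d m else 0)"
    by (simp_all only: kron_entry[OF sig(1,2) S(3,4) lt] kron_entry[OF sig(3,4) S(1,2) lt] sigma spin) simp_all
  have D: "D $$ (?i, ?i) = (if a then 1 - (int d - 2 * int m) else 1 + (int d - 2 * int m))"
    using ij kron_entry[of sigma_z "S_three d" "d + 1" m m a a] lt m
    by (cases a) (simp_all add: D_def sigma_z_def mat_of_rows_list_def S_three_def mat1_def)
  have dimD [simp]: "dim_row D = 2 * (d + 1)" "dim_col D = 2 * (d + 1)"
    by (simp_all add: D_def)
  have hD: "half_qpow qh D $$ (?i, ?j) = (if a = b \<and> m = n then qh powi (D $$ (?i, ?i)) else 0)"
    "half_qpow qh (- D) $$ (?i, ?j) = (if a = b \<and> m = n then qh powi (- (D $$ (?i, ?i))) else 0)"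
    unfolding half_qpow_def using ij by (simp_all only: dimD index_uminus_mat index_mat prod.case ij_eq)
  have "(\<Prod>k<d-1. cfun (z * fls_const (qh powi (int d - 1 - 2 * int k)))) = (\<Prod>i=1..<d. cc (y * fls_const q ^ i))"
  proof (rule prod.reindex_bij_witness[of _ "\<lambda>i. d - 1 - i" "\<lambda>k. d - 1 - k"])
    fix k assume "k \<in> {..<d - 1}"
    then have "int d - 1 - 2 * int k = (1 - int d) + 2 * int (d - 1 - k)"
      by auto
    from cfun_shift[OF this] show "cc (y * fls_const q ^ (d - 1 - k)) = cfun (z * fls_const (qh powi (int d - 1 - 2 * int k)))"
      by (simp only: y)
  qed auto
  then have "Rmat q qh d z $$ (?i, ?j) = (\<Prod>i=1..<d. cc (y * fls_const q ^ i)) *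
      (fls_const ((q - inverse q) * ((if \<not> a \<and> b \<and> m = Suc n then Bc d n else 0) + (if a \<and> \<not> b \<and> n = Suc m then Bc d m else 0)))
       + z * fls_const (if a = b \<and> m = n then qh powi (D $$ (?i, ?i)) else 0)
       - inverse z * fls_const (if a = b \<and> m = n then qh powi (- (D $$ (?i, ?i))) else 0))"
    unfolding Rmat_def Let_def D_def[symmetric] using d ij
    by (simp add: half_qpow_def[of qh D, THEN arg_cong[where f = dim_row]] half_qpow_def[of qh D, THEN arg_cong[where f = dim_col]]
      half_qpow_def[of qh "- D", THEN arg_cong[where f = dim_row]] half_qpow_def[of qh "- D", THEN arg_cong[where f = dim_col]] hD[simplified] pm[simplified] mp[simplified])
  moreover have "z * fls_const (qh powi (D $$ (?i, ?i))) - inverse z * fls_const (qh powi (- (D $$ (?i, ?i))))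
    = (if a then cc (y * fls_const q ^ m) else cc (y * fls_const q ^ (d - m)))"
  proof -
    have "z * fls_const (qh powi (D $$ (?i, ?i))) - inverse z * fls_const (qh powi (- (D $$ (?i, ?i)))) = cfun (z * fls_const (qh powi (D $$ (?i, ?i))))"
      by (simp add: cfun_def fls_inverse_const power_int_minus)
    moreover have "(1 - (int d - 2 * int m)) = (1 - int d) + 2 * int m" "1 + (int d - 2 * int m) = (1 - int d) + 2 * int (d - m)"
      using m by simp_all
    ultimately show ?thesis
      unfolding D y by (cases a) (simp_all only: if_True if_False cfun_shift)
  qed
  ultimately show ?thesis
    by (cases "a = b \<and> m = n") (auto simp: if_distrib)
qed

end

lemma dim_fused: "dim_row (fused \<iota> q qh K d x) = d + 1" "dim_col (fused \<iota> q qh K d x) = d + 1"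
  by (cases d; simp add: Let_def fus_F_def fus_E_def mat1_def)+

section \<open>The matrix recursion identified with \<open>cop\<close>\<close>

locale fused_match = rt: q_root q qh + fusion "fls_map \<iota>" "fls_const q" k G
  for \<iota> :: "complex \<Rightarrow> 'a::ring_1" and q qh k G +
  fixes K :: "complex fls \<Rightarrow> 'a fls mat"
  assumes scalars_const: "scalars \<iota>"
    and G_const: "x \<in> G \<Longrightarrow> c \<noteq> 0 \<Longrightarrow> x * fls_const c \<in> G"
    and K_dim: "dim_row (K x) = 2" "dim_col (K x) = 2"
    and K_entry: "K x $$ (of_bool a, of_bool b) = k x a b"
begin

abbreviation J :: "complex fls \<Rightarrow> 'a fls" where "J \<equiv> fls_map \<iota>"
abbreviation S :: "nat \<Rightarrow> nat \<Rightarrow> 'a fls" where "S d m \<equiv> J (fls_const (rt.sc d m))"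

lemma J_const: "fls_const (\<iota> c) = J (fls_const c)"
  using scalars.i_zero[OF scalars_const] by (intro fls_eqI) (simp add: fls_nth_fls_map)

lemma C_add: "J (fls_const (a + b)) = J (fls_const a) + J (fls_const b)"
  by (simp only: fls_plus_const[symmetric] i_add)

lemma C_mult: "J (fls_const a) * (J (fls_const b) * w) = J (fls_const (a * b)) * w"
  by (simp only: fls_const_mult_const[symmetric] i_i)

lemma E_mv:
  assumes m: "m < d"
  shows "mv (map_mat (\<lambda>c. fls_const (\<iota> c)) (fus_E q d)) (\<lambda>n. S d n * \<psi> n) (of_bool a * d + m) = S (d - 1) m * Em d \<psi> a m"
proof -
  let ?i = "of_bool a * d + m" and ?n = "of_bool a + m"
  have i: "?i < 2 * d" "?n < d + 1"
    using m by (cases a; simp)+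
  have "mv (map_mat (\<lambda>c. fls_const (\<iota> c)) (fus_E q d)) (\<lambda>n. S d n * \<psi> n) ?i
    = (\<Sum>n<d + 1. J (fls_const (fus_E q d $$ (?i, n))) * (S d n * \<psi> n))"
    unfolding mv_def J_const[symmetric] using i by (intro sum.cong) (simp_all add: fus_E_def mat1_def)
  also have "\<dots> = (\<Sum>n<d + 1. if n = ?n then J (fls_const (rt.e_coef d a m)) * (S d ?n * \<psi> ?n) else 0)"
    by (intro sum.cong refl) (simp add: rt.fus_E_entry[OF m])
  also have "\<dots> = J (fls_const (rt.e_coef d a m)) * (S d ?n * \<psi> ?n)"
    using i(2) by simp
  also have "\<dots> = S (d - 1) m * \<psi> ?n"
    unfolding i_i fls_const_mult_const rt.e_coef_def using rt.sc_nz[of ?n d] i(2) by simp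
  finally show ?thesis
    using m by (simp add: Em_def)
qed

lemma F_mv:
  assumes d: "0 < d" and n: "n \<le> d"
    and f: "\<And>a m. m < d \<Longrightarrow> f (of_bool a * d + m) = S (d - 1) m * \<psi> (of_bool a + m)"
  shows "mv (map_mat (\<lambda>c. fls_const (\<iota> c)) (fus_F q d)) f n = S d n * \<psi> n"
proof -
  obtain r s where rs: "\<And>i. i < 2 * d \<Longrightarrow> fus_F q d $$ (n, i) = (if i = n \<and> n < d then r else 0) + (if 0 < n \<and> i = d + (n - 1) then s else 0)"
    and one: "(if n < d then r * rt.e_coef d False n else 0) + (if 0 < n then s * rt.e_coef d True (n - 1) else 0) = 1"
    using rt.F_row[OF n d] by blast
  have J_if: "J (fls_const (if P then c else 0)) = (if P then J (fls_const c) else 0)" for P c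
    by simp
  have "mv (map_mat (\<lambda>c. fls_const (\<iota> c)) (fus_F q d)) f n = (\<Sum>i<2 * d. J (fls_const (fus_F q d $$ (n, i))) * f i)"
    unfolding mv_def J_const[symmetric] using n by (intro sum.cong) (simp_all add: fus_F_def mat1_def)
  also have "\<dots> = (\<Sum>i<2 * d. (if i = n then if n < d then J (fls_const r) * f n else 0 else 0)
      + (if i = d + (n - 1) then if 0 < n then J (fls_const s) * f (d + (n - 1)) else 0 else 0))"
    by (intro sum.cong refl) (auto simp: rs C_add distrib_right)
  also have "\<dots> = (if n < d then J (fls_const r) * f n else 0) + (if 0 < n then J (fls_const s) * f (d + (n - 1)) else 0)"
    using d n by (subst sum.distrib) auto
  also have "(if n < d then J (fls_const r) * f n else 0) = (if n < d then J (fls_const (r * rt.e_coef d False n)) * (S d n * \<psi> n) else 0)"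
  proof (rule if_cong[OF refl _ refl])
    assume nd: "n < d"
    have "rt.e_coef d False n * rt.sc d n = rt.sc (d - 1) n"
      using rt.sc_nz[OF n] by (simp add: rt.e_coef_def)
    moreover have "f n = S (d - 1) n * \<psi> n"
      using f[OF nd, of False] by simp
    ultimately show "J (fls_const r) * f n = J (fls_const (r * rt.e_coef d False n)) * (S d n * \<psi> n)"
      by (simp only: C_mult mult.assoc)
  qed
  also have "(if 0 < n then J (fls_const s) * f (d + (n - 1)) else 0) = (if 0 < n then J (fls_const (s * rt.e_coef d True (n - 1))) * (S d n * \<psi> n) else 0)"
  proof (rule if_cong[OF refl _ refl])
    assume n0: "0 < n"
    then have m: "n - 1 < d" "1 + (n - 1) = n"
      using n d by auto
    have "rt.e_coef d True (n - 1) * rt.sc d n = rt.sc (d - 1) (n - 1)"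
      using rt.sc_nz[OF n] n0 by (simp add: rt.e_coef_def)
    moreover have "f (d + (n - 1)) = S (d - 1) (n - 1) * \<psi> n"
      using f[OF m(1), of True] m(2) by simp
    ultimately show "J (fls_const s) * f (d + (n - 1)) = J (fls_const (s * rt.e_coef d True (n - 1))) * (S d n * \<psi> n)"
      by (simp only: C_mult mult.assoc)
  qed
  also have "(if n < d then J (fls_const (r * rt.e_coef d False n)) * (S d n * \<psi> n) else 0)
      + (if 0 < n then J (fls_const (s * rt.e_coef d True (n - 1))) * (S d n * \<psi> n) else 0)
    = J (fls_const ((if n < d then r * rt.e_coef d False n else 0) + (if 0 < n then s * rt.e_coef d True (n - 1) else 0))) * (S d n * \<psi> n)"
    by (simp add: C_add distrib_right)
  finally show ?thesis
    unfolding one by simp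
qed

lemma cc_const_q: "cc (fls_const q ^ n) = fls_const (q ^ n - inverse (q ^ n))"
  unfolding fls_const_power[symmetric] cc_def fls_inverse_const fls_minus_const ..

text \<open>Under the rescaling the off-diagonal entries (q - 1/q) B become \<open>cc\<close> of
  q^(d-m) and of q^m, by \<open>sc_up\<close> and \<open>sc_Suc\<close> respectively. At the ends of
  the index range both forms vanish.\<close>

lemma R_mv:
  assumes m: "m \<le> d" and y: "y = z * fls_const (qh powi (1 - int d))" and cc: "cc y \<noteq> 0"
    and f: "\<And>b n. n \<le> d \<Longrightarrow> f (of_bool b * (d + 1) + n) = S d n * \<phi> b n"
  shows "mv (map_mat J (Rmat q qh d z)) f (of_bool a * (d + 1) + m) = S d m * Rop d y \<phi> a m"
proof (cases "d = 0")
  case True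
  have S: "S 0 0 = 1"
    by (simp add: rt.sc_def)
  have "mv (map_mat J (Rmat q qh d z)) f (of_bool a * (d + 1) + m) = f (of_bool a)"
    using True m by (cases a) (simp_all add: mv_def Rmat_def numeral_2_eq_2 lessThan_Suc)
  with f[of 0 a] show ?thesis
    using True m cc S by (simp add: Rop_0)
next
  case False
  let ?P = "\<Prod>i=1..<d. cc (y * fls_const q ^ i)"
  let ?i = "of_bool a * (d + 1) + m"
  have dim: "dim_row (Rmat q qh d z) = 2 * (d + 1)" "dim_col (Rmat q qh d z) = 2 * (d + 1)"
    using False by (simp_all add: Rmat_def Let_def half_qpow_def kron_def sigma_z_def S_three_def mat1_def mat_of_rows_list_def)
  have i: "?i < 2 * (d + 1)"
    using m by (cases a) simp_all
  have fe: "f (of_bool b * (d + 1) + n) = S d n * \<phi> b n" if "n < d + 1" for b n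
    using f[of n b] that by simp
  have Re: "Rmat q qh d z $$ (?i, of_bool b * (d + 1) + n) = ?P
    * (if a = b then if m = n then if a then cc (y * fls_const q ^ m) else cc (y * fls_const q ^ (d - m)) else 0
       else if a then if n = Suc m then fls_const ((q - inverse q) * rt.Bc d m) else 0
       else if m = Suc n then fls_const ((q - inverse q) * rt.Bc d n) else 0)" if "n < d + 1" for b n
    using that rt.Rmat_entry[OF _ m _ y, of n a b] False by simp
  have step: "mv (map_mat J (Rmat q qh d z)) f ?i
    = (\<Sum>n<d + 1. J (Rmat q qh d z $$ (?i, of_bool False * (d + 1) + n)) * (S d n * \<phi> False n))
    + (\<Sum>n<d + 1. J (Rmat q qh d z $$ (?i, of_bool True * (d + 1) + n)) * (S d n * \<phi> True n))"
  proof -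
    have "mv (map_mat J (Rmat q qh d z)) f ?i = (\<Sum>j<2 * (d + 1). J (Rmat q qh d z $$ (?i, j)) * f j)"
      unfolding mv_def using i by (intro sum.cong) (simp_all add: dim)
    also have "\<dots> = (\<Sum>n<d + 1. J (Rmat q qh d z $$ (?i, of_bool False * (d + 1) + n)) * f (of_bool False * (d + 1) + n))
      + (\<Sum>n<d + 1. J (Rmat q qh d z $$ (?i, of_bool True * (d + 1) + n)) * f (of_bool True * (d + 1) + n))"
      by (simp only: sum_double of_bool_eq mult_zero_left mult_1 add_0)
    also have "\<dots> = (\<Sum>n<d + 1. J (Rmat q qh d z $$ (?i, of_bool False * (d + 1) + n)) * (S d n * \<phi> False n))
      + (\<Sum>n<d + 1. J (Rmat q qh d z $$ (?i, of_bool True * (d + 1) + n)) * (S d n * \<phi> True n))"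
      by (intro arg_cong2[of _ _ _ _ "(+)"] sum.cong refl) (simp_all only: fe lessThan_iff)
    finally show ?thesis .
  qed
  have qn: "(q - inverse q) * qnum q (int n) = q ^ n - inverse (q ^ n)" for n
    using rt.q_diff by (simp add: rt.qnum_nat)
  have pre: "J (?P * w) * (S d n * c) = J ?P * (J (w * fls_const (rt.sc d n)) * c)" for w n c
    by (simp only: i_i mult.assoc)
  show ?thesis
  proof (cases a)
    case True
    have "mv (map_mat J (Rmat q qh d z)) f ?i
      = (\<Sum>n<d + 1. if n = Suc m then J (?P * fls_const ((q - inverse q) * rt.Bc d m)) * (S d (Suc m) * \<phi> False (Suc m)) else 0)
      + (\<Sum>n<d + 1. if n = m then J (?P * cc (y * fls_const q ^ m)) * (S d m * \<phi> True m) else 0)"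
      unfolding step by (intro arg_cong2[of _ _ _ _ "(+)"] sum.cong refl, simp_all only: Re lessThan_iff) (use True in \<open>auto\<close>)
    also have "\<dots> = J ?P * (if m < d then J (fls_const ((q - inverse q) * rt.Bc d m) * fls_const (rt.sc d (Suc m))) * \<phi> False (Suc m) else 0)
      + J ?P * (J (cc (y * fls_const q ^ m) * fls_const (rt.sc d m)) * \<phi> True m)"
      unfolding pre using m by simp
    also have "(if m < d then J (fls_const ((q - inverse q) * rt.Bc d m) * fls_const (rt.sc d (Suc m))) * \<phi> False (Suc m) else 0)
      = J (cc (fls_const q ^ (d - m)) * fls_const (rt.sc d m)) * \<phi> False (Suc m)"
    proof (cases "m < d")
      case True
      have "(q - inverse q) * rt.Bc d m * rt.sc d (Suc m) = (q - inverse q) * (rt.sc d (Suc m) * rt.Bc d m)"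
        by (simp only: mult_ac)
      also have "\<dots> = (q ^ (d - m) - inverse (q ^ (d - m))) * rt.sc d m"
        unfolding rt.sc_up[OF True, symmetric] qn[symmetric] by (simp only: mult_ac)
      finally show ?thesis
        using True by (simp only: cc_const_q fls_const_mult_const if_True)
    next
      case False
      then have "d - m = 0" by simp
      with False show ?thesis
        by (simp add: cc_def)
    qed
    finally have "mv (map_mat J (Rmat q qh d z)) f ?i = J ?P * (J (cc (fls_const q ^ (d - m)) * fls_const (rt.sc d m)) * \<phi> False (Suc m))
        + J ?P * (J (cc (y * fls_const q ^ m) * fls_const (rt.sc d m)) * \<phi> True m)" .
    moreover have "Rop d y \<phi> a m = J ?P * (J (cc (y * fls_const q ^ m)) * \<phi> True m + J (cc (fls_const q ^ (d - m))) * \<phi> False (Suc m))"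
        using True m \<open>d \<noteq> 0\<close> by (simp add: Rop_def Lop_def Rpre_def)
      ultimately show ?thesis
        by (simp only: distrib_left i_i mult_ac add.commute)
  next
    case a: False
    have "mv (map_mat J (Rmat q qh d z)) f ?i
      = (\<Sum>n<d + 1. if n = m then J (?P * cc (y * fls_const q ^ (d - m))) * (S d m * \<phi> False m) else 0)
      + (\<Sum>n<d + 1. if n = m - 1 then if 0 < m then J (?P * fls_const ((q - inverse q) * rt.Bc d (m - 1))) * (S d (m - 1) * \<phi> True (m - 1)) else 0 else 0)"
      unfolding step by (intro arg_cong2[of _ _ _ _ "(+)"] sum.cong refl, simp_all only: Re lessThan_iff) (use a in \<open>auto\<close>)
    also have "\<dots> = J ?P * (J (cc (y * fls_const q ^ (d - m)) * fls_const (rt.sc d m)) * \<phi> False m)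
      + J ?P * (if 0 < m then J (fls_const ((q - inverse q) * rt.Bc d (m - 1)) * fls_const (rt.sc d (m - 1))) * \<phi> True (m - 1) else 0)"
      unfolding pre using m by auto
    also have "(if 0 < m then J (fls_const ((q - inverse q) * rt.Bc d (m - 1)) * fls_const (rt.sc d (m - 1))) * \<phi> True (m - 1) else 0)
      = J (cc (fls_const q ^ m) * fls_const (rt.sc d m)) * \<phi> True (m - 1)"
    proof (cases m)
      case (Suc l)
      have "(q - inverse q) * rt.Bc d l * rt.sc d l = (q - inverse q) * (rt.sc d l * rt.Bc d l)"
        by (simp only: mult_ac)
      also have "\<dots> = (q ^ m - inverse (q ^ m)) * rt.sc d m"
        unfolding rt.sc_Suc[symmetric] qn[symmetric] Suc by (simp only: mult_ac)
      finally show ?thesis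
        using Suc by (simp only: cc_const_q fls_const_mult_const zero_less_Suc if_True diff_Suc_1)
    qed (simp add: cc_def)
    finally have "mv (map_mat J (Rmat q qh d z)) f ?i = J ?P * (J (cc (y * fls_const q ^ (d - m)) * fls_const (rt.sc d m)) * \<phi> False m)
        + J ?P * (J (cc (fls_const q ^ m) * fls_const (rt.sc d m)) * \<phi> True (m - 1))" .
    moreover have "Rop d y \<phi> a m = J ?P * (J (cc (y * fls_const q ^ (d - m))) * \<phi> False m + J (cc (fls_const q ^ m)) * \<phi> True (m - 1))"
      using a m \<open>d \<noteq> 0\<close> by (simp add: Rop_def Lop_def Rpre_def)
    ultimately show ?thesis
      by (simp only: distrib_left i_i mult_ac)
  qed
qed

text \<open>The five factors of the recursion are matched from right to left, each carrying the
  rescaling of its own space along; \<open>xq\<close> and \<open>y\<close> translate the arguments u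
  q^(1/2) and u^2 q^(1-d/2) into shifted parameters.\<close>

lemma fused_mv:
  assumes "x * fls_const (qh powi (1 - int d)) \<in> G" "m \<le> d"
  shows "mv (fused \<iota> q qh K d x) (\<lambda>n. S d n * \<psi> n) m = S d m * cop k d (x * fls_const (qh powi (1 - int d))) \<psi> m"
  using assms
proof (induction d arbitrary: x m \<psi>)
  case 0
  then show ?case
    by (simp add: mv_def)
next
  case (Suc e)
  let ?d = "Suc e"
  define x1 where "x1 = x * fls_const (qh powi (1 - int ?d))"
  define z where "z = x\<^sup>2 * fls_const (qh powi (2 - int ?d))"
  define C where "C = fused \<iota> q qh K e (x * fls_const qh)"
  have x1: "x1 \<in> G"
    using Suc.prems(1) by (simp only: x1_def)
  have qp: "qh powi a * qh powi b = qh powi (a + b)" for a b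
    using rt.qh0 by (simp add: power_int_add)
  have xq: "x * fls_const qh * fls_const (qh powi (1 - int e)) = x1 * fls_const q"
  proof -
    have "qh * qh powi (1 - int e) = qh powi (2 - int e)" "qh powi (1 - int ?d) * q = qh powi (2 - int e)"
      using qp[of 1 "1 - int e"] qp[of "1 - int ?d" 2] by (simp_all add: rt.qh)
    then show ?thesis
      unfolding x1_def mult.assoc fls_const_mult_const by (simp only:)
  qed
  have y: "x1\<^sup>2 * fls_const q = z * fls_const (qh powi (1 - int e))"
  proof -
    have "qh powi (2 - int ?d) * qh powi (1 - int e) = qh powi (2 - 2 * int e)"
      "qh powi (1 - int ?d) * qh powi (1 - int ?d) * q = qh powi (2 - 2 * int e)"
    proof -
      have "2 - int ?d + (1 - int e) = 2 - 2 * int e" "1 - int ?d + (1 - int ?d) = - 2 * int e" "- 2 * int e + 2 = 2 - 2 * int e"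
        by simp_all
      note qp' = qp[of "2 - int ?d" "1 - int e", unfolded this] qp[of "1 - int ?d" "1 - int ?d", unfolded this] qp[of "- 2 * int e" 2, unfolded this]
      have "q = qh powi 2"
        by (simp add: rt.qh)
      then show "qh powi (2 - int ?d) * qh powi (1 - int e) = qh powi (2 - 2 * int e)"
        "qh powi (1 - int ?d) * qh powi (1 - int ?d) * q = qh powi (2 - 2 * int e)"
        by (simp_all only: qp')
    qed
    moreover have "x1\<^sup>2 * fls_const q = x\<^sup>2 * fls_const (qh powi (1 - int ?d) * qh powi (1 - int ?d) * q)"
      unfolding x1_def power2_eq_square fls_const_mult_const[symmetric] by (simp only: mult_ac)
    ultimately show ?thesis
      unfolding z_def mult.assoc fls_const_mult_const by (simp only:)
  qed
  have cc: "cc (x1\<^sup>2 * fls_const q) \<noteq> 0"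
    using Gcc[OF x1, of 1] by simp
  let ?E = "map_mat (\<lambda>c. fls_const (\<iota> c)) (fus_E q ?d)" and ?F = "map_mat (\<lambda>c. fls_const (\<iota> c)) (fus_F q ?d)"
  let ?K = "kron (K x1) (1\<^sub>m ?d)" and ?R = "map_mat J (Rmat q qh e z)" and ?C = "kron (1\<^sub>m 2) C"
  define f1 where "f1 = mv ?E (\<lambda>n. S ?d n * \<psi> n)"
  define f2 where "f2 = mv ?C f1"
  define f3 where "f3 = mv ?R f2"
  define f4 where "f4 = mv ?K f3"
  have dimC: "dim_row C = ?d" "dim_col C = ?d"
    by (simp_all add: C_def dim_fused)
  have dimR: "dim_row ?R = 2 * ?d" "dim_col ?R = 2 * ?d"
    by (cases "e = 0"; simp add: Rmat_def Let_def half_qpow_def kron_def sigma_z_def S_three_def mat1_def mat_of_rows_list_def)+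
  have dims: "dim_row ?F = ?d + 1" "dim_col ?F = 2 * ?d" "dim_row ?K = 2 * ?d" "dim_col ?K = 2 * ?d" "dim_row ?R = 2 * ?d" "dim_col ?R = 2 * ?d"
    "dim_row ?C = 2 * ?d" "dim_col ?C = 2 * ?d" "dim_row ?E = 2 * ?d"
    by (simp_all add: fus_F_def fus_E_def mat1_def kron_def K_dim dimC dimR[simplified])
  have m: "m < ?d + 1"
    using Suc.prems(2) by simp
  have fs: "fused \<iota> q qh K ?d x = ?F * ?K * ?R * ?C * ?E"
    by (simp only: fused.simps Let_def x1_def z_def C_def)
  have "mv (fused \<iota> q qh K ?d x) (\<lambda>n. S ?d n * \<psi> n) m = mv ?F f4 m"
    unfolding fs f4_def f3_def f2_def f1_def using m dims by (simp only: mv_mult index_mult_mat(2,3))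
  also have "\<dots> = S ?d m * cop k ?d x1 \<psi> m"
  proof (rule F_mv)
    fix a n assume n: "n < ?d"
    then have ne: "n \<le> e"
      by simp
    have f1: "f1 (of_bool b * ?d + l) = S e l * Em ?d \<psi> b l" if "l < ?d" for b l
      using E_mv[OF that, of \<psi> b] by (simp only: f1_def diff_Suc_1)
    have f2: "f2 (of_bool b * (e + 1) + l) = S e l * cop k e (x1 * fls_const q) (Em ?d \<psi> b) l" if l: "l \<le> e" for b l
    proof -
      have "f2 (of_bool b * ?d + l) = mv C (split2 ?d f1 b) l"
        unfolding f2_def using mv_kron_right[OF dimC, of l f1 b] l by (simp add: split2_def)
      also have "\<dots> = mv C (\<lambda>n. S e n * Em ?d \<psi> b n) l"
        by (rule mv_cong) (simp only: dimC split2_def f1)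
      also have "\<dots> = S e l * cop k e (x1 * fls_const q) (Em ?d \<psi> b) l"
        unfolding C_def using Suc.IH[of "x * fls_const qh" l "Em ?d \<psi> b"] Gq[OF x1] l by (simp only: xq)
      finally show ?thesis
        by (simp only: Suc_eq_plus1)
    qed
    have f3: "f3 (of_bool b * (e + 1) + l) = S e l * Rop e (x1\<^sup>2 * fls_const q) (\<lambda>b. cop k e (x1 * fls_const q) (Em ?d \<psi> b)) b l" if "l \<le> e" for b l
      unfolding f3_def by (rule R_mv[OF that y cc f2])
    have "f4 (of_bool a * ?d + n) = k x1 a False * f3 (of_bool False * (e + 1) + n) + k x1 a True * f3 (of_bool True * (e + 1) + n)"
      using mv_kron_left[OF K_dim n, of x1 f3 a] K_entry[of x1 a False] K_entry[of x1 a True] by (simp add: f4_def split2_def)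
    also have "\<dots> = S e n * dr e x1 (Em ?d \<psi>) a n"
      unfolding f3[OF ne] by (simp add: dr_def dress_def Kop_def i_left_comm[of "k _ _ _"] distrib_left)
    also have "\<dots> = S e n * cop k ?d x1 \<psi> (of_bool a + n)"
      unfolding dr_Em[OF x1] using n by (simp add: Em_def)
    finally show "f4 (of_bool a * ?d + n) = S (?d - 1) n * cop k ?d x1 \<psi> (of_bool a + n)"
      by simp
  qed (use m in simp_all)
  finally show ?case
    by (simp only: x1_def)
qed

lemma fused_entry:
  assumes x: "x * fls_const (qh powi (1 - int d)) \<in> G" and m: "m \<le> d" and n: "n \<le> d"
  shows "fused \<iota> q qh K d x $$ (m, n) = J (fls_const (rt.sc d m / rt.sc d n)) * cop k d (x * fls_const (qh powi (1 - int d))) (dl n) m"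
proof -
  have "mv (fused \<iota> q qh K d x) (\<lambda>i. S d i * dl n i) m = (\<Sum>i<d + 1. if i = n then fused \<iota> q qh K d x $$ (m, n) * S d n else 0)"
    unfolding mv_def by (intro sum.cong) (auto simp: dl_def dim_fused)
  also have "\<dots> = S d n * fused \<iota> q qh K d x $$ (m, n)"
    using n by (simp add: i_central)
  finally have "S d n * fused \<iota> q qh K d x $$ (m, n) = S d n * (J (fls_const (rt.sc d m / rt.sc d n)) * cop k d (x * fls_const (qh powi (1 - int d))) (dl n) m)"
    using fused_mv[OF x m] rt.sc_nz[OF n] by (simp add: i_i fls_const_mult_const)
  then show ?thesis
    by (rule i_cancel[rotated]) (rule fls_const_nonzero[OF rt.sc_nz[OF n]])
qed

end

context qscalars
begin

interpretation base: qscalars "id :: 'k \<Rightarrow> 'k" q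
  by unfold_locales (simp_all add: q0 mult.commute)

lemma Rop_lift: "Rop d y (\<lambda>a m. \<iota> (\<phi> a m)) = (\<lambda>a m. \<iota> (base.Rop d y \<phi> a m))"
  by (simp add: fun_eq_iff Rop_def base.Rop_def Lop_def base.Lop_def Rpre_def base.Rpre_def i_mult i_add)

lemma cop_lift: "cop (\<lambda>x a b. \<iota> (N x a b)) d x (\<lambda>m. \<iota> (\<psi> m)) m = \<iota> (base.cop N d x \<psi> m)"
proof (induction d arbitrary: x m \<psi>)
  case (Suc d)
  have Em: "Em (Suc d) (\<lambda>m. \<iota> (\<psi> m)) = (\<lambda>a m. \<iota> (base.Em (Suc d) \<psi> a m))"
    by (simp add: fun_eq_iff Em_def base.Em_def)
  have "(\<lambda>a. cop (\<lambda>x a b. \<iota> (N x a b)) d (x * q) (Em (Suc d) (\<lambda>m. \<iota> (\<psi> m)) a))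
    = (\<lambda>a m. \<iota> (base.cop N d (x * q) (base.Em (Suc d) \<psi> a) m))"
    unfolding Em by (intro ext) (rule Suc.IH)
  then show ?case
    unfolding cop.simps(2) base.cop.simps(2) dress_def base.dress_def
    by (simp add: Rop_lift Kop_def base.Kop_def i_mult i_add)
qed simp

lemma cop_expand: "cop K d x \<psi> m = (\<Sum>n\<le>d. cop K d x (dl n) m * \<psi> n)"
proof -
  have A: "rlin (cop K d x)"
    by (rule cop_rlin)
  have fin: "finite N \<Longrightarrow> cop K d x (\<lambda>m. \<Sum>n\<in>N. dl n m * \<psi> n) m = (\<Sum>n\<in>N. cop K d x (dl n) m * \<psi> n)" for N
  proof (induction N rule: finite_induct)
    case (insert n N)
    have "cop K d x (\<lambda>m. dl n m * \<psi> n + (\<Sum>n\<in>N. dl n m * \<psi> n)) m = cop K d x (\<lambda>m. dl n m * \<psi> n) m + cop K d x (\<lambda>m. \<Sum>n\<in>N. dl n m * \<psi> n) m"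
      by (simp add: rlin_add[OF A])
    also have "cop K d x (\<lambda>m. dl n m * \<psi> n) m = cop K d x (dl n) m * \<psi> n"
      by (simp add: rlin_right[OF A])
    finally show ?case
      using insert by simp
  qed (simp add: rlin_zero[OF A])
  have "cop K d x \<psi> = cop K d x (\<lambda>m. \<Sum>n\<le>d. dl n m * \<psi> n)"
    by (rule cop_cong) (simp add: dl_def of_bool_def if_distrib[of "\<lambda>x. x * _"] cong: if_cong)
  then show ?thesis
    by (simp add: fin)
qed

end

lemma fls_map_id: "fls_map id = (id :: 'b::zero fls \<Rightarrow> 'b fls)"
  by (rule ext, rule fls_eqI) (simp add: fls_nth_fls_map)

context root_free
begin

lemma fused_match_num:
  assumes "qh\<^sup>2 = q"
  shows "fused_match id q qh (knum ep em kp km) Gminus (K_num_half q ep em kp km)"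
  unfolding fused_match_def fused_match_axioms_def fls_map_id
proof (intro conjI allI impI)
    show "q_root q qh"
      using q0 qroot assms by unfold_locales
    show "fusion id (fls_const q) (knum ep em kp km) Gminus"
      by (rule fusion_knum)
    show "scalars (id :: complex \<Rightarrow> complex)"
      by unfold_locales simp_all
  next
    fix x :: "complex fls" and c :: complex
    assume "x \<in> Gminus" "c \<noteq> 0"
    then show "x * fls_const c \<in> Gminus"
      by (simp add: subdegree_scale)
  next
    fix x :: "complex fls" and a b
    show "K_num_half q ep em kp km x $$ (of_bool a, of_bool b) = knum ep em kp km x a b"
      by (cases a; cases b) (simp_all add: K_num_half_def mat_of_rows_list_def knum_def Nmat_def cfun_def cc_def)
qed (simp_all add: K_num_half_def mat_of_rows_list_def)

lemma wt_sc:
  assumes "qh\<^sup>2 = q" "m \<le> d"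
  shows "numeric_fusion.wt (fls_const q) d m = fls_const (q_root.sc q d m * q_root.sc q d m)"
proof -
  interpret rt: q_root q qh
    using q0 qroot assms(1) by unfold_locales
  interpret numeric_fusion "fls_const q" "knum 0 0 0 0" Gminus
    by (rule numeric_fusion_knum)
  show ?thesis
    using assms(2)
  proof (induction m)
    case 0
    show ?case
      by (simp add: wt_def rt.sc_def)
  next
    case (Suc m)
    have m: "m < d"
      using Suc.prems by simp
    have IH: "wt d m = fls_const (rt.sc d m * rt.sc d m)"
      using Suc.IH m by simp
    have c: "cc (fls_const q ^ n) = fls_const ((q - inverse q) * qnum q (int n))" for n
      unfolding fls_const_power[symmetric] cc_const using rt.q_diff by (simp add: rt.qnum_nat)
    have e: "rt.sc d (Suc m) * rt.sc d (Suc m) * ((q - inverse q) * qnum q (int (Suc m))) = rt.sc d m * rt.sc d m * ((q - inverse q) * qnum q (int (d - m)))"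
    proof -
      have "rt.sc d (Suc m) * rt.sc d (Suc m) * ((q - inverse q) * qnum q (int (Suc m)))
        = (q - inverse q) * rt.sc d (Suc m) * (rt.sc d (Suc m) * qnum q (int (Suc m)))"
        by (simp only: mult_ac)
      also have "\<dots> = (q - inverse q) * rt.sc d m * (rt.sc d (Suc m) * rt.Bc d m)"
        unfolding rt.sc_Suc by (simp only: mult_ac)
      also have "\<dots> = rt.sc d m * rt.sc d m * ((q - inverse q) * qnum q (int (d - m)))"
        unfolding rt.sc_up[OF m, symmetric] by (simp only: mult_ac)
      finally show ?thesis .
    qed
    have "wt d (Suc m) * cc (fls_const q ^ Suc m) = fls_const (rt.sc d (Suc m) * rt.sc d (Suc m)) * cc (fls_const q ^ Suc m)"
      unfolding wt_Suc unfolding c IH fls_const_mult_const e ..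
    then show ?case
      using cc_qn[of "Suc m"] by (metis mult_right_cancel zero_less_Suc)
  qed
qed

text \<open>\<open>fused_entry\<close> gives the entry (n, m) with the factor sc_n / sc_m.
  Adjointness for the weights sc^2 exchanges m and n and inverts that factor, while the two
  off-diagonal constants of K change places.\<close>

lemma num_fused_transpose:
  assumes qh: "qh\<^sup>2 = q" and x: "x \<in> Gminus" and m: "m \<le> d" and n: "n \<le> d"
  shows "fused id q qh (K_num_half q ep em km kp) d x $$ (n, m) = fls_const (q_root.sc q d m / q_root.sc q d n)
    * qscalars.cop id (fls_const q) (knum ep em kp km) d (x * fls_const (qh powi (1 - int d))) (qscalars.dl n) m"
proof -
  interpret f: fused_match id q qh "knum ep em km kp" Gminus "K_num_half q ep em km kp"
    by (rule fused_match_num[OF qh])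
  interpret numeric_fusion "fls_const q" "knum ep em kp km" Gminus
    by (rule numeric_fusion_knum)
  let ?x = "x * fls_const (qh powi (1 - int d))"
  have x': "?x \<in> Gminus"
    using x f.rt.qh0 by (simp add: subdegree_scale)
  have form_dl: "form d (dl n) g = wt d n * g n" "form d g (dl m) = wt d m * g m" for g
    using m n by (simp_all add: form_def dl_def of_bool_def if_distrib[of "\<lambda>z. _ * z"] if_distrib[of "\<lambda>z. z * _"] cong: if_cong)
  have adj: "wt d n * cop (knum ep em km kp) d ?x (dl m) n = wt d m * cop (knum ep em kp km) d ?x (dl n) m"
    using cop_adjoint[OF x', of d "dl n" "dl m"] unfolding knum_transpose form_dl .
  have nz: "f.rt.sc d n \<noteq> 0" "f.rt.sc d m \<noteq> 0"
    using m n by (simp_all add: f.rt.sc_nz)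
  have "fls_const (f.rt.sc d n * f.rt.sc d n) * (fls_const (f.rt.sc d n / f.rt.sc d m) * cop (knum ep em km kp) d ?x (dl m) n)
    = fls_const (f.rt.sc d n / f.rt.sc d m) * (wt d m * cop (knum ep em kp km) d ?x (dl n) m)"
    unfolding wt_sc[OF qh n, symmetric] adj[symmetric] by (simp only: mult_ac)
  also have "\<dots> = fls_const (f.rt.sc d n * f.rt.sc d n) * (fls_const (f.rt.sc d m / f.rt.sc d n) * cop (knum ep em kp km) d ?x (dl n) m)"
    unfolding wt_sc[OF qh m] mult.assoc[symmetric] fls_const_mult_const using nz by (simp add: field_simps)
  finally have "fls_const (f.rt.sc d n / f.rt.sc d m) * cop (knum ep em km kp) d ?x (dl m) n
    = fls_const (f.rt.sc d m / f.rt.sc d n) * cop (knum ep em kp km) d ?x (dl n) m"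
    using nz by simp
  then show ?thesis
    using f.fused_entry[OF x' n m] unfolding fls_map_id id_apply by simp
qed

end

context aq_transfer
begin

definition Kmat :: "complex fls \<Rightarrow> 'a fls mat" where
  "Kmat x = mat_of_rows_list 2 [[Kser x False False, Kser x False True], [Kser x True False, Kser x True True]]"

definition transfer :: "complex \<Rightarrow> nat \<Rightarrow> 'a fls" where
  "transfer qh d = mat_trace (map_mat J (K_dual q qh ebp ebm kbp kbm d fls_X_inv) * fused \<iota> q qh Kmat d fls_X_inv)"

lemma fused_match_op:
  assumes "qh\<^sup>2 = q"
  shows "fused_match \<iota> q qh Kser Gplus Kmat"
  unfolding fused_match_def fused_match_axioms_def
proof (intro conjI allI impI)
  show "q_root q qh"
    using q0 qroot assms by unfold_locales
  show "fusion J (fls_const q) Kser Gplus"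
    by (rule fusion_Kser)
  show "scalars \<iota>"
    by (rule scalars_axioms)
  show "x * fls_const c \<in> Gplus" if "x \<in> Gplus" "c \<noteq> 0" for x :: "complex fls" and c
    using that by (simp add: subdegree_scale)
  show "Kmat x $$ (of_bool a, of_bool b) = Kser x a b" for x a b
    by (cases a; cases b) (simp_all add: Kmat_def mat_of_rows_list_def)
qed (simp_all add: Kmat_def mat_of_rows_list_def)

text \<open>In the trace, the rescaling factors of the dual matrix and of the operator are
  reciprocal and cancel, which leaves the normalisation by \<open>f_norm\<close>.\<close>

lemma transfer_tau:
  assumes qh: "qh\<^sup>2 = q"
  shows "transfer qh d = J (1 / f_norm q d fls_X_inv) * pair.tau d (fls_X_inv * fls_const (qh powi (1 - int d)))"
proof -
  interpret f: fused_match \<iota> q qh Kser Gplus Kmat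
    by (rule fused_match_op[OF qh])
  let ?x = "fls_X_inv :: complex fls" and ?r = "fls_const (qh powi (1 - int d)) :: complex fls"
  let ?y = "inverse ?x * fls_const (inverse q)"
  let ?c = "1 / f_norm q d ?x"
  have x: "?x * ?r \<in> Gplus"
    using f.rt.qh0 by (simp add: subdegree_scale)
  have y: "?y \<in> Gminus"
    using q0 by (simp add: subdegree_scale fls_inverse_subdegree)
  have y_eq: "?y * ?r = inverse (?x * ?r * fls_const q ^ d)"
  proof -
    have "inverse q * qh powi (1 - int d) * (qh powi (1 - int d) * q ^ d) = inverse q * qh powi ((1 - int d) + (1 - int d) + 2 * int d)"
      by (subst f.rt.qh_powi_even) (simp only: power_int_add[OF disjI1[OF f.rt.qh0]] mult.assoc)
    also have "(1 - int d) + (1 - int d) + 2 * int d = 2"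
      by simp
    also have "inverse q * qh powi 2 = 1"
      using q0 qh by simp
    finally have "inverse q * qh powi (1 - int d) = inverse (qh powi (1 - int d) * q ^ d)"
      by (metis inverse_unique mult.commute)
    then show ?thesis
      unfolding mult.assoc fls_const_power[symmetric] fls_const_mult_const inverse_mult_distrib fls_inverse_const by simp
  qed
  let ?K = "fused \<iota> q qh Kmat d ?x" and ?N = "K_dual q qh ebp ebm kbp kbm d ?x"
  have dK: "dim_row ?K = d + 1" "dim_col ?K = d + 1"
    by (simp_all add: dim_fused)
  interpret n: fused_match id q qh "knum ebm ebp (- kbm) (- kbp)" Gminus "K_num_half q ebm ebp (- kbm) (- kbp)"
    by (rule fused_match_num[OF qh])
  have K_num: "K_num q qh ebm ebp (- kbm) (- kbp) = fused id q qh (K_num_half q ebm ebp (- kbm) (- kbp))"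
    by (simp add: K_num_def id_def)
  have dN: "dim_row ?N = d + 1" "dim_col ?N = d + 1"
    by (simp_all add: K_dual_def K_num dim_fused)
  let ?A = "\<lambda>m n. qscalars.cop J (fls_const q) Nser d (?y * ?r) (op.dl n) m" and ?B = "\<lambda>n m. op.cop Kser d (?x * ?r) (op.dl m) n"
  have Nent: "J (?N $$ (m, n)) = J (?c * fls_const (f.rt.sc d m / f.rt.sc d n)) * ?A m n" if "m \<le> d" "n \<le> d" for m n
  proof -
    have "?N $$ (m, n) = ?c * fused id q qh (K_num_half q ebm ebp (- kbm) (- kbp)) d ?y $$ (n, m)"
      using that by (simp add: K_dual_def K_num dim_fused)
    also have "\<dots> = ?c * (fls_const (f.rt.sc d m / f.rt.sc d n)
        * qscalars.cop id (fls_const q) (knum ebm ebp (- kbp) (- kbm)) d (?y * ?r) (n.dl n) m)"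
      using num_fused_transpose[OF qh y that] by simp
    finally have "J (?N $$ (m, n)) = J (?c * fls_const (f.rt.sc d m / f.rt.sc d n))
        * J (qscalars.cop id (fls_const q) (knum ebm ebp (- kbp) (- kbm)) d (?y * ?r) (n.dl n) m)"
      by (simp only: ser.i_mult mult.assoc)
    also have "J (qscalars.cop id (fls_const q) (knum ebm ebp (- kbp) (- kbm)) d (?y * ?r) (n.dl n) m)
        = op.cop (\<lambda>x a b. J (knum ebm ebp (- kbp) (- kbm) x a b)) d (?y * ?r) (\<lambda>m. J (n.dl n m)) m"
      by (rule op.cop_lift[symmetric])
    also have "(\<lambda>m. J (n.dl n m)) = op.dl n"
      by (simp add: fun_eq_iff n.dl_def op.dl_def of_bool_def)
    finally show ?thesis
      unfolding Nser_def[abs_def] .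
  qed
  have pull: "J a * A * (J b * B) = J a * (J b * (A * B))" for a b A B
    by (simp only: mult.assoc ser.i_left_comm[of A])
  have "transfer qh d = (\<Sum>m<d + 1. \<Sum>n<d + 1. J (?N $$ (m, n)) * ?K $$ (n, m))"
    unfolding transfer_def mat_trace_def by (simp add: dK dN scalar_prod_def atLeast0LessThan)
  also have "\<dots> = (\<Sum>m<d + 1. \<Sum>n<d + 1. J ?c * (?A m n * ?B n m))"
  proof (intro sum.cong refl)
    fix m n
    assume "m \<in> {..<d + 1}" "n \<in> {..<d + 1}"
    then have mn: "m \<le> d" "n \<le> d"
      by simp_all
    have "fls_const (f.rt.sc d m / f.rt.sc d n) * fls_const (f.rt.sc d n / f.rt.sc d m) = 1"
      unfolding fls_const_mult_const using f.rt.sc_nz mn by simp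
    note st = arg_cong[OF this, of "\<lambda>s. J (?c * s) * (?A m n * ?B n m)"]
    have "J (?N $$ (m, n)) * ?K $$ (n, m) = J (?c * fls_const (f.rt.sc d m / f.rt.sc d n)) * (J (fls_const (f.rt.sc d n / f.rt.sc d m)) * (?A m n * ?B n m))"
      unfolding Nent[OF mn] f.fused_entry[OF x mn(2,1)] by (rule pull)
    also have "\<dots> = J ?c * (?A m n * ?B n m)"
      unfolding ser.i_i using st by (simp only: mult.assoc mult_1_right)
    finally show "J (?N $$ (m, n)) * ?K $$ (n, m) = J ?c * (?A m n * ?B n m)" .
  qed
  also have "\<dots> = J ?c * (\<Sum>m\<le>d. \<Sum>n\<le>d. ?A m n * ?B n m)"
    by (simp add: sum_distrib_left lessThan_Suc_atMost)
  also have "(\<Sum>m\<le>d. \<Sum>n\<le>d. ?A m n * ?B n m) = pair.tau d (?x * ?r)"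
    unfolding pair.tau_def y_eq[symmetric] by (intro sum.cong refl) (rule op.cop_expand[symmetric])
  finally show ?thesis .
qed

text \<open>As \<open>genset\<close> is commutative it lies in its own commutant, so its double
  commutant lies in the commutant as well; the coefficients of one transfer series are in the
  latter, and those of the other commute with everything in it.\<close>

lemma transfer_commute:
  assumes qh: "qh\<^sup>2 = q"
  shows "fls_nth (transfer qh d) m * fls_nth (transfer qh e) n = fls_nth (transfer qh e) n * fls_nth (transfer qh d) m"
proof -
  have qh0: "qh \<noteq> 0"
    using qh q0 by auto
  have c: "coefs (commutant genset) (transfer qh d)" for d
    unfolding transfer_tau[OF qh] by (intro coefs_closed coefs_tau) (simp add: qh0 subdegree_scale)
  then have "fls_nth (transfer qh e) n \<in> commutant genset"
    using genset_commute unfolding coefs_def commutant_def by blast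
  then show ?thesis
    using c[of d] unfolding coefs_def commutant_def by blast
qed

end

section \<open>Passage to the quotient algebra\<close>

locale coeff_hom =
  fixes h :: "'a::ring_1 \<Rightarrow> 'b::ring_1"
  assumes h_add: "h (x + y) = h x + h y" and h_mult: "h (x * y) = h x * h y" and h_one: "h 1 = 1"
begin

lemma h_zero: "h 0 = 0"
  using h_add[of 0 0] by simp

lemma h_minus: "h (- x) = - h x"
  using h_add[of x "- x"] by (simp add: h_zero eq_neg_iff_add_eq_0 add.commute)

lemma h_diff: "h (x - y) = h x - h y"
  using h_add[of x "- y"] by (simp add: h_minus)

lemma h_sum: "h (sum g A) = (\<Sum>x\<in>A. h (g x))"
  by (induction A rule: infinite_finite_induct) (simp_all add: h_add h_zero)

abbreviation H :: "'a fls \<Rightarrow> 'b fls" where "H \<equiv> fls_map h"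

lemma H_nth: "fls_nth (H f) n = h (fls_nth f n)"
  by (simp add: fls_nth_fls_map h_zero)

lemma H_add: "H (f + g) = H f + H g"
  and H_diff: "H (f - g) = H f - H g"
  and H_one: "H 1 = 1"
  and H_zero: "H 0 = 0"
  and H_const: "H (fls_const c) = fls_const (h c)"
  by (rule fls_eqI, simp add: H_nth h_add h_diff h_one h_zero)+

lemma H_mult: "H (f * g) = H f * H g"
proof (rule fls_eqI)
  fix n
  have "fls_nth (H f * H g) n = (\<Sum>i=fls_subdegree f..n - fls_subdegree g. fls_nth (H f) i * fls_nth (H g) (n - i))"
    by (rule fls_times_nth_bounds) (simp_all add: H_nth h_zero)
  then show "fls_nth (H (f * g)) n = fls_nth (H f * H g) n"
    by (simp add: H_nth fls_times_nth(2) h_sum h_mult)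
qed

lemma H_sum: "H (sum g A) = (\<Sum>x\<in>A. H (g x))"
  by (induction A rule: infinite_finite_induct) (simp_all add: H_add H_zero)

lemma map_mat_mult: "dim_col A = dim_row B \<Longrightarrow> map_mat H (A * B) = map_mat H A * map_mat H B"
  by (rule eq_matI) (simp_all add: scalar_prod_def H_sum H_mult)

lemma map_mat_trace: "dim_row A = dim_col A \<Longrightarrow> H (mat_trace A) = mat_trace (map_mat H A)"
  by (simp add: mat_trace_def H_sum)

lemma map_mat_kron: "map_mat H (kron A B) = kron (map_mat H A) (map_mat H B)"
proof (rule eq_matI)
  fix i j
  assume "i < dim_row (kron (map_mat H A) (map_mat H B))" "j < dim_col (kron (map_mat H A) (map_mat H B))"
  then have ij: "i < dim_row A * dim_row B" "j < dim_col A * dim_col B"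
    by (simp_all add: kron_def)
  then have "0 < dim_row B" "0 < dim_col B"
    by (auto intro: Nat.gr0I)
  then have "i div dim_row B < dim_row A" "j div dim_col B < dim_col A" "i mod dim_row B < dim_row B" "j mod dim_col B < dim_col B"
    using ij by (simp_all add: less_mult_imp_div_less)
  then show "map_mat H (kron A B) $$ (i, j) = kron (map_mat H A) (map_mat H B) $$ (i, j)"
    using ij by (simp add: kron_def H_mult)
qed (simp_all add: kron_def)

lemma map_mat_one: "map_mat H (1\<^sub>m n) = 1\<^sub>m n"
  by (rule eq_matI) (simp_all add: H_one H_zero)

end

locale scalar_hom = coeff_hom h for h :: "'a::ring_1 \<Rightarrow> 'b::ring_1" +
  fixes \<sigma> :: "complex \<Rightarrow> 'a" and \<iota> :: "complex \<Rightarrow> 'b"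
  assumes h_scalar: "h (\<sigma> c) = \<iota> c" and \<sigma>_zero: "\<sigma> 0 = 0"
begin

lemma \<iota>_zero: "\<iota> 0 = 0"
  using h_scalar[of 0] by (simp add: \<sigma>_zero h_zero)

lemma H_scalar: "H (fls_map \<sigma> f) = fls_map \<iota> f"
  by (rule fls_eqI) (simp add: H_nth fls_nth_fls_map \<sigma>_zero \<iota>_zero h_scalar)

lemma map_mat_scalar: "map_mat H (map_mat (fls_map \<sigma>) A) = map_mat (fls_map \<iota>) A"
  "map_mat H (map_mat (\<lambda>c. fls_const (\<sigma> c)) E) = map_mat (\<lambda>c. fls_const (\<iota> c)) E"
  by (rule eq_matI; simp add: H_scalar H_const h_scalar)+

lemma map_mat_fused:
  assumes K: "\<And>x. dim_row (K x) = 2" "\<And>x. dim_col (K x) = 2"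
  shows "map_mat H (fused \<sigma> q qh K d x) = fused \<iota> q qh (\<lambda>x. map_mat H (K x)) d x"
proof (induction d arbitrary: x)
  case 0
  show ?case
    by (simp add: map_mat_one)
next
  case (Suc e)
  have dimR: "dim_row (Rmat q qh e z) = 2 * Suc e" "dim_col (Rmat q qh e z) = 2 * Suc e" for z
    by (cases "e = 0"; simp add: Rmat_def Let_def half_qpow_def kron_def sigma_z_def S_three_def mat1_def mat_of_rows_list_def)+
  have dims: "dim_row (fus_F q (Suc e)) = Suc e + 1" "dim_col (fus_F q (Suc e)) = 2 * Suc e"
    "dim_row (fus_E q (Suc e)) = 2 * Suc e" "dim_col (fus_E q (Suc e)) = Suc e + 1"
    "dim_row (kron A B) = dim_row A * dim_row B" "dim_col (kron A B) = dim_col A * dim_col B" for A B :: "'c::times mat"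
    by (simp_all add: fus_F_def fus_E_def mat1_def kron_def)
  show ?case
    unfolding fused.simps Let_def
    using Suc.IH by (simp only: map_mat_mult map_mat_kron map_mat_scalar map_mat_one index_mult_mat index_map_mat dims dimR dim_fused K index_one_mat Suc_eq_plus1[symmetric])
qed

end

lemma dim_K_dual: "dim_row (K_dual q qh ebp ebm kbp kbm d x) = d + 1" "dim_col (K_dual q qh ebp ebm kbp kbm d x) = d + 1"
  by (simp_all add: K_dual_def K_num_def dim_fused)

lemma (in aq_transfer) T_free_transfer:
  assumes h: "scalar_hom h fscal \<iota>"
    and gen: "\<And>k. h (Wneg k) = Wn k" "\<And>k. h (Wpos k) = Wp k" "\<And>k. h (Gen k) = Gn k" "\<And>k. h (Gtil k) = Gt k"
  shows "h (fls_nth (T_free q qh kp km ebp ebm kbp kbm d) n) = fls_nth (transfer qh d) n"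
proof -
  interpret h: scalar_hom h fscal \<iota>
    by (rule h)
  have series: "h.H (gen_series q a x) = gser (\<lambda>k. h (a k)) (inverse (Ufun q x))" for a x
    by (rule fls_eqI) (simp add: h.H_nth fls_nth_gen_series gser_nth h.h_sum h.h_mult h.h_scalar)
  have map2: "map_mat h.H (mat_of_rows_list 2 [[a, b], [c, e]]) = mat_of_rows_list 2 [[h.H a, h.H b], [h.H c, h.H e]]" for a b c e
    by (rule eq_matI) (auto simp: mat_of_rows_list_def numeral_2_eq_2 less_Suc_eq)
  have K: "(\<lambda>x. map_mat h.H (K_op_half q kp km x)) = Kmat"
    unfolding K_op_half_def Let_def map2 h.H_add h.H_diff h.H_mult h.H_scalar h.H_const h.h_scalar series gen
    by (simp add: fun_eq_iff Kmat_def Kser_def sW_def sV_def)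
  have Kd: "dim_row (K_op_half q kp km x) = 2" "dim_col (K_op_half q kp km x) = 2" for x
    by (simp_all add: K_op_half_def Let_def mat_of_rows_list_def)
  have "h.H (T_free q qh kp km ebp ebm kbp kbm d) = transfer qh d"
    unfolding T_free_def transfer_def K_op_def
    by (simp add: h.map_mat_trace h.map_mat_mult dim_fused dim_K_dual h.map_mat_scalar h.map_mat_fused[OF Kd] K)
  then show ?thesis
    by (simp add: h.H_nth[symmetric])
qed

section \<open>The augmentation and one ring for all quotients\<close>

definition aug :: "free_alg \<Rightarrow> complex" where
  "aug a = Poly_Mapping.lookup a 0"

lemma aug_add: "aug (a + b) = aug a + aug b"
  and aug_diff: "aug (a - b) = aug a - aug b"
  and aug_zero: "aug 0 = 0"
  by (simp_all add: aug_def lookup_add lookup_minus)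

lemma aug_single: "aug (Poly_Mapping.single w c) = (if w = 0 then c else 0)"
  by (simp add: aug_def lookup_single when_def)

lemma gword_add_eq_0: "v + w = 0 \<longleftrightarrow> v = 0 \<and> w = (0 :: gword)"
  by (cases v; cases w) (simp add: zero_gword_def)

lemma free_alg_induct [case_names single add]:
  fixes a :: free_alg
  assumes "\<And>w c. P (Poly_Mapping.single w c)" "\<And>a b. P a \<Longrightarrow> P b \<Longrightarrow> P (a + b)"
  shows "P a"
proof (induction a rule: update_induct)
  case const
  show ?case
    using assms(1)[of 0 0] by simp
next
  case (update a w c)
  have "Poly_Mapping.update w c a = a + Poly_Mapping.single w c"
    using update(1) by (intro poly_mapping_eqI) (auto simp: lookup_update lookup_add lookup_single when_def in_keys_iff)
  then show ?case
    using assms update(3) by simp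
qed

text \<open>A concatenation of words is empty only when both words are, so constant terms
  multiply.\<close>

lemma aug_mult: "aug (a * b) = aug a * aug b"
proof (induction a rule: free_alg_induct)
  case (single w c)
  show ?case
    by (induction b rule: free_alg_induct) (auto simp: mult_single aug_single gword_add_eq_0 distrib_left aug_add)
next
  case (add a b)
  then show ?case
    by (simp add: distrib_right aug_add)
qed

lemma fscal_central: "fscal c * b = b * fscal c"
  by (induction b rule: free_alg_induct) (simp_all add: fscal_def mult_single mult.commute distrib_left distrib_right)

lemma fscal_add: "fscal (c + d) = fscal c + fscal d"
  and fscal_mult: "fscal (c * d) = fscal c * fscal d"
  and fscal_one: "fscal 1 = 1"
  and fscal_zero: "fscal 0 = 0"
  by (simp_all add: fscal_def single_add mult_single)

lemma aug_simps: "aug (fscal c) = c" "aug (fgen g) = 0" "aug 1 = 1"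
  by (simp_all add: fscal_def fgen_def aug_single zero_gword_def) (simp add: aug_def lookup_one zero_gword_def)

definition tsi :: "free_alg set \<Rightarrow> bool" where
  "tsi I \<longleftrightarrow> 0 \<in> I \<and> (\<forall>x\<in>I. \<forall>y\<in>I. x + y \<in> I \<and> x - y \<in> I) \<and> (\<forall>x\<in>I. \<forall>a. a * x \<in> I \<and> x * a \<in> I)"

text \<open>A type cannot depend on the parameters of the algebra, so one ring receives all the quotients at once: the product
  over all two-sided ideals. In the components other than the relevant one, generators are sent to 0, which satisfies
  the relations.\<close>

definition qrel :: "(free_alg set \<Rightarrow> free_alg) \<Rightarrow> (free_alg set \<Rightarrow> free_alg) \<Rightarrow> bool" where
  "qrel f g \<longleftrightarrow> (\<forall>I. tsi I \<longrightarrow> f I - g I \<in> I)"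

lemma tsi_simps:
  assumes "tsi I"
  shows "0 \<in> I" "x \<in> I \<Longrightarrow> y \<in> I \<Longrightarrow> x + y \<in> I" "x \<in> I \<Longrightarrow> y \<in> I \<Longrightarrow> x - y \<in> I"
    "x \<in> I \<Longrightarrow> a * x \<in> I" "x \<in> I \<Longrightarrow> x * a \<in> I"
  using assms by (auto simp: tsi_def)

quotient_type quot_alg = "free_alg set \<Rightarrow> free_alg" / qrel
proof (rule equivpI)
  show "reflp qrel"
    by (auto simp: reflp_def qrel_def tsi_simps)
  have "g I - f I \<in> I" if "tsi I" "f I - g I \<in> I" for f g :: "free_alg set \<Rightarrow> free_alg" and I
    using tsi_simps(3)[OF that(1) tsi_simps(1)[OF that(1)] that(2)] by simp
  then show "symp qrel"
    by (auto simp: symp_def qrel_def)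
  have "f I - k I \<in> I" if "tsi I" "f I - g I \<in> I" "g I - k I \<in> I" for f g k :: "free_alg set \<Rightarrow> free_alg" and I
    using tsi_simps(2)[OF that] by simp
  then show "transp qrel"
    unfolding transp_def qrel_def by blast
qed

instantiation quot_alg :: ring_1
begin

lift_definition zero_quot_alg :: quot_alg is "\<lambda>I. 0" .
lift_definition one_quot_alg :: quot_alg is "\<lambda>I. 1" .

lift_definition plus_quot_alg :: "quot_alg \<Rightarrow> quot_alg \<Rightarrow> quot_alg" is "\<lambda>f g I. f I + g I"
  unfolding qrel_def by (metis tsi_simps(2) add_diff_add)

lift_definition minus_quot_alg :: "quot_alg \<Rightarrow> quot_alg \<Rightarrow> quot_alg" is "\<lambda>f g I. f I - g I"
  unfolding qrel_def
proof (intro allI impI)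
  fix f f' g g' :: "free_alg set \<Rightarrow> free_alg" and I
  assume "\<forall>I. tsi I \<longrightarrow> f I - f' I \<in> I" "\<forall>I. tsi I \<longrightarrow> g I - g' I \<in> I" and I: "tsi I"
  then have "(f I - f' I) - (g I - g' I) \<in> I"
    using tsi_simps(3) by blast
  then show "f I - g I - (f' I - g' I) \<in> I"
    by (simp add: algebra_simps)
qed

lift_definition uminus_quot_alg :: "quot_alg \<Rightarrow> quot_alg" is "\<lambda>f I. - f I"
  unfolding qrel_def
proof (intro allI impI)
  fix f f' :: "free_alg set \<Rightarrow> free_alg" and I
  assume "\<forall>I. tsi I \<longrightarrow> f I - f' I \<in> I" and I: "tsi I"
  then have "0 - (f I - f' I) \<in> I"
    using tsi_simps(1,3) by blast
  then show "- f I - - f' I \<in> I"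
    by simp
qed

lift_definition times_quot_alg :: "quot_alg \<Rightarrow> quot_alg \<Rightarrow> quot_alg" is "\<lambda>f g I. f I * g I"
  unfolding qrel_def
proof (intro allI impI)
  fix f f' g g' :: "free_alg set \<Rightarrow> free_alg" and I
  assume "\<forall>I. tsi I \<longrightarrow> f I - f' I \<in> I" "\<forall>I. tsi I \<longrightarrow> g I - g' I \<in> I" and I: "tsi I"
  then have "(f I - f' I) * g I \<in> I" "f' I * (g I - g' I) \<in> I"
    using tsi_simps(4,5) by blast+
  then have "(f I - f' I) * g I + f' I * (g I - g' I) \<in> I"
    by (rule tsi_simps(2)[OF I])
  then show "f I * g I - f' I * g' I \<in> I"
    by (simp add: algebra_simps)
qed

instance
proof
  fix a b c :: quot_alg
  have refl: "qrel f f" for f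
    by (simp add: qrel_def tsi_simps)
  show "a + b + c = a + (b + c)" "a * b * c = a * (b * c)" "(a + b) * c = a * c + b * c" "a * (b + c) = a * b + a * c"
    "a + b = b + a" "0 + a = a" "- a + a = 0" "a - b = a + - b" "1 * a = a" "a * 1 = a"
    by (transfer, simp add: algebra_simps refl)+
  \<comment> \<open>The zero ideal is one of the components, which keeps 0 and 1 apart even though
    other components may collapse.\<close>
  have "tsi {0}"
    by (simp add: tsi_def)
  then show "(0 :: quot_alg) \<noteq> 1"
    by transfer (auto simp: qrel_def intro!: exI[of _ "{0}"])
qed

end

text \<open>Outside the component of interest an element acts by its constant term, not by 0, so
  that the map preserves the unit.\<close>

definition quot_at :: "free_alg set \<Rightarrow> free_alg \<Rightarrow> quot_alg" where
  "quot_at I a = abs_quot_alg (\<lambda>J. if J = I then a else fscal (aug a))"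

lemma quot_at_hom: "coeff_hom (quot_at I)"
proof
  fix x y
  show "quot_at I (x + y) = quot_at I x + quot_at I y"
    unfolding quot_at_def plus_quot_alg.abs_eq by (rule arg_cong[of _ _ abs_quot_alg]) (simp add: fun_eq_iff aug_add fscal_add)
  show "quot_at I (x * y) = quot_at I x * quot_at I y"
    unfolding quot_at_def times_quot_alg.abs_eq by (rule arg_cong[of _ _ abs_quot_alg]) (simp add: fun_eq_iff aug_mult fscal_mult)
  show "quot_at I 1 = 1"
    unfolding quot_at_def one_quot_alg.abs_eq by (rule arg_cong[of _ _ abs_quot_alg]) (simp add: fun_eq_iff aug_simps fscal_one)
qed

lemma quot_at_central: "quot_at I (fscal c) * b = b * quot_at I (fscal c)"
proof (induction b rule: quot_alg.abs_induct)
  case (1 f)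
  show ?case
    unfolding quot_at_def times_quot_alg.abs_eq
    by (rule arg_cong[of _ _ abs_quot_alg]) (simp add: fun_eq_iff aug_simps fscal_central)
qed

lemma quot_at_eqD: "tsi I \<Longrightarrow> quot_at I a = quot_at I b \<Longrightarrow> a - b \<in> I"
  unfolding quot_at_def quot_alg.abs_eq_iff qrel_def by auto

lemma quot_at_eqI: "a - b \<in> I \<Longrightarrow> aug a = aug b \<Longrightarrow> quot_at I a = quot_at I b"
  unfolding quot_at_def quot_alg.abs_eq_iff qrel_def by (auto simp: tsi_simps)

section \<open>Return to the quotient of the free algebra by its ideal\<close>

lemma ring_free_ring: "ring free_ring"
proof (rule ringI)
  show "abelian_group free_ring"
  proof (rule abelian_groupI)
    fix x
    show "\<exists>y\<in>carrier free_ring. y \<oplus>\<^bsub>free_ring\<^esub> x = \<zero>\<^bsub>free_ring\<^esub>"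
      by (rule bexI[of _ "- x"]) (simp_all add: free_ring_def)
  qed (simp_all add: free_ring_def add_ac)
  show "monoid free_ring"
    by (rule monoidI) (simp_all add: free_ring_def mult.assoc)
qed (simp_all add: free_ring_def distrib_left distrib_right)

lemma ideal_Aq: "ideal (Aq_ideal q kp km) free_ring"
  unfolding Aq_ideal_def by (rule ring.genideal_ideal[OF ring_free_ring]) (simp add: free_ring_def)

lemma Aq_relations_in_ideal: "(a, b) \<in> Aq_relations q kp km \<Longrightarrow> a - b \<in> Aq_ideal q kp km"
  unfolding Aq_ideal_def by (rule subsetD[OF ring.genideal_self[OF ring_free_ring]]) (auto simp: free_ring_def)

lemma tsi_Aq: "tsi (Aq_ideal q kp km)"
proof -
  note sub = ideal.axioms(1)[OF ideal_Aq, of q kp km]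
  have r: "x + y \<in> Aq_ideal q kp km" "a * x \<in> Aq_ideal q kp km" "x * a \<in> Aq_ideal q kp km"
    if "x \<in> Aq_ideal q kp km" "y \<in> Aq_ideal q kp km" for x y a
    using additive_subgroup.a_closed[OF sub that] ideal.I_l_closed[OF ideal_Aq that(1), of a]
      ideal.I_r_closed[OF ideal_Aq that(1), of a] by (simp_all add: free_ring_def)
  have "x - y \<in> Aq_ideal q kp km" if "x \<in> Aq_ideal q kp km" "y \<in> Aq_ideal q kp km" for x y
    using r(1)[OF that(1) r(2)[OF that(2,2), of "- 1"]] by simp
  moreover have "0 \<in> Aq_ideal q kp km"
    using additive_subgroup.zero_closed[OF sub] by (simp add: free_ring_def)
  ultimately show ?thesis
    using r by (auto simp: tsi_def)
qed

lemma Aq_proj_eq: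
  assumes "a - b \<in> Aq_ideal q kp km"
  shows "Aq_proj q kp km a = Aq_proj q kp km b"
proof -
  have I: "tsi (Aq_ideal q kp km)"
    by (rule tsi_Aq)
  have mem: "z \<in> Aq_proj q kp km a \<longleftrightarrow> (\<exists>i\<in>Aq_ideal q kp km. z = i + a)" for z a
    by (simp add: Aq_proj_def a_r_coset_def' free_ring_def)
  have sub: "Aq_proj q kp km a \<subseteq> Aq_proj q kp km b" if "a - b \<in> Aq_ideal q kp km" for a b
  proof
    fix z
    assume "z \<in> Aq_proj q kp km a"
    then obtain i where i: "i \<in> Aq_ideal q kp km" "z = i + a"
      unfolding mem by blast
    have "z = (i + (a - b)) + b"
      using i(2) by simp
    moreover have "i + (a - b) \<in> Aq_ideal q kp km"
      using I i(1) that by (rule tsi_simps(2))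
    ultimately show "z \<in> Aq_proj q kp km b"
      unfolding mem by blast
  qed
  have "0 - (a - b) \<in> Aq_ideal q kp km"
    using I tsi_simps(1)[OF I] assms by (rule tsi_simps(3))
  then show ?thesis
    using sub[OF assms] sub[of b a] by simp
qed

lemma laurent_comm_Aq:
  assumes "\<And>m n. a m * b n - b n * a m \<in> Aq_ideal q kp km"
  shows "laurent_comm (Aq q kp km) (\<lambda>m. Aq_proj q kp km (a m)) (\<lambda>n. Aq_proj q kp km (b n)) = (\<lambda>m n. \<zero>\<^bsub>Aq q kp km\<^esub>)"
proof (intro ext)
  fix m n
  interpret ideal "Aq_ideal q kp km" free_ring
    by (rule ideal_Aq)
  interpret p: ring_hom_ring free_ring "Aq q kp km" "Aq_proj q kp km"
    unfolding Aq_def Aq_proj_def[abs_def] by (rule rcos_ring_hom_ring)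
  have c: "x \<in> carrier free_ring" for x
    by (simp add: free_ring_def)
  have mult: "Aq_proj q kp km x \<otimes>\<^bsub>Aq q kp km\<^esub> Aq_proj q kp km y = Aq_proj q kp km (x * y)" for x y
    using p.hom_mult[OF c c, of x y] by (simp add: free_ring_def)
  show "laurent_comm (Aq q kp km) (\<lambda>m. Aq_proj q kp km (a m)) (\<lambda>n. Aq_proj q kp km (b n)) m n = \<zero>\<^bsub>Aq q kp km\<^esub>"
    unfolding laurent_comm_def mult Aq_proj_eq[OF assms] a_minus_def by (rule p.S.r_neg[OF p.hom_closed[OF c]])
qed

lemma in_UN2: "p \<in> F k l \<Longrightarrow> p \<in> (\<Union>k l. F k l)"
  by blast

lemma Aq_relations_mem:
  "(comm (Wneg 0) (Wpos k), fscal (1 / (q + inverse q)) * (Gtil k - Gen k)) \<in> Aq_relations q kp km"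
  "(comm (Wneg k) (Wpos 0), fscal (1 / (q + inverse q)) * (Gtil k - Gen k)) \<in> Aq_relations q kp km"
  "(qcomm q (Wneg 0) (Gen k), fscal (rho q kp km) * (Wneg (k+1) - Wpos k)) \<in> Aq_relations q kp km"
  "(qcomm q (Gtil k) (Wneg 0), fscal (rho q kp km) * (Wneg (k+1) - Wpos k)) \<in> Aq_relations q kp km"
  "(qcomm q (Gen k) (Wpos 0), fscal (rho q kp km) * (Wpos (k+1) - Wneg k)) \<in> Aq_relations q kp km"
  "(qcomm q (Wpos 0) (Gtil k), fscal (rho q kp km) * (Wpos (k+1) - Wneg k)) \<in> Aq_relations q kp km"
  "(comm (Wneg k) (Wneg l), 0) \<in> Aq_relations q kp km"
  "(comm (Wpos k) (Wpos l), 0) \<in> Aq_relations q kp km"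
  "(comm (Gen k) (Gen l), 0) \<in> Aq_relations q kp km"
  "(comm (Gtil k) (Gtil l), 0) \<in> Aq_relations q kp km"
  "(comm (Wneg k) (Wpos l) + comm (Wpos k) (Wneg l), 0) \<in> Aq_relations q kp km"
  "(comm (Wneg k) (Gen l) + comm (Gen k) (Wneg l), 0) \<in> Aq_relations q kp km"
  "(comm (Wneg k) (Gtil l) + comm (Gtil k) (Wneg l), 0) \<in> Aq_relations q kp km"
  "(comm (Wpos k) (Gen l) + comm (Gen k) (Wpos l), 0) \<in> Aq_relations q kp km"
  "(comm (Wpos k) (Gtil l) + comm (Gtil k) (Wpos l), 0) \<in> Aq_relations q kp km"
  "(comm (Gtil k) (Gen l) + comm (Gen k) (Gtil l), 0) \<in> Aq_relations q kp km"
  unfolding Aq_relations_def by (rule in_UN2[of _ _ k l], simp)+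

theorem corollary3p7:
  fixes q qh kp km ebp ebm kbp kbm :: complex and d d' :: nat
  assumes "q \<noteq> 0" and "\<And>n::nat. n > 0 \<Longrightarrow> q ^ n \<noteq> 1"
    and "qh\<^sup>2 = q"
    and "kp \<noteq> 0" and "km \<noteq> 0"
  shows "laurent_comm (Aq q kp km)
           (T_gen q qh kp km ebp ebm kbp kbm d)
           (T_gen q qh kp km ebp ebm kbp kbm d')
         = (\<lambda>m n. \<zero>\<^bsub>Aq q kp km\<^esub>)"
proof -
  define h where "h = quot_at (Aq_ideal q kp km)"
  define \<iota> where "\<iota> c = h (fscal c)" for c
  interpret h: coeff_hom h
    unfolding h_def by (rule quot_at_hom)
  note hom = h.h_add h.h_mult h.h_one h.h_diff h.h_zero \<iota>_def
  note aug = aug_add aug_mult aug_diff aug_zero aug_simps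
  \<comment> \<open>The condition on augmentations will hold because both sides of every defining
    relation have constant term 0.\<close>
  have rel: "aug a = aug b \<Longrightarrow> h a = h b" if "(a, b) \<in> Aq_relations q kp km" for a b
    unfolding h_def using quot_at_eqI[OF Aq_relations_in_ideal[OF that]] .
  note rels = rel[OF Aq_relations_mem(1)] rel[OF Aq_relations_mem(2)] rel[OF Aq_relations_mem(3)] rel[OF Aq_relations_mem(4)]
    rel[OF Aq_relations_mem(5)] rel[OF Aq_relations_mem(6)] rel[OF Aq_relations_mem(7)] rel[OF Aq_relations_mem(8)]
    rel[OF Aq_relations_mem(9)] rel[OF Aq_relations_mem(10)] rel[OF Aq_relations_mem(11)] rel[OF Aq_relations_mem(12)]
    rel[OF Aq_relations_mem(13)] rel[OF Aq_relations_mem(14)] rel[OF Aq_relations_mem(15)] rel[OF Aq_relations_mem(16)]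
  note rels' = rels[unfolded comm_def qcomm_def aug hom]
  interpret scalars \<iota>
    by unfold_locales (simp_all add: hom fscal_add fscal_mult fscal_one, simp add: h_def quot_at_central)
  interpret aq_transfer \<iota> q kp km "\<lambda>k. h (Wneg k)" "\<lambda>k. h (Wpos k)" "\<lambda>k. h (Gen k)" "\<lambda>k. h (Gtil k)" ebp ebm kbp kbm
  proof unfold_locales
    fix k l
    show "h (Wneg k) * h (Wneg l) = h (Wneg l) * h (Wneg k)" "h (Wpos k) * h (Wpos l) = h (Wpos l) * h (Wpos k)"
      "h (Gen k) * h (Gen l) = h (Gen l) * h (Gen k)" "h (Gtil k) * h (Gtil l) = h (Gtil l) * h (Gtil k)"
      using rels'(7-10)[of k l] by simp_all
  qed (use rels' assms in \<open>simp_all add: hom\<close>)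
  have sh: "scalar_hom h fscal \<iota>"
    by unfold_locales (simp_all add: \<iota>_def fscal_zero)
  have T: "h (fls_nth (T_free q qh kp km ebp ebm kbp kbm d) n) = fls_nth (transfer qh d) n" for d n
    by (rule T_free_transfer[OF sh]) (rule refl)+
  have "fls_nth (T_free q qh kp km ebp ebm kbp kbm d) m * fls_nth (T_free q qh kp km ebp ebm kbp kbm d') n
    - fls_nth (T_free q qh kp km ebp ebm kbp kbm d') n * fls_nth (T_free q qh kp km ebp ebm kbp kbm d) m \<in> Aq_ideal q kp km" for m n
  proof (rule quot_at_eqD[OF tsi_Aq], fold h_def)
    show "h (fls_nth (T_free q qh kp km ebp ebm kbp kbm d) m * fls_nth (T_free q qh kp km ebp ebm kbp kbm d') n)
      = h (fls_nth (T_free q qh kp km ebp ebm kbp kbm d') n * fls_nth (T_free q qh kp km ebp ebm kbp kbm d) m)"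
      unfolding h.h_mult T by (rule transfer_commute[OF assms(3)])
  qed
  then show ?thesis
    unfolding T_gen_def[abs_def] by (rule laurent_comm_Aq)
qed

end
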